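(* Let $V$ be a finite-dimensional $\mathbb{R}$-vector space, let $K\subseteq\mathbb{R}$ be a subfield, and let $W$ be a $K$-structure on $V$. Every $W$-semifan in $V$ has a $W$-completion, and every simplicial $W$-semifan in $V$ has a simplicial $W$-completion. That is, for every $W$-semifan $\Sigma$ in $V$ there is a complete $W$-semifan $\widehat{\Sigma}$ in $V$ with $\Sigma\subseteq\widehat{\Sigma}$, and if $\Sigma$ is simplicial then $\widehat{\Sigma}$ can be chosen simplicial.
   Context: A $K$-structure on $V$ is a sub-$K$-vector space $W\subseteq V$ such that the canonical map $\mathbb{R}\otimes_K W\to V$, $a\otimes x\mapsto ax$, is an isomorphism. A subspace of $V$ is $W$-rational if it has a basis contained in $W$. A $W$-halfspace is a closed linear halfspace of $V$ bounded by a $W$-rational linear hyperplane. A $W$-polycone is the intersection of finitely many $W$-halfspaces (equivalently, the conic hull of a finite subset of $W$). A face of a $W$-polycone $\sigma$ is a set $\sigma\cap\ker(u)$ with $u\in V^*$ and $u(\sigma)\subseteq\mathbb{R}_{\geq 0}$ ($u=0$ is allowed, so $\sigma$ is a face of itself). A $W$-polycone is simplicial if it is the conic hull of a linearly independent subset of $V$. A $W$-semifan is a finite set $\Sigma$ of $W$-polycones such that every face of an element of $\Sigma$ lies in $\Sigma$ and, for all $\sigma,\tau\in\Sigma$, $\sigma\cap\tau$ is a face of $\sigma$. A $W$-semifan is simplicial if all its elements are simplicial. A $W$-semifan $\Sigma$ is complete if $\bigcup\Sigma=V$. A $W$-completion of $\Sigma$ is a complete $W$-semifan containing $\Sigma$.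 *)

theory Defs
  imports
    "HOL-Analysis.Analysis"
    "HOL-Library.Poly_Mapping"
    "HOL-Computational_Algebra.Group_Closure"
begin

definition subfield_of_reals :: "real set \<Rightarrow> bool" where
  "subfield_of_reals K \<longleftrightarrow>
     0 \<in> K \<and> 1 \<in> K \<and>
     (\<forall>a\<in>K. \<forall>b\<in>K. a + b \<in> K \<and> a * b \<in> K) \<and>
     (\<forall>a\<in>K. - a \<in> K \<and> inverse a \<in> K)"

definition sub_vector_space :: "real set \<Rightarrow> 'a::real_vector set \<Rightarrow> bool" where
  "sub_vector_space K W \<longleftrightarrow>
     0 \<in> W \<and> (\<forall>x\<in>W. \<forall>y\<in>W. x + y \<in> W) \<and> (\<forall>k\<in>K. \<forall>x\<in>W. k *\<^sub>R x \<in> W)"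


text \<open>
  The tensor product of the reals with \<open>W\<close> over \<open>K\<close> is the free abelian group on
  \<open>\<real> \<times> W\<close> modulo the subgroup generated by the relations of a \<open>K\<close>-balanced biadditive map.
\<close>

definition tensor_free :: "'a::real_vector set \<Rightarrow> ((real \<times> 'a) \<Rightarrow>\<^sub>0 int) set" where
  "tensor_free W = {f. Poly_Mapping.keys f \<subseteq> UNIV \<times> W}"

definition tensor_relators ::
    "real set \<Rightarrow> 'a::real_vector set \<Rightarrow> ((real \<times> 'a) \<Rightarrow>\<^sub>0 int) set" where
  "tensor_relators K W =
     {frag_of (a + b, x) - frag_of (a, x) - frag_of (b, x) | a b x. x \<in> W} \<union>
     {frag_of (a, x + y) - frag_of (a, x) - frag_of (a, y) | a x y. x \<in> W \<and> y \<in> W} \<union>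
     {frag_of (a * k, x) - frag_of (a, k *\<^sub>R x) | a k x. k \<in> K \<and> x \<in> W}"

definition tensor_product ::
    "real set \<Rightarrow> 'a::real_vector set \<Rightarrow> ((real \<times> 'a) \<Rightarrow>\<^sub>0 int) set set" where
  "tensor_product K W =
     tensor_free W //
       {(f, g). f \<in> tensor_free W \<and> g \<in> tensor_free W \<and>
                f - g \<in> group_closure (tensor_relators K W)}"

definition tensor_eval :: "((real \<times> 'a::real_vector) \<Rightarrow>\<^sub>0 int) \<Rightarrow> 'a" where
  "tensor_eval f =
     (\<Sum>p\<in>Poly_Mapping.keys f. of_int (Poly_Mapping.lookup f p) *\<^sub>R (fst p *\<^sub>R snd p))"

text \<open>
  The canonical map sends the class of \<open>f\<close> to \<open>tensor_eval f\<close>; \<open>tensor_eval\<close> is constant on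
  classes because it is additive and vanishes on the relators (shown below), so
  \<open>the_elem\<close> is applied to a singleton.
\<close>

definition tensor_canonical_map :: "((real \<times> 'a::real_vector) \<Rightarrow>\<^sub>0 int) set \<Rightarrow> 'a" where
  "tensor_canonical_map c = the_elem (tensor_eval ` c)"

text \<open>
  The canonical map is linear by construction, so it is an isomorphism iff it is bijective.
\<close>

definition K_structure :: "real set \<Rightarrow> 'a::real_vector set \<Rightarrow> bool" where
  "K_structure K W \<longleftrightarrow>
     sub_vector_space K W \<and>
     bij_betw tensor_canonical_map (tensor_product K W) UNIV"

lemma tensor_eval_superset:
  assumes "finite A" "Poly_Mapping.keys f \<subseteq> A"
  shows "tensor_eval f =
    (\<Sum>p\<in>A. of_int (Poly_Mapping.lookup f p) *\<^sub>R (fst p *\<^sub>R snd p))"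
  unfolding tensor_eval_def
  by (rule sum.mono_neutral_left) (use assms in \<open>simp_all add: in_keys_iff\<close>)

lemma tensor_eval_diff: "tensor_eval (f - g) = tensor_eval f - tensor_eval g"
proof -
  define A where "A = Poly_Mapping.keys f \<union> Poly_Mapping.keys g"
  have A: "finite A" "Poly_Mapping.keys f \<subseteq> A" "Poly_Mapping.keys g \<subseteq> A"
    by (auto simp: A_def)
  have fg: "Poly_Mapping.keys (f - g) \<subseteq> A"
    unfolding A_def by (rule keys_diff)
  show ?thesis
    unfolding tensor_eval_superset[OF A(1,2)] tensor_eval_superset[OF A(1,3)]
      tensor_eval_superset[OF A(1) fg]
    by (simp only: lookup_minus of_int_diff scaleR_left_diff_distrib sum_subtractf)
qed

lemma tensor_eval_frag_of [simp]: "tensor_eval (frag_of (a, x)) = a *\<^sub>R x"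
  by (simp add: tensor_eval_def)

lemma tensor_eval_group_closure:
  assumes "f \<in> group_closure (tensor_relators K W)"
  shows "tensor_eval f = 0"
  using assms
proof (induction rule: group_closure.induct)
  case (base s)
  then consider "s = 0"
    | a b x where "s = frag_of (a + b, x) - frag_of (a, x) - frag_of (b, x)"
    | a x y where "s = frag_of (a, x + y) - frag_of (a, x) - frag_of (a, y)"
    | a k x where "s = frag_of (a * k, x) - frag_of (a, k *\<^sub>R x)"
    unfolding tensor_relators_def by blast
  then show ?case
    by cases
       (simp add: tensor_eval_def,
        simp_all add: tensor_eval_diff scaleR_left_distrib scaleR_right_distrib)
qed (simp add: tensor_eval_diff)

lemma tensor_canonical_map_class:
  assumes "c \<in> tensor_product K W" "f \<in> c"
  shows "tensor_canonical_map c = tensor_eval f"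
proof -
  have "tensor_eval g = tensor_eval f" if "g \<in> c" for g
  proof -
    obtain h where c: "c = {g. h \<in> tensor_free W \<and> g \<in> tensor_free W \<and>
        h - g \<in> group_closure (tensor_relators K W)}"
      using assms(1) by (auto simp: tensor_product_def quotient_def)
    have "tensor_eval (h - g) = 0" "tensor_eval (h - f) = 0"
      using assms(2) that c tensor_eval_group_closure by blast+
    then show ?thesis
      by (simp add: tensor_eval_diff)
  qed
  then have "tensor_eval ` c = {tensor_eval f}"
    using assms(2) by blast
  then show ?thesis
    by (simp add: tensor_canonical_map_def)
qed


definition rational_subspace :: "'a::real_vector set \<Rightarrow> 'a set \<Rightarrow> bool" where
  "rational_subspace W S \<longleftrightarrow> (\<exists>B\<subseteq>W. independent B \<and> span B = S)"

text \<open>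
  In finite dimension the linear hyperplanes are the kernels of nonzero linear forms \<open>u\<close>, and
  the closed halfspaces bounded by such a kernel are \<open>{x. 0 \<le> u x}\<close> and \<open>{x. 0 \<le> - u x}\<close>.
\<close>

definition rational_halfspace :: "'a::real_vector set \<Rightarrow> 'a set \<Rightarrow> bool" where
  "rational_halfspace W H \<longleftrightarrow>
     (\<exists>u :: 'a \<Rightarrow> real. linear u \<and> (\<exists>x. u x \<noteq> 0) \<and>
        rational_subspace W {x. u x = 0} \<and> H = {x. 0 \<le> u x})"

text \<open>The empty intersection is allowed and equals the whole space.\<close>

definition polycone :: "'a::real_vector set \<Rightarrow> 'a set \<Rightarrow> bool" where
  "polycone W \<sigma> \<longleftrightarrow>
     (\<exists>\<H>. finite \<H> \<and> (\<forall>H\<in>\<H>. rational_halfspace W H) \<and> \<sigma> = \<Inter>\<H>)"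

definition polycone_face :: "'a::real_vector set \<Rightarrow> 'a set \<Rightarrow> bool" where
  "polycone_face \<tau> \<sigma> \<longleftrightarrow>
     (\<exists>u :: 'a \<Rightarrow> real. linear u \<and> (\<forall>x\<in>\<sigma>. 0 \<le> u x) \<and> \<tau> = \<sigma> \<inter> {x. u x = 0})"

text \<open>
  The conic hull here is the set of all nonnegative linear combinations, i.e. \<open>convex_cone hull\<close>;
  the library's \<open>conic hull\<close> is not convex in general.
\<close>

definition simplicial_cone :: "'a::real_vector set \<Rightarrow> bool" where
  "simplicial_cone \<sigma> \<longleftrightarrow> (\<exists>B. independent B \<and> \<sigma> = convex_cone hull B)"

definition semifan :: "'a::real_vector set \<Rightarrow> 'a set set \<Rightarrow> bool" where
  "semifan W \<Sigma> \<longleftrightarrow>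
     finite \<Sigma> \<and>
     (\<forall>\<sigma>\<in>\<Sigma>. polycone W \<sigma>) \<and>
     (\<forall>\<sigma>\<in>\<Sigma>. \<forall>\<tau>. polycone_face \<tau> \<sigma> \<longrightarrow> \<tau> \<in> \<Sigma>) \<and>
     (\<forall>\<sigma>\<in>\<Sigma>. \<forall>\<tau>\<in>\<Sigma>. polycone_face (\<sigma> \<inter> \<tau>) \<sigma>)"

definition simplicial_semifan :: "'a::real_vector set \<Rightarrow> 'a set set \<Rightarrow> bool" where
  "simplicial_semifan W \<Sigma> \<longleftrightarrow> semifan W \<Sigma> \<and> (\<forall>\<sigma>\<in>\<Sigma>. simplicial_cone \<sigma>)"

definition complete_semifan :: "'a::real_vector set \<Rightarrow> 'a set set \<Rightarrow> bool" where
  "complete_semifan W \<Sigma> \<longleftrightarrow> semifan W \<Sigma> \<and> \<Union>\<Sigma> = UNIV"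

definition semifan_completion ::
    "'a::real_vector set \<Rightarrow> 'a set set \<Rightarrow> 'a set set \<Rightarrow> bool" where
  "semifan_completion W \<Sigma> \<Sigma>' \<longleftrightarrow> complete_semifan W \<Sigma>' \<and> \<Sigma> \<subseteq> \<Sigma>'"

end

theory Submission
  imports Defs
begin

text \<open>
  A cone \<open>\<sigma>\<close> is extended by a finite set \<open>B\<close> of new generators to the join \<open>\<sigma> + cone B\<close>, in
  such a way that every point of the resulting fan has a unique expression as a point of \<open>\<Sigma>\<close>
  plus a nonnegative combination of new generators. Such a relative fan over \<open>\<Sigma>\<close> contains
  \<open>\<Sigma>\<close>, and it is simplicial if \<open>\<Sigma>\<close> is, so both claims follow once it can be made complete.

  This is done by induction on the codimension of the common lineality space \<open>L\<close> of the cones.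
  For a point \<open>r\<close> of the fan outside \<open>L\<close>, the cones \<open>\<delta> + \<real> r\<close> with \<open>r \<in> \<delta>\<close> form a semifan with
  a larger lineality space. Pushing the new generators of a completion of it far towards \<open>r\<close>
  gives an extension of the original fan that is a neighbourhood of \<open>r\<close>. After this has been
  done for finitely many \<open>r\<close> generating the cones of \<open>\<Sigma>\<close> modulo \<open>L\<close>, the cones of \<open>\<Sigma>\<close> meet the
  boundary of the covered region only in \<open>L\<close>. Then a simplicial fan fine enough to be compatible
  with everything fills the complement, and it subdivides only joins of cones with new
  generators, never a cone of \<open>\<Sigma>\<close>.
\<close>

subsection \<open>Nonnegative combinations\<close>

text \<open>The obstacle is that the cones of \<open>\<Sigma>\<close> must survive uncut, whereas a
  fan compatible with all hyperplanes in sight would cut them. A pair \<open>(\<sigma>, B)\<close>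
  never expands \<open>\<sigma>\<close> in generators, so only its \<open>B\<close>-part can be
  subdivided, and \<open>\<sigma>\<close> may be an arbitrary cone. Filling is then harmless only
  away from points whose \<open>\<sigma>\<close>-part is outside \<open>L\<close>, so these need a
  covered neighbourhood beforehand. Finitely many \<open>r\<close> suffice for this: if
  \<open>s - \<eta> *\<^sub>R r\<close> lies in \<open>\<sigma>\<close> for some positive
  \<open>\<eta>\<close>, then a covered neighbourhood of \<open>r\<close> yields one of
  \<open>s\<close>. Since a star cone contains the whole line through \<open>r\<close>, the
  induction has to admit cones that are not pointed. Rationality costs no approximation: new
  generators are basis vectors in \<open>W\<close>, the negative of their sum, translates by natural
  multiples of \<open>r\<close>, and points where the kernel of a form that is
  \<open>K\<close>-valued on \<open>W\<close> meets an edge. All of these are again in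
  \<open>W\<close>.\<close>

definition nonneg_on :: "'a set \<Rightarrow> ('a \<Rightarrow> real) set" where
  "nonneg_on B = {c. (\<forall>b. 0 \<le> c b) \<and> (\<forall>b. b \<notin> B \<longrightarrow> c b = 0)}"

text \<open>The sum runs over the support and does not mention a generator set, so coefficients
  belonging to different sets can be compared as functions. For infinite support the value is 0,
  hence the finiteness assumptions below.\<close>

definition lincomb :: "('a::real_vector \<Rightarrow> real) \<Rightarrow> 'a" where
  "lincomb c = (\<Sum>b | c b \<noteq> 0. c b *\<^sub>R b)"

definition cone_hull :: "'a::real_vector set \<Rightarrow> 'a set" where
  "cone_hull B = lincomb ` nonneg_on B"

definition join :: "'a::real_vector set \<Rightarrow> 'a set \<Rightarrow> 'a set" where
  "join \<sigma> B = {s + x | s x. s \<in> \<sigma> \<and> x \<in> cone_hull B}"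

lemma nonneg_onD: "c \<in> nonneg_on B \<Longrightarrow> 0 \<le> c b" "c \<in> nonneg_on B \<Longrightarrow> b \<notin> B \<Longrightarrow> c b = 0"
  by (auto simp: nonneg_on_def)

lemma nonneg_on_mono: "B \<subseteq> B' \<Longrightarrow> nonneg_on B \<subseteq> nonneg_on B'"
  by (auto simp: nonneg_on_def)

lemma nonneg_on_zero [simp]: "(\<lambda>_. 0) \<in> nonneg_on B"
  by (simp add: nonneg_on_def)

lemma nonneg_on_empty [simp]: "nonneg_on {} = {\<lambda>_. 0}"
  by (auto simp: nonneg_on_def)

lemma nonneg_on_add: "c \<in> nonneg_on B \<Longrightarrow> c' \<in> nonneg_on B' \<Longrightarrow> (\<lambda>b. c b + c' b) \<in> nonneg_on (B \<union> B')"
  by (auto simp: nonneg_on_def)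

lemma nonneg_on_scale: "c \<in> nonneg_on B \<Longrightarrow> 0 \<le> a \<Longrightarrow> (\<lambda>b. a * c b) \<in> nonneg_on B"
  by (auto simp: nonneg_on_def)

lemma nonneg_on_single: "b \<in> B \<Longrightarrow> 0 \<le> a \<Longrightarrow> (\<lambda>x. if x = b then a else 0) \<in> nonneg_on B"
  by (auto simp: nonneg_on_def)

lemma nonneg_on_Int: "c \<in> nonneg_on A \<Longrightarrow> c \<in> nonneg_on B \<Longrightarrow> c \<in> nonneg_on (A \<inter> B)"
  by (auto simp: nonneg_on_def)

lemma lincomb_eq_sum: "finite B \<Longrightarrow> (\<And>b. b \<notin> B \<Longrightarrow> c b = 0) \<Longrightarrow> lincomb c = (\<Sum>b\<in>B. c b *\<^sub>R b)"
  unfolding lincomb_def by (rule sum.mono_neutral_left) auto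

lemma lincomb_nonneg_on: "finite B \<Longrightarrow> c \<in> nonneg_on B \<Longrightarrow> lincomb c = (\<Sum>b\<in>B. c b *\<^sub>R b)"
  by (rule lincomb_eq_sum) (auto simp: nonneg_on_def)

lemma lincomb_zero [simp]: "lincomb (\<lambda>_. 0) = 0"
  by (simp add: lincomb_def)

lemma lincomb_single [simp]: "lincomb (\<lambda>x. if x = b then a else 0) = a *\<^sub>R b"
  using lincomb_eq_sum[of "{b}" "\<lambda>x. if x = b then a else 0"] by simp

lemma lincomb_add:
  assumes "finite B" "finite B'" "c \<in> nonneg_on B" "c' \<in> nonneg_on B'"
  shows "lincomb (\<lambda>b. c b + c' b) = lincomb c + lincomb c'"
proof -
  have "lincomb (\<lambda>b. c b + c' b) = (\<Sum>b\<in>B \<union> B'. (c b + c' b) *\<^sub>R b)"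
    "lincomb c = (\<Sum>b\<in>B \<union> B'. c b *\<^sub>R b)" "lincomb c' = (\<Sum>b\<in>B \<union> B'. c' b *\<^sub>R b)"
    using assms by (intro lincomb_eq_sum; auto simp: nonneg_on_def)+
  then show ?thesis
    by (simp add: scaleR_left_distrib sum.distrib)
qed

lemma lincomb_scale:
  assumes "finite B" "c \<in> nonneg_on B"
  shows "lincomb (\<lambda>b. a * c b) = a *\<^sub>R lincomb c"
proof -
  have "lincomb (\<lambda>b. a * c b) = (\<Sum>b\<in>B. (a * c b) *\<^sub>R b)"
    using assms by (intro lincomb_eq_sum) (auto dest: nonneg_onD)
  then show ?thesis
    using lincomb_nonneg_on[OF assms] by (simp add: scaleR_right.sum)
qed

lemma linear_lincomb:
  assumes "linear u" "finite B" "c \<in> nonneg_on B"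
  shows "u (lincomb c) = (\<Sum>b\<in>B. c b * (u b :: real))"
  using assms by (simp add: lincomb_nonneg_on linear_sum linear_scale)

lemma cone_hullI: "c \<in> nonneg_on B \<Longrightarrow> lincomb c \<in> cone_hull B"
  by (simp add: cone_hull_def)

lemma cone_hull_mono: "B \<subseteq> B' \<Longrightarrow> cone_hull B \<subseteq> cone_hull B'"
  unfolding cone_hull_def using nonneg_on_mono by blast

lemma cone_hull_empty [simp]: "cone_hull {} = {0}"
  by (simp add: cone_hull_def)

lemma cone_hull_incl: "B \<subseteq> cone_hull B"
proof
  fix b assume "b \<in> B"
  then show "b \<in> cone_hull B"
    using cone_hullI[OF nonneg_on_single[of b B 1]] by simp
qed

lemma convex_cone_cone_hull:
  assumes "finite B"
  shows "convex_cone (cone_hull B)"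
  unfolding convex_cone_iff
proof (intro conjI ballI allI impI)
  show "0 \<in> cone_hull B"
    using cone_hullI[OF nonneg_on_zero] by simp
  show "x + y \<in> cone_hull B" if xy: "x \<in> cone_hull B" "y \<in> cone_hull B" for x y
  proof -
    obtain c d where "c \<in> nonneg_on B" "d \<in> nonneg_on B" "x = lincomb c" "y = lincomb d"
      using xy by (auto simp: cone_hull_def)
    then show ?thesis
      using cone_hullI[OF nonneg_on_add[of c B d B]] assms by (simp add: lincomb_add)
  qed
  show "a *\<^sub>R x \<in> cone_hull B" if x: "x \<in> cone_hull B" "0 \<le> a" for x a
  proof -
    obtain c where "c \<in> nonneg_on B" "x = lincomb c"
      using x by (auto simp: cone_hull_def)
    then show ?thesis
      using cone_hullI[OF nonneg_on_scale[of c B a]] assms x by (simp add: lincomb_scale)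
  qed
qed

lemma convex_cone_sum:
  assumes "convex_cone S" "\<And>i. i \<in> I \<Longrightarrow> f i \<in> S"
  shows "(\<Sum>i\<in>I. f i) \<in> S"
  using assms(2)
  by (induction I rule: infinite_finite_induct)
     (auto simp: convex_cone_contains_0[OF assms(1)] convex_cone_add[OF assms(1)])

lemma cone_hull_least:
  assumes "convex_cone S" "B \<subseteq> S" "finite B"
  shows "cone_hull B \<subseteq> S"
  using assms
  by (auto simp: cone_hull_def lincomb_nonneg_on nonneg_onD intro!: convex_cone_sum convex_cone_scaleR)

lemma cone_hull_eq_hull: "finite B \<Longrightarrow> cone_hull B = convex_cone hull B"
  by (rule hull_unique[symmetric]) (auto simp: cone_hull_incl convex_cone_cone_hull cone_hull_least)

lemma joinI: "s \<in> \<sigma> \<Longrightarrow> c \<in> nonneg_on B \<Longrightarrow> s + lincomb c \<in> join \<sigma> B"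
  by (auto simp: join_def cone_hull_def)

lemma joinE:
  assumes "x \<in> join \<sigma> B"
  obtains s c where "s \<in> \<sigma>" "c \<in> nonneg_on B" "x = s + lincomb c"
  using assms by (auto simp: join_def cone_hull_def)

lemma join_mono: "\<sigma> \<subseteq> \<tau> \<Longrightarrow> A \<subseteq> B \<Longrightarrow> join \<sigma> A \<subseteq> join \<tau> B"
  using cone_hull_mono[of A B] unfolding join_def by blast

lemma join_empty [simp]: "join \<sigma> {} = \<sigma>"
  by (simp add: join_def)

lemma join_base: "\<sigma> \<subseteq> join \<sigma> B"
  using join_mono[of \<sigma> \<sigma> "{}" B] by simp

lemma convex_cone_join:
  assumes "convex_cone \<sigma>" "finite B"
  shows "convex_cone (join \<sigma> B)"
proof -
  have "join \<sigma> B = (\<Union>x\<in>\<sigma>. \<Union>y\<in>cone_hull B. {x + y})"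
    by (auto simp: join_def)
  then show ?thesis
    using convex_cone_sums[OF assms(1) convex_cone_cone_hull[OF assms(2)]] by simp
qed

lemma join_incl: "convex_cone \<sigma> \<Longrightarrow> B \<subseteq> join \<sigma> B"
  using cone_hull_incl[of B] convex_cone_contains_0[of \<sigma>] by (force simp: join_def)

lemma join_Un:
  assumes "finite B" "finite B'"
  shows "join (join \<sigma> B) B' = join \<sigma> (B \<union> B')"
proof
  show "join (join \<sigma> B) B' \<subseteq> join \<sigma> (B \<union> B')"
  proof
    fix x assume "x \<in> join (join \<sigma> B) B'"
    then obtain s c c' where *: "s \<in> \<sigma>" "c \<in> nonneg_on B" "c' \<in> nonneg_on B'"
      "x = s + lincomb c + lincomb c'"
      by (metis joinE)
    then have "x = s + lincomb (\<lambda>b. c b + c' b)"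
      using assms by (simp add: lincomb_add add.assoc)
    then show "x \<in> join \<sigma> (B \<union> B')"
      using joinI[OF *(1) nonneg_on_add[OF *(2,3)]] by simp
  qed
  show "join \<sigma> (B \<union> B') \<subseteq> join (join \<sigma> B) B'"
  proof
    fix x assume "x \<in> join \<sigma> (B \<union> B')"
    then obtain s c where *: "s \<in> \<sigma>" "c \<in> nonneg_on (B \<union> B')" "x = s + lincomb c"
      by (metis joinE)
    define c1 c2 where "c1 = (\<lambda>b. if b \<in> B then c b else 0)"
      and "c2 = (\<lambda>b. if b \<in> B then 0 else c b)"
    have c12: "c1 \<in> nonneg_on B" "c2 \<in> nonneg_on B'" "c = (\<lambda>b. c1 b + c2 b)"
      using *(2) by (auto simp: c1_def c2_def nonneg_on_def)
    then have "x = s + lincomb c1 + lincomb c2"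
      using * lincomb_add[OF assms c12(1,2)] by (simp add: add.assoc)
    then show "x \<in> join (join \<sigma> B) B'"
      using joinI[OF joinI[OF *(1) c12(1)] c12(2)] by simp
  qed
qed

lemma join_singleton: "join \<sigma> {g} = {s + t *\<^sub>R g | s t. s \<in> \<sigma> \<and> 0 \<le> t}"
proof -
  have "cone_hull {g} = {t *\<^sub>R g | t. 0 \<le> t}"
  proof
    show "cone_hull {g} \<subseteq> {t *\<^sub>R g | t. 0 \<le> t}"
      using lincomb_nonneg_on[of "{g}"] nonneg_onD(1)[of _ "{g}" g] by (auto simp: cone_hull_def)
    show "{t *\<^sub>R g | t. 0 \<le> t} \<subseteq> cone_hull {g}"
      using convex_cone_scaleR[OF convex_cone_cone_hull[of "{g}"]] cone_hull_incl[of "{g}"] by auto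
  qed
  then show ?thesis
    by (auto simp: join_def)
qed

lemma sum_split_sign:
  fixes u :: "'a \<Rightarrow> real"
  assumes "finite G"
  shows "sum f G = sum f {g \<in> G. 0 < u g} + sum f {g \<in> G. u g < 0} + sum f {g \<in> G. u g = 0}"
proof -
  have "sum f G = sum f (({g \<in> G. 0 < u g} \<union> {g \<in> G. u g < 0}) \<union> {g \<in> G. u g = 0})"
    by (rule arg_cong[of _ _ "sum f"]) auto
  also have "\<dots> = sum f {g \<in> G. 0 < u g} + sum f {g \<in> G. u g < 0} + sum f {g \<in> G. u g = 0}"
    using assms by (subst sum.union_disjoint; (subst sum.union_disjoint)?; auto)
  finally show ?thesis .
qed

subsection \<open>Coordinates of a \<open>K\<close>-structure\<close>

text \<open>The classes of \<open>f\<close> and \<open>0\<close> have the same image under the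
  canonical map, so injectivity identifies them.\<close>

lemma tensor_product_kernel:
  assumes inj: "inj_on tensor_canonical_map (tensor_product K W)"
    and f: "f \<in> tensor_free W" "tensor_eval f = 0"
  shows "f \<in> group_closure (tensor_relators K W)"
proof -
  define E where "E = {(f, g). f \<in> tensor_free W \<and> g \<in> tensor_free W \<and>
                f - g \<in> group_closure (tensor_relators K W)}"
  have 0: "0 \<in> tensor_free W" by (simp add: tensor_free_def)
  have cls: "E `` {h} \<in> tensor_product K W" "h \<in> E `` {h}" if "h \<in> tensor_free W" for h
    using that by (auto simp: tensor_product_def E_def quotient_def)
  have "tensor_canonical_map (E `` {f}) = tensor_canonical_map (E `` {0})"
    using tensor_canonical_map_class[OF cls[OF f(1)]] tensor_canonical_map_class[OF cls[OF 0]] f(2)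
    by (simp add: tensor_eval_def)
  then have "E `` {f} = E `` {0}"
    using inj_onD[OF inj _ cls(1)[OF f(1)] cls(1)[OF 0]] by blast
  then have "f \<in> E `` {0}" using cls(2)[OF f(1)] by simp
  then show ?thesis by (simp add: E_def)
qed

lemma K_structure_span:
  assumes "K_structure K W"
  shows "span W = UNIV"
proof -
  have "x \<in> span W" for x
  proof -
    have "x \<in> tensor_canonical_map ` tensor_product K W"
      using assms by (simp add: K_structure_def bij_betw_def)
    then obtain c where c: "c \<in> tensor_product K W" "x = tensor_canonical_map c" by blast
    then obtain f where f: "f \<in> tensor_free W" "f \<in> c"
      by (auto simp: tensor_product_def quotient_def)
    have scaled: "fst p *\<^sub>R snd p \<in> span W" if "p \<in> Poly_Mapping.keys f" for p
      using that f(1) by (intro span_scale span_base) (auto simp: tensor_free_def)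
    have "tensor_eval f \<in> span W"
      unfolding tensor_eval_def by (rule span_sum, rule span_scale, rule scaled)
    then show ?thesis using tensor_canonical_map_class[OF c(1) f(2)] c(2) by simp
  qed
  then show ?thesis by auto
qed

text \<open>
  A maximal \<open>K\<close>-subspace of \<open>W\<close> avoiding \<open>w\<close> is a hyperplane, and \<open>\<phi>\<close> is the coordinate
  along \<open>w\<close>.
\<close>

lemma separating_K_form:
  assumes K: "subfield_of_reals K" and W: "sub_vector_space K W"
    and M: "sub_vector_space K M" "M \<subseteq> W" and w: "w \<in> W" "w \<notin> M"
  obtains \<phi> where "\<And>x y. x \<in> W \<Longrightarrow> y \<in> W \<Longrightarrow> \<phi> (x + y) = \<phi> x + \<phi> y"
    "\<And>k x. k \<in> K \<Longrightarrow> x \<in> W \<Longrightarrow> \<phi> (k *\<^sub>R x) = k * \<phi> x"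
    "\<And>x. x \<in> M \<Longrightarrow> \<phi> x = 0" "\<phi> w = (1 :: real)"
proof -
  have K1: "1 \<in> K" "0 \<in> K" and Ka: "\<And>a b. a \<in> K \<Longrightarrow> b \<in> K \<Longrightarrow> a + b \<in> K"
    and Km: "\<And>a b. a \<in> K \<Longrightarrow> b \<in> K \<Longrightarrow> a * b \<in> K" and Ku: "\<And>a. a \<in> K \<Longrightarrow> - a \<in> K"
    and Ki: "\<And>a. a \<in> K \<Longrightarrow> inverse a \<in> K"
    using K by (auto simp: subfield_of_reals_def)
  have sv: "0 \<in> S" "x \<in> S \<Longrightarrow> y \<in> S \<Longrightarrow> x + y \<in> S" "k \<in> K \<Longrightarrow> x \<in> S \<Longrightarrow> k *\<^sub>R x \<in> S"
    "x \<in> S \<Longrightarrow> - x \<in> S" if "sub_vector_space K S" for S and x y :: 'a and k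
  proof -
    show "0 \<in> S" and add: "x \<in> S \<Longrightarrow> y \<in> S \<Longrightarrow> x + y \<in> S"
      and sc: "k \<in> K \<Longrightarrow> x \<in> S \<Longrightarrow> k *\<^sub>R x \<in> S" for x y k
      using that by (auto simp: sub_vector_space_def)
    show "x \<in> S \<Longrightarrow> - x \<in> S" using sc[OF Ku[OF K1(1)], of x] by simp
  qed
  define \<A> where "\<A> = {S. sub_vector_space K S \<and> S \<subseteq> W \<and> M \<subseteq> S \<and> w \<notin> S}"
  have "\<A> \<noteq> {}" using M w by (auto simp: \<A>_def)
  moreover have "\<Union>\<C> \<in> \<A>" if \<C>: "\<C> \<noteq> {}" "subset.chain \<A> \<C>" for \<C>
  proof -
    have sub: "\<C> \<subseteq> \<A>" and tot: "\<And>X Y. X \<in> \<C> \<Longrightarrow> Y \<in> \<C> \<Longrightarrow> X \<subseteq> Y \<or> Y \<subseteq> X"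
      using \<C>(2) by (auto simp: subset_chain_def)
    have S: "sub_vector_space K X" if "X \<in> \<C>" for X using that sub by (auto simp: \<A>_def)
    have "sub_vector_space K (\<Union>\<C>)"
      unfolding sub_vector_space_def
    proof (intro conjI ballI)
      show "0 \<in> \<Union>\<C>" using \<C>(1) sv(1)[OF S] by blast
      show "x + y \<in> \<Union>\<C>" if xy: "x \<in> \<Union>\<C>" "y \<in> \<Union>\<C>" for x y
      proof -
        obtain X Y where XY: "X \<in> \<C>" "x \<in> X" "Y \<in> \<C>" "y \<in> Y" using xy by blast
        from tot[OF XY(1,3)] show ?thesis
        proof
          assume "X \<subseteq> Y"
          then have "x + y \<in> Y" using sv(2)[OF S[OF XY(3)]] XY by blast
          then show ?thesis using XY(3) by blast
        next
          assume "Y \<subseteq> X"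
          then have "x + y \<in> X" using sv(2)[OF S[OF XY(1)]] XY by blast
          then show ?thesis using XY(1) by blast
        qed
      qed
      show "k *\<^sub>R x \<in> \<Union>\<C>" if "k \<in> K" "x \<in> \<Union>\<C>" for k x
        using that sv(3)[OF S] by blast
    qed
    moreover have "\<Union>\<C> \<subseteq> W" "M \<subseteq> \<Union>\<C>" "w \<notin> \<Union>\<C>"
      using sub \<C>(1) unfolding \<A>_def by blast+
    ultimately show ?thesis by (simp add: \<A>_def)
  qed
  ultimately have "\<exists>S\<in>\<A>. \<forall>X\<in>\<A>. S \<subseteq> X \<longrightarrow> X = S" by (rule subset_Zorn_nonempty)
  then obtain S where S: "S \<in> \<A>" "\<And>X. X \<in> \<A> \<Longrightarrow> S \<subseteq> X \<Longrightarrow> X = S" by blast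
  have SK: "sub_vector_space K S" and SW: "S \<subseteq> W" "M \<subseteq> S" "w \<notin> S" using S(1) by (auto simp: \<A>_def)
  \<comment> \<open>For \<open>x\<close> outside \<open>S\<close> the subspace
    \<open>S + K x\<close> is strictly larger, so by maximality it contains \<open>w\<close>.
    Solving \<open>w = s + k x\<close> for \<open>x\<close> uses inverses in
    \<open>K\<close>.\<close>
  have ex: "\<exists>k\<in>K. x - k *\<^sub>R w \<in> S" if x: "x \<in> W" for x
  proof (cases "x \<in> S")
    case True
    then show ?thesis using K1 by (intro bexI[of _ 0]) auto
  next
    case False
    define X where "X = {s + k *\<^sub>R x | s k. s \<in> S \<and> k \<in> K}"
    have XI: "s + k *\<^sub>R x \<in> X" if "s \<in> S" "k \<in> K" for s k using that unfolding X_def by blast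
    have "sub_vector_space K X"
      unfolding sub_vector_space_def
    proof (intro conjI ballI)
      show "0 \<in> X" using XI[OF sv(1)[OF SK] K1(2)] by simp
      show "y + z \<in> X" if yz: "y \<in> X" "z \<in> X" for y z
      proof -
        obtain s k s' k' where "s \<in> S" "k \<in> K" "y = s + k *\<^sub>R x" "s' \<in> S" "k' \<in> K" "z = s' + k' *\<^sub>R x"
          using yz unfolding X_def by blast
        then show ?thesis
          using XI[OF sv(2)[OF SK, of s s'] Ka[of k k']] by (simp add: algebra_simps)
      qed
      show "a *\<^sub>R y \<in> X" if y: "a \<in> K" "y \<in> X" for a y
      proof -
        obtain s k where "s \<in> S" "k \<in> K" "y = s + k *\<^sub>R x" using y unfolding X_def by blast
        then show ?thesis
          using XI[OF sv(3)[OF SK y(1), of s] Km[OF y(1), of k]] by (simp add: algebra_simps)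
      qed
    qed
    moreover have "S \<subseteq> X" using XI[OF _ K1(2)] by auto
    moreover have "X \<subseteq> W"
    proof
      fix y assume "y \<in> X"
      then obtain s k where "s \<in> S" "k \<in> K" "y = s + k *\<^sub>R x" unfolding X_def by blast
      then show "y \<in> W" using sv(2,3)[OF W] x SW(1) by blast
    qed
    moreover have "x \<in> X" using XI[OF sv(1)[OF SK] K1(1)] by simp
    ultimately have "w \<in> X" using S(2)[of X] False SW(2) unfolding \<A>_def by blast
    then obtain s k where s: "s \<in> S" "k \<in> K" "w = s + k *\<^sub>R x" unfolding X_def by blast
    have k: "k \<noteq> 0" using s SW(3) by auto
    have "x - inverse k *\<^sub>R w = - (inverse k *\<^sub>R s)"
      using k by (simp add: s(3) scaleR_right_distrib)
    also have "\<dots> \<in> S" using sv(4)[OF SK sv(3)[OF SK Ki[OF s(2)] s(1)]] .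
    finally show ?thesis using Ki[OF s(2)] by blast
  qed
  have unique: "k = k'" if k: "k \<in> K" "k' \<in> K" "x - k *\<^sub>R w \<in> S" "x - k' *\<^sub>R w \<in> S" for x k k'
  proof (rule ccontr)
    assume neq: "k \<noteq> k'"
    have "(x - k' *\<^sub>R w) + - (x - k *\<^sub>R w) \<in> S" using sv(2)[OF SK k(4) sv(4)[OF SK k(3)]] .
    moreover have "(x - k' *\<^sub>R w) + - (x - k *\<^sub>R w) = (k - k') *\<^sub>R w" by (simp add: algebra_simps)
    ultimately have "(k - k') *\<^sub>R w \<in> S" by simp
    moreover have "inverse (k - k') \<in> K" using Ki[OF Ka[OF k(1) Ku[OF k(2)]]] by simp
    ultimately have "inverse (k - k') *\<^sub>R ((k - k') *\<^sub>R w) \<in> S" using sv(3)[OF SK] by blast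
    then show False using neq SW(3) by simp
  qed
  define \<phi> where "\<phi> = (\<lambda>x. SOME k. k \<in> K \<and> x - k *\<^sub>R w \<in> S)"
  have \<phi>: "\<phi> x \<in> K \<and> x - \<phi> x *\<^sub>R w \<in> S" if "x \<in> W" for x
    unfolding \<phi>_def using ex[OF that] by (intro someI_ex[of "\<lambda>k. k \<in> K \<and> x - k *\<^sub>R w \<in> S"]) blast
  have \<phi>_eq: "\<phi> x = k" if "x \<in> W" "k \<in> K" "x - k *\<^sub>R w \<in> S" for x k
    using unique[of "\<phi> x" k x] \<phi>[OF that(1)] that by blast
  show ?thesis
  proof (rule that[of \<phi>])
    show "\<phi> (x + y) = \<phi> x + \<phi> y" if xy: "x \<in> W" "y \<in> W" for x y
    proof (rule \<phi>_eq)
      show "x + y \<in> W" using sv(2)[OF W xy] .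
      show "\<phi> x + \<phi> y \<in> K" using Ka \<phi> xy by blast
      have "(x - \<phi> x *\<^sub>R w) + (y - \<phi> y *\<^sub>R w) \<in> S" using sv(2)[OF SK] \<phi> xy by blast
      then show "x + y - (\<phi> x + \<phi> y) *\<^sub>R w \<in> S" by (simp add: algebra_simps)
    qed
    show "\<phi> (k *\<^sub>R x) = k * \<phi> x" if kx: "k \<in> K" "x \<in> W" for k x
    proof (rule \<phi>_eq)
      show "k *\<^sub>R x \<in> W" using sv(3)[OF W kx] .
      show "k * \<phi> x \<in> K" using Km \<phi> kx by blast
      have "k *\<^sub>R (x - \<phi> x *\<^sub>R w) \<in> S" using sv(3)[OF SK] \<phi> kx by blast
      then show "k *\<^sub>R x - (k * \<phi> x) *\<^sub>R w \<in> S" by (simp add: algebra_simps)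
    qed
    show "\<phi> x = 0" if "x \<in> M" for x using that SW M(2) K1 by (intro \<phi>_eq) auto
    show "\<phi> w = 1" using w(1) K1 sv(1)[OF SK] by (intro \<phi>_eq) auto
  qed
qed

text \<open>If some coordinate were outside \<open>K\<close>, there would be a
  \<open>K\<close>-linear form \<phi> on \<open>W\<close> that kills all vectors with coordinates in
  \<open>K\<close>, in particular \<open>B\<close>, and sends \<open>w\<close> to 1. The tensor of 1
  and \<open>w\<close> minus the sum of the tensors of \<open>a b\<close> and \<open>b\<close>
  evaluates to 0, so it is zero in the tensor product, yet the map induced by \<phi> sends it to
  1.\<close>

lemma K_structure_representation:
  assumes K: "subfield_of_reals K" and KW: "K_structure K W"
    and B: "B \<subseteq> W" "independent B" "span B = UNIV" "finite B" and w: "w \<in> W"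
  shows "representation B w b \<in> K"
proof (rule ccontr)
  assume nK: "representation B w b \<notin> K"
  have W: "sub_vector_space K W" and inj: "inj_on tensor_canonical_map (tensor_product K W)"
    using KW by (auto simp: K_structure_def bij_betw_def)
  define M where "M = {x \<in> W. \<forall>b. representation B x b \<in> K}"
  have "sub_vector_space K M"
    using W K B(2,3)
    by (auto simp: sub_vector_space_def subfield_of_reals_def M_def representation_zero
        representation_add representation_scale)
  moreover have "M \<subseteq> W" "w \<notin> M" using nK by (auto simp: M_def)
  ultimately obtain \<phi> where add: "\<And>x y. x \<in> W \<Longrightarrow> y \<in> W \<Longrightarrow> \<phi> (x + y) = \<phi> x + \<phi> y"
    and scale: "\<And>k x. k \<in> K \<Longrightarrow> x \<in> W \<Longrightarrow> \<phi> (k *\<^sub>R x) = k * \<phi> x"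
    and zero: "\<And>x. x \<in> M \<Longrightarrow> \<phi> x = 0" and one: "\<phi> w = (1 :: real)"
    using separating_K_form[OF K W _ _ w] by metis
  \<comment> \<open>The map induced by \<phi> on the tensor product, computed on representatives:
    the pair \<open>(a, x)\<close> contributes \<open>a * \<phi> x\<close>.\<close>
  define \<Phi> where "\<Phi> = (\<lambda>f. tensor_eval (frag_extend (\<lambda>(a, x). frag_of (a, \<phi> x)) f))"
  have \<Phi>_diff: "\<Phi> (f - g) = \<Phi> f - \<Phi> g" for f g
    by (simp add: \<Phi>_def frag_extend_diff tensor_eval_diff)
  have \<Phi>_of: "\<Phi> (frag_of (a, x)) = a * \<phi> x" for a x by (simp add: \<Phi>_def)
  have \<Phi>_0: "\<Phi> 0 = 0" using \<Phi>_diff[of 0 0] by simp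
  have closure: "\<Phi> f = 0" if "f \<in> group_closure (tensor_relators K W)" for f
    using that
  proof (induction rule: group_closure.induct)
    case (base s)
    then consider "s = 0"
      | a b x where "s = frag_of (a + b, x) - frag_of (a, x) - frag_of (b, x)"
      | a x y where "s = frag_of (a, x + y) - frag_of (a, x) - frag_of (a, y)" "x \<in> W" "y \<in> W"
      | a k x where "s = frag_of (a * k, x) - frag_of (a, k *\<^sub>R x)" "k \<in> K" "x \<in> W"
      unfolding tensor_relators_def by blast
    then show ?case
      by cases (simp_all add: \<Phi>_0 \<Phi>_diff \<Phi>_of add scale distrib_left distrib_right)
  qed (simp add: \<Phi>_diff)
  have hom_sum: "h (\<Sum>i\<in>I. g i) = (\<Sum>i\<in>I. h (g i))"
    if "\<And>f g. h (f - g) = h f - h g" for h :: "((real \<times> 'a) \<Rightarrow>\<^sub>0 int) \<Rightarrow> 'c::ab_group_add"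
      and g :: "'a \<Rightarrow> (real \<times> 'a) \<Rightarrow>\<^sub>0 int" and I
  proof -
    have 0: "h 0 = 0" using that[of 0 0] by simp
    have neg: "h (- f) = - h f" for f using that[of 0 f] 0 by simp
    have "h (f + g) = h f + h g" for f g using that[of f "- g"] neg by simp
    then show ?thesis using 0 by (induction I rule: infinite_finite_induct) auto
  qed
  define a where "a = representation B w"
  define f where "f = frag_of (1, w) - (\<Sum>b\<in>B. frag_of (a b, b))"
  have "Poly_Mapping.keys (\<Sum>b\<in>B. frag_of (a b, b)) \<subseteq> UNIV \<times> W"
    using keys_sum[of "\<lambda>b. frag_of (a b, b)" B] B(1) by fastforce
  then have "f \<in> tensor_free W"
    using keys_diff[of "frag_of (1, w)" "\<Sum>b\<in>B. frag_of (a b, b)"] w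
    unfolding tensor_free_def f_def by auto
  moreover have "tensor_eval f = 0"
    using real_vector.sum_representation_eq[OF B(2), of w B] B(3,4)
    by (simp add: f_def tensor_eval_diff hom_sum[OF tensor_eval_diff] a_def)
  ultimately have "\<Phi> f = 0" using closure tensor_product_kernel[OF inj] by blast
  moreover have "\<phi> b = 0" if "b \<in> B" for b
  proof (rule zero)
    have "representation B b b' \<in> K" for b'
      using K representation_basis[OF B(2) that] by (simp add: subfield_of_reals_def)
    then show "b \<in> M" using that B(1) by (auto simp: M_def)
  qed
  then have "\<Phi> f = 1"
    by (simp add: f_def \<Phi>_diff hom_sum[OF \<Phi>_diff] \<Phi>_of one)
  ultimately show False by simp
qed

subsection \<open>Rational polyhedral cones\<close>

text \<open>Isolates the two consequences of the tensor isomorphism on which the geometry rests: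
  \<open>W\<close> spans the space, and coordinates of vectors of \<open>W\<close> in a basis from
  \<open>W\<close> lie in \<open>K\<close>.\<close>

locale rational_structure =
  fixes K :: "real set" and W :: "'a::real_vector set"
  assumes finite_dimensional: "\<exists>B :: 'a set. finite B \<and> span B = UNIV"
    and subfield: "subfield_of_reals K"
    and sub_space: "sub_vector_space K W"
    and span_W: "span W = UNIV"
    and representation_in_K:
      "B \<subseteq> W \<Longrightarrow> independent B \<Longrightarrow> span B = UNIV \<Longrightarrow> w \<in> W \<Longrightarrow> representation B w b \<in> K"
begin

lemma K_closed:
  shows K_0: "0 \<in> K" and K_1: "1 \<in> K"
    and K_add: "a \<in> K \<Longrightarrow> b \<in> K \<Longrightarrow> a + b \<in> K"
    and K_mult: "a \<in> K \<Longrightarrow> b \<in> K \<Longrightarrow> a * b \<in> K"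
    and K_uminus: "a \<in> K \<Longrightarrow> - a \<in> K"
    and K_inverse: "a \<in> K \<Longrightarrow> inverse a \<in> K"
  using subfield by (auto simp: subfield_of_reals_def)

lemma K_diff: "a \<in> K \<Longrightarrow> b \<in> K \<Longrightarrow> a - b \<in> K"
  using K_add[of a "- b"] K_uminus[of b] by simp

lemma K_divide: "a \<in> K \<Longrightarrow> b \<in> K \<Longrightarrow> a / b \<in> K"
  using K_mult[of a "inverse b"] K_inverse[of b] by (simp add: divide_inverse)

lemma K_of_nat: "of_nat n \<in> K"
  by (induction n) (auto simp: K_0 K_1 K_add)

lemma W_closed:
  shows W_0: "0 \<in> W"
    and W_add: "x \<in> W \<Longrightarrow> y \<in> W \<Longrightarrow> x + y \<in> W"
    and W_scale: "k \<in> K \<Longrightarrow> x \<in> W \<Longrightarrow> k *\<^sub>R x \<in> W"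
  using sub_space by (auto simp: sub_vector_space_def)

lemma W_uminus: "x \<in> W \<Longrightarrow> - x \<in> W"
  using W_scale[OF K_uminus[OF K_1], of x] by simp

lemma W_diff: "x \<in> W \<Longrightarrow> y \<in> W \<Longrightarrow> x - y \<in> W"
  using W_add[of x "- y"] W_uminus[of y] by simp

lemma W_sum: "(\<And>i. i \<in> I \<Longrightarrow> f i \<in> W) \<Longrightarrow> (\<Sum>i\<in>I. f i) \<in> W"
  by (induction I rule: infinite_finite_induct) (auto simp: W_0 W_add)

lemma finite_independent: "independent (B :: 'a set) \<Longrightarrow> finite B"
  using finite_dimensional independent_span_bound by blast

lemma rational_basis:
  obtains E where "E \<subseteq> W" "independent E" "span E = UNIV" "finite E"
proof -
  obtain E where E: "E \<subseteq> W" "independent E" "W \<subseteq> span E"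
    using maximal_independent_subset by blast
  then have "span E = UNIV"
    using span_W span_mono[OF E(3)] by (simp add: span_span top.extremum_unique)
  then show ?thesis
    using that E finite_independent by blast
qed

lemma rational_subspace_span: "S \<subseteq> W \<Longrightarrow> rational_subspace W (span S)"
proof -
  assume S: "S \<subseteq> W"
  obtain B where "B \<subseteq> S" "independent B" "S \<subseteq> span B"
    using maximal_independent_subset by blast
  moreover from this have "span B = span S"
    by (meson span_mono span_minimal subspace_span subset_antisym)
  ultimately show ?thesis
    using S unfolding rational_subspace_def by (metis subset_trans)
qed

section \<open>Rational forms; polycones by inequalities and by generators\<close>

definition rational_forms :: "('a \<Rightarrow> real) set" where
  "rational_forms = {u. linear u \<and> (\<forall>w\<in>W. u w \<in> K)}"

lemma rational_formD:
  assumes "u \<in> rational_forms"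
  shows "linear u" and "w \<in> W \<Longrightarrow> u w \<in> K"
  using assms by (auto simp: rational_forms_def)

lemma rational_form_uminus: "u \<in> rational_forms \<Longrightarrow> (\<lambda>x. - u x) \<in> rational_forms"
  by (auto simp: rational_forms_def linear_compose_neg K_uminus)

lemma rational_form_comb:
  assumes "u \<in> rational_forms" "v \<in> rational_forms" "a \<in> K" "b \<in> K"
  shows "(\<lambda>x. a * u x - b * v x) \<in> rational_forms"
  using assms
  by (auto simp: rational_forms_def linear_iff algebra_simps intro!: K_add K_mult K_diff)

lemma rational_form_representation:
  assumes "E \<subseteq> W" "independent E" "span E = UNIV"
  shows "(\<lambda>x. representation E x e) \<in> rational_forms"
  using assms
  by (auto simp: rational_forms_def linear_iff representation_add representation_scale
      representation_in_K)

text \<open>A form with rational kernel becomes \<open>K\<close>-valued on \<open>W\<close> after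
  scaling: for \<open>w0\<close> in \<open>W\<close> off the kernel, \<open>u w / u w0\<close> is
  the \<open>w0\<close>-coordinate of \<open>w\<close> in the basis made of \<open>w0\<close> and a
  basis of the kernel. Dividing by the absolute value of \<open>u w0\<close> preserves the
  halfspace.\<close>

lemma rational_halfspaceE:
  assumes "rational_halfspace W H"
  obtains u where "u \<in> rational_forms" "H = {x. 0 \<le> u x}"
proof -
  obtain u :: "'a \<Rightarrow> real" and x0 B where u: "linear u" "u x0 \<noteq> 0" "H = {x. 0 \<le> u x}"
    and B: "B \<subseteq> W" "independent B" "span B = {x. u x = 0}"
    using assms unfolding rational_halfspace_def rational_subspace_def by blast
  obtain w0 where w0: "w0 \<in> W" "u w0 \<noteq> 0"
  proof (rule ccontr)
    assume "\<not> thesis"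
    then have "\<And>x. x \<in> W \<Longrightarrow> u x = 0" using that by blast
    then have "u x0 = 0"
      using linear_eq_0_on_span[OF u(1), of W x0] span_W by auto
    then show False using u by simp
  qed
  have w0B: "w0 \<notin> span B" using B w0 by simp
  have ind: "independent (insert w0 B)" using independent_insertI[OF w0B B(2)] .
  have sp: "span (insert w0 B) = UNIV"
  proof -
    have "x \<in> span (insert w0 B)" for x
    proof -
      have "x - (u x / u w0) *\<^sub>R w0 \<in> span B"
        using w0 by (simp add: B linear_diff[OF u(1)] linear_scale[OF u(1)])
      then show ?thesis using span_breakdown_eq by blast
    qed
    then show ?thesis by auto
  qed
  have fin: "finite (insert w0 B)" using finite_independent[OF ind] .
  have uB: "u b = 0" if "b \<in> B" for b using span_base[OF that] B by simp
  have quot: "u w / u w0 \<in> K" if "w \<in> W" for w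
  proof -
    have "u w = u (\<Sum>b\<in>insert w0 B. representation (insert w0 B) w b *\<^sub>R b)"
      using real_vector.sum_representation_eq[OF ind, of w "insert w0 B"] sp fin by simp
    also have "\<dots> = (\<Sum>b\<in>insert w0 B. representation (insert w0 B) w b * u b)"
      by (simp add: linear_sum[OF u(1)] linear_scale[OF u(1)] del: sum.insert)
    also have "\<dots> = (\<Sum>b\<in>{w0}. representation (insert w0 B) w b * u b)"
      using fin uB by (intro sum.mono_neutral_right) auto
    also have "\<dots> = representation (insert w0 B) w w0 * u w0"
      by simp
    finally show ?thesis
      using representation_in_K[OF _ ind sp that, of w0] w0 B by simp
  qed
  show ?thesis
  proof (rule that)
    show "(\<lambda>x. u x / \<bar>u w0\<bar>) \<in> rational_forms"
    proof -
      have "u w / \<bar>u w0\<bar> \<in> K" if "w \<in> W" for w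
        using quot[OF that] K_uminus[OF quot[OF that]] by (cases "u w0 > 0") auto
      then show ?thesis
        using u(1) by (auto simp: rational_forms_def linear_iff add_divide_distrib)
    qed
    show "H = {x. 0 \<le> u x / \<bar>u w0\<bar>}"
      using w0 by (auto simp: u zero_le_divide_iff)
  qed
qed

lemma rational_halfspaceI:
  assumes "u \<in> rational_forms" "u x \<noteq> 0"
  shows "rational_halfspace W {x. 0 \<le> u x}"
proof -
  have u: "linear u" "\<And>w. w \<in> W \<Longrightarrow> u w \<in> K" using assms(1) rational_formD by auto
  obtain E where E: "E \<subseteq> W" "independent E" "span E = UNIV" "finite E"
    using rational_basis by blast
  obtain e0 where e0: "e0 \<in> E" "u e0 \<noteq> 0"
    using linear_eq_0_on_span[OF u(1), of E x] E(3) assms(2) by auto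
  \<comment> \<open>The basis \<open>E\<close> projected to the kernel along \<open>e0\<close>. The
    coefficients are in \<open>K\<close>, so the images stay in \<open>W\<close>.\<close>
  define S where "S = (\<lambda>e. e - (u e / u e0) *\<^sub>R e0) ` E"
  have S: "S \<subseteq> W"
    using E e0 u by (auto simp: S_def intro!: W_diff W_scale K_divide)
  have "{x. u x = 0} = span S"
  proof
    show "{x. u x = 0} \<subseteq> span S"
    proof
      fix y assume "y \<in> {x. u x = 0}"
      then have y: "u y = 0" by simp
      let ?r = "representation E y"
      have rep: "(\<Sum>b\<in>E. ?r b *\<^sub>R b) = y"
        using real_vector.sum_representation_eq[OF E(2), of y E] E by simp
      have "(\<Sum>b\<in>E. ?r b * u b) = u (\<Sum>b\<in>E. ?r b *\<^sub>R b)"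
        by (simp add: linear_sum[OF u(1)] linear_scale[OF u(1)])
      then have 0: "(\<Sum>b\<in>E. ?r b * u b) = 0" using y rep by simp
      have "(\<Sum>b\<in>E. ?r b *\<^sub>R (b - (u b / u e0) *\<^sub>R e0)) =
          y - (\<Sum>b\<in>E. ?r b * u b / u e0) *\<^sub>R e0"
        by (simp add: scaleR_right_diff_distrib sum_subtractf rep scaleR_left.sum)
      also have "\<dots> = y"
        using 0 by (simp add: sum_divide_distrib[symmetric])
      finally have "y = (\<Sum>b\<in>E. ?r b *\<^sub>R (b - (u b / u e0) *\<^sub>R e0))" by simp
      also have "\<dots> \<in> span S"
        by (intro span_sum span_scale span_base) (auto simp: S_def)
      finally show "y \<in> span S" .
    qed
    have "subspace {x. u x = 0}"
      using u(1) by (auto simp: subspace_def linear_0 linear_add linear_scale)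
    then show "span S \<subseteq> {x. u x = 0}"
      using e0 by (intro span_minimal) (auto simp: S_def linear_diff[OF u(1)] linear_scale[OF u(1)])
  qed
  then show ?thesis
    using rational_subspace_span[OF S] u assms(2) by (auto simp: rational_halfspace_def)
qed

lemma polycone_iff:
  "polycone W \<sigma> \<longleftrightarrow> (\<exists>U. finite U \<and> U \<subseteq> rational_forms \<and> \<sigma> = {x. \<forall>u\<in>U. 0 \<le> u x})"
proof
  assume "polycone W \<sigma>"
  then obtain \<H> where H: "finite \<H>" "\<And>H. H \<in> \<H> \<Longrightarrow> rational_halfspace W H" "\<sigma> = \<Inter>\<H>"
    by (auto simp: polycone_def)
  have "\<forall>H. \<exists>u. H \<in> \<H> \<longrightarrow> u \<in> rational_forms \<and> H = {x. 0 \<le> u x}"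
    using H(2) by (blast elim: rational_halfspaceE)
  then obtain f where f: "\<And>H. H \<in> \<H> \<Longrightarrow> f H \<in> rational_forms \<and> H = {x. 0 \<le> f H x}"
    by metis
  have "\<sigma> = {x. \<forall>u\<in>f ` \<H>. 0 \<le> u x}"
  proof -
    have "x \<in> \<Inter>\<H> \<longleftrightarrow> (\<forall>H\<in>\<H>. 0 \<le> f H x)" for x
      using f by blast
    then show ?thesis using H(3) by auto
  qed
  then show "\<exists>U. finite U \<and> U \<subseteq> rational_forms \<and> \<sigma> = {x. \<forall>u\<in>U. 0 \<le> u x}"
    using H(1) f by (intro exI[of _ "f ` \<H>"]) auto
next
  assume "\<exists>U. finite U \<and> U \<subseteq> rational_forms \<and> \<sigma> = {x. \<forall>u\<in>U. 0 \<le> u x}"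
  then obtain U where U: "finite U" "U \<subseteq> rational_forms" "\<sigma> = {x. \<forall>u\<in>U. 0 \<le> u x}"
    by blast
  \<comment> \<open>The zero form bounds no halfspace; it imposes no condition and is
    dropped.\<close>
  define \<H> where "\<H> = (\<lambda>u. {x. 0 \<le> u x}) ` {u \<in> U. \<exists>x. u x \<noteq> 0}"
  have "\<sigma> = \<Inter>\<H>"
  proof -
    have "(\<forall>u\<in>U. 0 \<le> u x) \<longleftrightarrow> (\<forall>u\<in>{u \<in> U. \<exists>x. u x \<noteq> 0}. 0 \<le> u x)" for x
      by (metis (mono_tags, lifting) mem_Collect_eq order_refl)
    then show ?thesis by (auto simp: U(3) \<H>_def)
  qed
  moreover have "rational_halfspace W H" if "H \<in> \<H>" for H
    using that U(2) rational_halfspaceI by (auto simp: \<H>_def)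
  ultimately show "polycone W \<sigma>"
    using U(1) unfolding polycone_def by (intro exI[of _ \<H>]) (auto simp: \<H>_def)
qed

lemma polycone_0: "polycone W {0}"
proof -
  obtain E where E: "E \<subseteq> W" "independent E" "span E = UNIV" "finite E"
    using rational_basis by blast
  define f where "f = (\<lambda>e x. representation E x e)"
  define U where "U = f ` E \<union> (\<lambda>e x. - f e x) ` E"
  have f: "f e \<in> rational_forms" for e
    unfolding f_def using rational_form_representation[OF E(1-3)] .
  have "x = 0" if "\<forall>u\<in>U. 0 \<le> u x" for x
  proof -
    have "representation E x e = 0" if "e \<in> E" for e
    proof -
      have "f e \<in> U" "(\<lambda>x. - f e x) \<in> U" using that by (auto simp: U_def)
      then have "0 \<le> f e x" "0 \<le> - f e x" using \<open>\<forall>u\<in>U. 0 \<le> u x\<close> by fastforce+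
      then show ?thesis by (simp add: f_def)
    qed
    then show ?thesis
      using real_vector.sum_representation_eq[OF E(2), of x E] E by simp
  qed
  moreover have "u 0 = 0" if "u \<in> U" for u
    using that linear_0[OF rational_formD(1)[OF f]] by (auto simp: U_def)
  ultimately have "{0} = {x. \<forall>u\<in>U. 0 \<le> u x}" by (auto dest: eq_refl[OF sym])
  moreover have "finite U" "U \<subseteq> rational_forms"
    using E f rational_form_uminus by (auto simp: U_def)
  ultimately show ?thesis unfolding polycone_iff by blast
qed

lemma polycone_convex_cone: "polycone W \<sigma> \<Longrightarrow> convex_cone \<sigma>"
proof -
  assume "polycone W \<sigma>"
  then obtain U where U: "U \<subseteq> rational_forms" "\<sigma> = {x. \<forall>u\<in>U. 0 \<le> u x}"
    unfolding polycone_iff by blast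
  have "convex_cone {x. 0 \<le> u x}" if "u \<in> U" for u
    using rational_formD(1)[of u] U(1) that
    by (auto simp: convex_cone_iff linear_0 linear_add linear_scale)
  then have "convex_cone (\<Inter>u\<in>U. {x. 0 \<le> u x})"
    by (intro convex_cone_Inter) blast
  moreover have "\<sigma> = (\<Inter>u\<in>U. {x. 0 \<le> u x})" using U by blast
  ultimately show "convex_cone \<sigma>" by simp
qed

text \<open>Fourier--Motzkin elimination of the coefficient of \<open>g\<close>.\<close>

lemma polycone_add_ray:
  assumes "polycone W \<sigma>" "g \<in> W"
  shows "polycone W (join \<sigma> {g})"
proof -
  obtain U where U: "finite U" "U \<subseteq> rational_forms" and \<sigma>: "\<sigma> = {x. \<forall>u\<in>U. 0 \<le> u x}"
    using assms(1) unfolding polycone_iff by blast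
  define comb where "comb = (\<lambda>(u, v) x. u g * v x - v g * (u x :: real))"
  define U' where "U' = {u \<in> U. 0 \<le> u g} \<union> comb ` {(u, v) \<in> U \<times> U. 0 < u g \<and> v g < 0}"
  have lin: "linear u" if "u \<in> U" for u using that U(2) rational_formD by blast
  have U': "finite U'" "U' \<subseteq> rational_forms"
  proof -
    have "finite {(u, v) \<in> U \<times> U. 0 < u g \<and> v g < 0}"
      by (rule finite_subset[of _ "U \<times> U"]) (use U in auto)
    then show "finite U'" using U by (auto simp: U'_def)
    show "U' \<subseteq> rational_forms"
      using U(2) assms(2)
      by (auto simp: U'_def comb_def intro!: rational_form_comb rational_formD(2))
  qed
  have "join \<sigma> {g} = {x. \<forall>u\<in>U'. 0 \<le> u x}"
  proof
    show "join \<sigma> {g} \<subseteq> {x. \<forall>u\<in>U'. 0 \<le> u x}"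
    proof
      fix x assume "x \<in> join \<sigma> {g}"
      then obtain s t where s: "\<And>u. u \<in> U \<Longrightarrow> 0 \<le> u s" and t: "0 \<le> t" and x: "x = s + t *\<^sub>R g"
        by (auto simp: join_singleton \<sigma>)
      have ux: "u x = u s + t * u g" if "u \<in> U" for u
        by (simp add: x linear_add[OF lin[OF that]] linear_scale[OF lin[OF that]])
      have "0 \<le> u x" if "u \<in> U" "0 \<le> u g" for u
        using s[OF that(1)] t ux[OF that(1)] that(2) by simp
      moreover have "0 \<le> u g * v x - v g * u x" if "u \<in> U" "v \<in> U" "0 < u g" "v g < 0" for u v
      proof -
        have "u g * v x - v g * u x = u g * v s + (- v g) * u s"
          by (simp add: ux[OF that(1)] ux[OF that(2)] algebra_simps)
        then show ?thesis
          using mult_nonneg_nonneg[OF less_imp_le[OF that(3)] s[OF that(2)]]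
            mult_nonpos_nonneg[OF less_imp_le[OF that(4)] s[OF that(1)]] by linarith
      qed
      ultimately have "0 \<le> w x" if "w \<in> U'" for w
        using that by (auto simp: U'_def comb_def)
      then show "x \<in> {x. \<forall>u\<in>U'. 0 \<le> u x}" by blast
    qed
    show "{x. \<forall>u\<in>U'. 0 \<le> u x} \<subseteq> join \<sigma> {g}"
    proof
      fix x assume "x \<in> {x. \<forall>u\<in>U'. 0 \<le> u x}"
      then have x: "0 \<le> w x" if "w \<in> U'" for w using that by blast
      have pos: "0 \<le> u x" if "u \<in> U" "0 \<le> u g" for u
        using x[of u] that by (simp add: U'_def)
      have mix: "0 \<le> u g * v x - v g * u x"
        if "u \<in> U" "v \<in> U" "0 < u g" "v g < 0" for u v
      proof -
        have "comb (u, v) \<in> U'" using that by (auto simp: U'_def)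
        from x[OF this] show ?thesis by (simp add: comb_def)
      qed
      \<comment> \<open>The lower bounds for an admissible \<open>t\<close>: it must be nonnegative,
        and each form negative at \<open>g\<close> bounds it below. Their maximum also respects the
        upper bounds given by forms positive at \<open>g\<close>, because the combined forms in
        \<open>U'\<close> compare each upper bound with each lower one.\<close>
      define N where "N = insert 0 ((\<lambda>v. v x / v g) ` {v \<in> U. v g < 0})"
      define t where "t = Max N"
      have N: "finite N" "N \<noteq> {}" using U by (auto simp: N_def)
      have t0: "0 \<le> t" unfolding t_def using N by (intro Max_ge) (auto simp: N_def)
      have tN: "t \<in> N" unfolding t_def using N by (rule Max_in)
      have nonneg: "0 \<le> u (x - t *\<^sub>R g)" if u: "u \<in> U" for u
      proof -
        have eq: "u (x - t *\<^sub>R g) = u x - t * u g"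
          by (simp add: linear_diff[OF lin[OF u]] linear_scale[OF lin[OF u]])
        consider "u g = 0" | "u g < 0" | "0 < u g" by linarith
        then show ?thesis
        proof cases
          case 1
          then show ?thesis using pos[OF u] eq by simp
        next
          case 2
          then have "u x / u g \<le> t"
            unfolding t_def using N u by (intro Max_ge) (auto simp: N_def)
          then show ?thesis using 2 eq by (simp add: field_simps)
        next
          case 3
          show ?thesis
          proof (cases "t = 0")
            case True
            then show ?thesis using pos[OF u] 3 eq by simp
          next
            case False
            then obtain v where v: "v \<in> U" "v g < 0" "t = v x / v g"
              using tN by (auto simp: N_def)
            then have vx: "v x = t * v g" by simp
            have "v g * u x \<le> v g * (t * u g)"
              using mix[OF u v(1) 3 v(2)] unfolding vx by (simp add: algebra_simps)
            then have "t * u g \<le> u x"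
              using v(2) by (simp add: mult_le_cancel_left)
            then show ?thesis using eq by simp
          qed
        qed
      qed
      then have "x - t *\<^sub>R g \<in> \<sigma>" unfolding \<sigma> by blast
      moreover have "x = (x - t *\<^sub>R g) + t *\<^sub>R g" by simp
      ultimately show "x \<in> join \<sigma> {g}"
        unfolding join_singleton using t0 by blast
    qed
  qed
  then show ?thesis
    using U' unfolding polycone_iff by blast
qed

lemma polycone_join:
  assumes "finite B" "B \<subseteq> W" "polycone W \<sigma>"
  shows "polycone W (join \<sigma> B)"
  using assms
proof (induction B rule: finite_induct)
  case (insert b B)
  then have "polycone W (join (join \<sigma> B) {b})"
    by (intro polycone_add_ray) auto
  then show ?case
    using insert join_Un[of B "{b}" \<sigma>] by (simp add: Un_commute)
qed simp

text \<open>The double description step. Weight on generators with negative \<open>u\<close> can be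
  balanced against generators with positive \<open>u\<close>, and each balanced pair contributes a
  multiple of its \<open>mix\<close>, the point of the pair's cone on the hyperplane.\<close>

lemma cone_hull_Int_halfspace:
  assumes G: "finite G" "G \<subseteq> W" and u: "u \<in> rational_forms"
  shows "\<exists>G'. finite G' \<and> G' \<subseteq> W \<and> cone_hull G \<inter> {x. 0 \<le> u x} = cone_hull G'"
proof -
  have lin: "linear u" using u rational_formD by blast
  define Gp Gn where "Gp = {g \<in> G. 0 < u g}" and "Gn = {h \<in> G. u h < 0}"
  define mix where "mix = (\<lambda>(g, h). u g *\<^sub>R h - u h *\<^sub>R g)"
  define G' where "G' = {g \<in> G. 0 \<le> u g} \<union> mix ` (Gp \<times> Gn)"
  have fin: "finite Gp" "finite Gn" "finite G'"
    using G by (auto simp: Gp_def Gn_def G'_def)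
  have GW: "G' \<subseteq> W"
    using G(2) rational_formD(2)[OF u]
    by (auto simp: G'_def Gp_def Gn_def mix_def intro!: W_diff W_scale)
  have ccG: "convex_cone (cone_hull G)" and ccG': "convex_cone (cone_hull G')"
    using G fin by (auto intro: convex_cone_cone_hull)
  have cch: "convex_cone {x. 0 \<le> u x}"
    by (auto simp: convex_cone_iff linear_0[OF lin] linear_add[OF lin] linear_scale[OF lin])
  have "cone_hull G' \<subseteq> cone_hull G \<inter> {x. 0 \<le> u x}"
  proof (rule cone_hull_least)
    show "convex_cone (cone_hull G \<inter> {x. 0 \<le> u x})"
      using ccG cch unfolding convex_cone_iff by blast
    have "mix (g, h) \<in> cone_hull G \<inter> {x. 0 \<le> u x}" if "g \<in> Gp" "h \<in> Gn" for g h
    proof -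
      have gh: "g \<in> cone_hull G" "h \<in> cone_hull G" "0 < u g" "u h < 0"
        using that cone_hull_incl[of G] by (auto simp: Gp_def Gn_def)
      have "mix (g, h) = u g *\<^sub>R h + (- u h) *\<^sub>R g" by (simp add: mix_def)
      moreover have "u g *\<^sub>R h + (- u h) *\<^sub>R g \<in> cone_hull G"
        using gh by (intro convex_cone_add[OF ccG] convex_cone_scaleR[OF ccG]) auto
      moreover have "u (mix (g, h)) = 0"
        by (simp add: mix_def linear_diff[OF lin] linear_scale[OF lin])
      ultimately show ?thesis by simp
    qed
    moreover have "{g \<in> G. 0 \<le> u g} \<subseteq> cone_hull G \<inter> {x. 0 \<le> u x}"
      using cone_hull_incl[of G] by auto
    ultimately show "G' \<subseteq> cone_hull G \<inter> {x. 0 \<le> u x}"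
      by (auto simp: G'_def)
  qed (rule fin)
  moreover have "cone_hull G \<inter> {x. 0 \<le> u x} \<subseteq> cone_hull G'"
  proof
    fix x assume x: "x \<in> cone_hull G \<inter> {x. 0 \<le> u x}"
    then obtain c where c: "c \<in> nonneg_on G" "x = lincomb c" by (auto simp: cone_hull_def)
    have c0: "0 \<le> c g" for g using nonneg_onD(1)[OF c(1)] .
    \<comment> \<open>The total positive and negative weights, so that \<open>u x = P - M\<close>.
      The sum of all \<open>mix (g, h)\<close> with weights \<open>c g * c h\<close> equals
      \<open>P\<close> times \<open>B\<close> plus \<open>M\<close> times \<open>A\<close>; divided
      by \<open>P\<close>, it uses up \<open>B\<close> and the fraction \<open>M / P\<close> of
      \<open>A\<close>. What remains of \<open>A\<close> has a nonnegative factor because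
      \<open>u x\<close> is nonnegative.\<close>
    define P M where "P = (\<Sum>g\<in>Gp. c g * u g)" and "M = (\<Sum>h\<in>Gn. c h * (- u h))"
    define A B where "A = (\<Sum>g\<in>Gp. c g *\<^sub>R g)" and "B = (\<Sum>h\<in>Gn. c h *\<^sub>R h)"
    define Z where "Z = (\<Sum>g\<in>{g \<in> G. u g = 0}. c g *\<^sub>R g)"
    note split = sum_split_sign[OF G(1), of _ u, folded Gp_def Gn_def]
    have xs: "x = A + B + Z"
      using lincomb_nonneg_on[OF G(1) c(1)] c(2) by (simp add: split A_def B_def Z_def)
    have "u x = (\<Sum>g\<in>G. c g * u g)"
      using linear_lincomb[OF lin G(1) c(1)] c(2) by simp
    then have ux: "u x = P - M"
      by (simp add: split P_def M_def sum_negf)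
    have PM: "M \<le> P" using x ux by simp
    have M0: "0 \<le> M"
      unfolding M_def by (intro sum_nonneg mult_nonneg_nonneg) (use c0 in \<open>auto simp: Gn_def\<close>)
    have inG': "g \<in> cone_hull G'" if "g \<in> G'" for g using cone_hull_incl[of G'] that by blast
    have ZG: "Z \<in> cone_hull G'"
      unfolding Z_def using c0
      by (intro convex_cone_sum[OF ccG'] convex_cone_scaleR[OF ccG'] inG') (auto simp: G'_def)
    have AG: "A \<in> cone_hull G'"
      unfolding A_def using c0
      by (intro convex_cone_sum[OF ccG'] convex_cone_scaleR[OF ccG'] inG')
        (auto simp: G'_def Gp_def)
    show "x \<in> cone_hull G'"
    proof (cases "P = 0")
      case True
      then have "M = 0" using PM M0 by simp
      then have "\<forall>h\<in>Gn. c h * (- u h) = 0"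
        unfolding M_def using fin c0
        by (subst (asm) sum_nonneg_eq_0_iff) (auto simp: Gn_def mult_nonneg_nonpos)
      then have "B = 0" unfolding B_def by (intro sum.neutral) (auto simp: Gn_def)
      then show ?thesis using xs AG ZG convex_cone_add[OF ccG'] by simp
    next
      case False
      then have P: "0 < P" using PM M0 by simp
      have "P *\<^sub>R B + M *\<^sub>R A = (\<Sum>g\<in>Gp. \<Sum>h\<in>Gn. (c g * c h) *\<^sub>R mix (g, h))"
      proof -
        have "P *\<^sub>R B = (\<Sum>g\<in>Gp. \<Sum>h\<in>Gn. (c g * u g) *\<^sub>R (c h *\<^sub>R h))"
          unfolding P_def B_def scaleR_sum_left by (simp only: scaleR_sum_right)
        moreover have "M *\<^sub>R A = (\<Sum>g\<in>Gp. \<Sum>h\<in>Gn. (c h * (- u h)) *\<^sub>R (c g *\<^sub>R g))"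
          unfolding M_def A_def scaleR_sum_left by (simp only: scaleR_sum_right) (rule sum.swap)
        ultimately show ?thesis
          by (simp add: sum.distrib[symmetric] mix_def scaleR_right_diff_distrib
              algebra_simps del: sum.distrib)
      qed
      also have "\<dots> \<in> cone_hull G'"
        using c0
        by (intro convex_cone_sum[OF ccG'] convex_cone_scaleR[OF ccG'] inG')
          (auto simp: G'_def)
      finally have "(1 / P) *\<^sub>R (P *\<^sub>R B + M *\<^sub>R A) \<in> cone_hull G'"
        using P by (intro convex_cone_scaleR[OF ccG']) auto
      moreover have "(1 - M / P) *\<^sub>R A \<in> cone_hull G'"
        using P PM AG by (intro convex_cone_scaleR[OF ccG']) auto
      ultimately have "(1 / P) *\<^sub>R (P *\<^sub>R B + M *\<^sub>R A) + (1 - M / P) *\<^sub>R A + Z \<in> cone_hull G'"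
        using ZG by (intro convex_cone_add[OF ccG'])
      moreover have "(1 / P) *\<^sub>R (P *\<^sub>R B + M *\<^sub>R A) + (1 - M / P) *\<^sub>R A + Z = x"
        using P by (simp add: xs scaleR_right_distrib scaleR_left_diff_distrib)
      ultimately show ?thesis by simp
    qed
  qed
  ultimately show ?thesis using fin GW by blast
qed

text \<open>Halfspaces are imposed one at a time, starting from the whole space, which is generated
  by a basis in \<open>W\<close> and its negatives.\<close>

lemma polycone_generators:
  assumes "polycone W \<sigma>"
  obtains G where "finite G" "G \<subseteq> W" "\<sigma> = cone_hull G"
proof -
  obtain U where "finite U" "U \<subseteq> rational_forms" and \<sigma>: "\<sigma> = {x. \<forall>u\<in>U. 0 \<le> u x}"
    using assms unfolding polycone_iff by blast
  then have "\<exists>G. finite G \<and> G \<subseteq> W \<and> {x. \<forall>u\<in>U. 0 \<le> u x} = cone_hull G"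
  proof (induction U arbitrary: \<sigma> rule: finite_induct)
    case empty
    obtain E where E: "E \<subseteq> W" "independent E" "span E = UNIV" "finite E"
      using rational_basis by blast
    define G where "G = E \<union> uminus ` E"
    have G: "finite G" "G \<subseteq> W" using E W_uminus by (auto simp: G_def)
    note cc = convex_cone_cone_hull[OF G(1)]
    have "x \<in> cone_hull G" for x
    proof -
      let ?r = "representation E x"
      have "?r e *\<^sub>R e \<in> cone_hull G" if "e \<in> E" for e
      proof (cases "0 \<le> ?r e")
        case True
        then show ?thesis
          using that cone_hull_incl[of G] by (intro convex_cone_scaleR[OF cc]) (auto simp: G_def)
      next
        case False
        then have "(- ?r e) *\<^sub>R (- e) \<in> cone_hull G"
          using that cone_hull_incl[of G] by (intro convex_cone_scaleR[OF cc]) (auto simp: G_def)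
        then show ?thesis by simp
      qed
      then have "(\<Sum>e\<in>E. ?r e *\<^sub>R e) \<in> cone_hull G" by (intro convex_cone_sum[OF cc])
      then show ?thesis
        using real_vector.sum_representation_eq[OF E(2), of x E] E by simp
    qed
    then show ?case using G by auto
  next
    case (insert u U)
    then obtain G where G: "finite G" "G \<subseteq> W" "{x. \<forall>u\<in>U. 0 \<le> u x} = cone_hull G" by auto
    moreover have "{x. \<forall>v\<in>insert u U. 0 \<le> v x} = {x. \<forall>u\<in>U. 0 \<le> u x} \<inter> {x. 0 \<le> u x}"
      by auto
    ultimately show ?case using cone_hull_Int_halfspace[OF G(1,2), of u] insert by auto
  qed
  then show ?thesis using that \<sigma> by auto
qed

section \<open>Faces as extreme subcones, and separation of cones\<close>

lemma face_extreme:
  assumes "convex_cone \<sigma>" "polycone_face F \<sigma>"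
  shows "F \<subseteq> \<sigma>" "convex_cone F" "x \<in> \<sigma> \<Longrightarrow> y \<in> \<sigma> \<Longrightarrow> x + y \<in> F \<Longrightarrow> x \<in> F"
proof -
  obtain u where u: "linear u" "\<And>x. x \<in> \<sigma> \<Longrightarrow> 0 \<le> (u x :: real)" "F = \<sigma> \<inter> {x. u x = 0}"
    using assms(2) unfolding polycone_face_def by blast
  show "F \<subseteq> \<sigma>" using u by auto
  show "convex_cone F"
    using assms(1)
    by (simp add: u(3) convex_cone_iff linear_0[OF u(1)] linear_add[OF u(1)] linear_scale[OF u(1)])
  show "x \<in> F" if "x \<in> \<sigma>" "y \<in> \<sigma>" "x + y \<in> F"
    using that u(2)[OF that(1)] u(2)[OF that(2)] by (simp add: u(3) linear_add[OF u(1)])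
qed

text \<open>Converse of \<open>face_extreme\<close>; it recognizes faces without exhibiting a form.
  Take \<open>p\<close> in \<open>F\<close> positive under every defining form that does not vanish
  on \<open>F\<close>, and let \<open>v\<close> be the sum of the other forms. If \<open>v\<close>
  vanishes at a point \<open>x\<close> of \<sigma>, then \<open>k p - x\<close> lies in \<sigma> for
  large \<open>k\<close>, and extremeness applied to \<open>x + (k p - x)\<close> puts
  \<open>x\<close> into \<open>F\<close>.\<close>

lemma extreme_face:
  assumes "polycone W \<sigma>" "F \<subseteq> \<sigma>" "convex_cone F"
    and ext: "\<And>x y. x \<in> \<sigma> \<Longrightarrow> y \<in> \<sigma> \<Longrightarrow> x + y \<in> F \<Longrightarrow> x \<in> F"
  shows "polycone_face F \<sigma>"
proof -
  obtain U where U: "finite U" "U \<subseteq> rational_forms" and \<sigma>: "\<sigma> = {x. \<forall>u\<in>U. 0 \<le> u x}"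
    using assms(1) unfolding polycone_iff by blast
  have lin: "linear u" if "u \<in> U" for u using that U(2) rational_formD by blast
  have nonneg: "0 \<le> u x" if "u \<in> U" "x \<in> F" for u x
    using that assms(2) unfolding \<sigma> by blast
  define U1 where "U1 = {u \<in> U. \<exists>x\<in>F. 0 < u x}"
  have "\<forall>u. \<exists>x. u \<in> U1 \<longrightarrow> x \<in> F \<and> 0 < u x" by (auto simp: U1_def)
  then obtain f where f: "\<And>u. u \<in> U1 \<Longrightarrow> f u \<in> F \<and> 0 < u (f u)" by metis
  have U1: "finite U1" "U1 \<subseteq> U" using U by (auto simp: U1_def)
  define p where "p = (\<Sum>u\<in>U1. f u)"
  have pF: "p \<in> F" unfolding p_def using f by (intro convex_cone_sum[OF assms(3)]) auto
  have pos: "0 < u p" if "u \<in> U1" for u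
  proof -
    have uU: "u \<in> U" using U1 that by auto
    have "u p = (\<Sum>v\<in>U1. u (f v))" unfolding p_def using linear_sum[OF lin[OF uU]] .
    also have "\<dots> > 0"
      using U1 that f nonneg[OF uU] by (intro sum_pos2[of U1 u]) auto
    finally show ?thesis .
  qed
  define v where "v = (\<lambda>x. \<Sum>u\<in>U - U1. u x)"
  have linv: "linear v"
    unfolding v_def using lin by (intro linear_compose_sum) auto
  have vF: "F = \<sigma> \<inter> {x. v x = 0}"
  proof
    have "u x = 0" if "u \<in> U - U1" "x \<in> F" for u x
      using that nonneg[of u x] by (force simp: U1_def)
    then show "F \<subseteq> \<sigma> \<inter> {x. v x = 0}"
      using assms(2) by (auto simp: v_def intro!: sum.neutral)
    show "\<sigma> \<inter> {x. v x = 0} \<subseteq> F"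
    proof
      fix x assume x: "x \<in> \<sigma> \<inter> {x. v x = 0}"
      then have ux: "\<And>u. u \<in> U \<Longrightarrow> 0 \<le> u x" unfolding \<sigma> by blast
      have zero: "u x = 0" if "u \<in> U - U1" for u
      proof -
        have "(\<Sum>u\<in>U - U1. u x) = 0" using x by (simp add: v_def)
        then have "\<forall>u\<in>U - U1. u x = 0"
          using U(1) ux sum_nonneg_eq_0_iff[of "U - U1" "\<lambda>u. u x"] by blast
        then show ?thesis using that by blast
      qed
      obtain k :: real where k: "0 < k" "\<And>u. u \<in> U1 \<Longrightarrow> u x \<le> k * u p"
      proof -
        define k where "k = 1 + (\<Sum>u\<in>U1. u x / u p)"
        have q: "0 \<le> u x / u p" if "u \<in> U1" for u
          using that ux[of u] pos[of u] U1 by (auto intro!: divide_nonneg_pos)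
        have "u x \<le> k * u p" if "u \<in> U1" for u
        proof -
          have "u x / u p \<le> (\<Sum>u\<in>U1. u x / u p)"
            using q U1 that by (intro member_le_sum) auto
          then show ?thesis using pos[OF that] by (simp add: k_def field_simps)
        qed
        moreover have "0 < k" using q by (simp add: k_def add_pos_nonneg sum_nonneg)
        ultimately show ?thesis using that by blast
      qed
      have "0 \<le> u (k *\<^sub>R p - x)" if "u \<in> U" for u
      proof (cases "u \<in> U1")
        case True
        then show ?thesis
          using k by (simp add: linear_diff[OF lin[OF that]] linear_scale[OF lin[OF that]])
      next
        case False
        then have "u x = 0" using zero that by auto
        then show ?thesis
          using nonneg[OF that pF] k
          by (simp add: linear_diff[OF lin[OF that]] linear_scale[OF lin[OF that]])
      qed
      then have "k *\<^sub>R p - x \<in> \<sigma>" unfolding \<sigma> by blast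
      moreover have "x + (k *\<^sub>R p - x) \<in> F"
        using convex_cone_scaleR[OF assms(3) _ pF] k by simp
      ultimately show "x \<in> F" using ext x by blast
    qed
  qed
  moreover have "0 \<le> v x" if "x \<in> \<sigma>" for x
    using that unfolding v_def \<sigma> by (intro sum_nonneg) auto
  ultimately show ?thesis
    unfolding polycone_face_def using linv by blast
qed

text \<open>The difference cone of \<sigma> and \<tau> is a polycone, and the sum \<open>v\<close>
  of its defining forms vanishes on it only along its lineality space. If \<open>s\<close> in
  \<sigma> has \<open>v s = 0\<close>, then \<open>- s\<close> is again a difference, so
  \<open>s + s'\<close> lies in both cones for some \<open>s'\<close> in \<sigma>, and extremeness
  of the common face gives \<open>s\<close> in \<tau>.\<close>

lemma separating_form:
  assumes \<sigma>: "polycone W \<sigma>" and \<tau>: "polycone W \<tau>"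
    and "polycone_face (\<sigma> \<inter> \<tau>) \<sigma>" "polycone_face (\<sigma> \<inter> \<tau>) \<tau>"
  obtains v :: "'a \<Rightarrow> real" where "linear v"
    "\<And>x. x \<in> \<sigma> \<Longrightarrow> 0 \<le> v x" "\<And>x. x \<in> \<sigma> \<Longrightarrow> v x = 0 \<Longrightarrow> x \<in> \<tau>"
    "\<And>x. x \<in> \<tau> \<Longrightarrow> v x \<le> 0"
proof -
  have cc: "convex_cone \<sigma>" "convex_cone \<tau>" using \<sigma> \<tau> polycone_convex_cone by auto
  obtain G where G: "finite G" "G \<subseteq> W" "\<tau> = cone_hull G" using polycone_generators[OF \<tau>] .
  define \<kappa> where "\<kappa> = join \<sigma> (uminus ` G)"
  have cnm: "cone_hull (uminus ` G) = uminus ` \<tau>"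
    using G convex_cone_hull_linear_image[OF linear_uminus, of G] by (simp add: cone_hull_eq_hull)
  have \<kappa>: "\<kappa> = {s - t | s t. s \<in> \<sigma> \<and> t \<in> \<tau>}"
    unfolding \<kappa>_def join_def cnm by force
  have "polycone W \<kappa>"
    unfolding \<kappa>_def using G W_uminus \<sigma> by (intro polycone_join) auto
  then obtain U where U: "finite U" "U \<subseteq> rational_forms" and \<kappa>U: "\<kappa> = {x. \<forall>u\<in>U. 0 \<le> u x}"
    unfolding polycone_iff by blast
  have lin: "linear u" if "u \<in> U" for u using that U(2) rational_formD by blast
  define v where "v = (\<lambda>x. \<Sum>u\<in>U. u x)"
  have linv: "linear v" unfolding v_def using lin by (intro linear_compose_sum) auto
  have nonneg: "0 \<le> v x" if "x \<in> \<kappa>" for x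
    using that unfolding v_def \<kappa>U by (intro sum_nonneg) auto
  have sk: "s \<in> \<kappa>" if "s \<in> \<sigma>" for s
    using that convex_cone_contains_0[OF cc(2)] unfolding \<kappa> by force
  have tk: "- t \<in> \<kappa>" if "t \<in> \<tau>" for t
    using that convex_cone_contains_0[OF cc(1)] unfolding \<kappa> by force
  show ?thesis
  proof (rule that)
    show "linear v" by (rule linv)
    show "0 \<le> v x" if "x \<in> \<sigma>" for x using nonneg sk that by blast
    show "v x \<le> 0" if "x \<in> \<tau>" for x
      using nonneg[OF tk[OF that]] by (simp add: linear_neg[OF linv])
    show "s \<in> \<tau>" if s: "s \<in> \<sigma>" "v s = 0" for s
    proof -
      have us: "\<And>u. u \<in> U \<Longrightarrow> 0 \<le> u s" using sk[OF s(1)] unfolding \<kappa>U by blast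
      have "\<forall>u\<in>U. u s = 0"
        using s(2) U(1) us unfolding v_def by (subst (asm) sum_nonneg_eq_0_iff) auto
      then have "- s \<in> \<kappa>" unfolding \<kappa>U by (auto simp: linear_neg[OF lin])
      then obtain s' t' where "- s = s' - t'" "s' \<in> \<sigma>" "t' \<in> \<tau>" unfolding \<kappa> by blast
      then have "s + s' = t'" by (metis add.commute add_uminus_conv_diff diff_add_cancel
          minus_diff_eq uminus_add_conv_diff minus_minus)
      then have "s + s' \<in> \<sigma> \<inter> \<tau>"
        using convex_cone_add[OF cc(1) s(1) \<open>s' \<in> \<sigma>\<close>] \<open>t' \<in> \<tau>\<close> by simp
      then show ?thesis
        using face_extreme(3)[OF cc(1) assms(3) s(1) \<open>s' \<in> \<sigma>\<close>] by simp
    qed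
  qed
qed

subsection \<open>Semifans and relative fans\<close>

lemma face_refl: "polycone_face \<sigma> (\<sigma> :: 'a set)"
  unfolding polycone_face_def by (rule exI[of _ "\<lambda>_. 0"]) (auto simp: linear_iff)

lemma face_trans:
  assumes "polycone W \<sigma>" "polycone_face \<tau> \<sigma>" "polycone_face \<phi> \<tau>"
  shows "polycone_face \<phi> \<sigma>"
proof (rule extreme_face[OF assms(1)])
  note \<sigma> = face_extreme[OF polycone_convex_cone[OF assms(1)] assms(2)]
  note \<tau> = face_extreme[OF \<sigma>(2) assms(3)]
  show "\<phi> \<subseteq> \<sigma>" "convex_cone \<phi>" using \<sigma>(1) \<tau>(1,2) by auto
  show "x \<in> \<phi>" if "x \<in> \<sigma>" "y \<in> \<sigma>" "x + y \<in> \<phi>" for x y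
    using \<sigma>(3)[of x y] \<sigma>(3)[of y x] \<tau>(1) \<tau>(3)[of x y] that by (auto simp: add.commute)
qed

lemma semifanD:
  assumes "semifan W \<Sigma>"
  shows "finite \<Sigma>" "\<sigma> \<in> \<Sigma> \<Longrightarrow> polycone W \<sigma>" "\<sigma> \<in> \<Sigma> \<Longrightarrow> convex_cone \<sigma>"
    "\<sigma> \<in> \<Sigma> \<Longrightarrow> polycone_face \<tau> \<sigma> \<Longrightarrow> \<tau> \<in> \<Sigma>"
    "\<sigma> \<in> \<Sigma> \<Longrightarrow> \<tau> \<in> \<Sigma> \<Longrightarrow> polycone_face (\<sigma> \<inter> \<tau>) \<sigma>"
    "\<sigma> \<in> \<Sigma> \<Longrightarrow> \<tau> \<in> \<Sigma> \<Longrightarrow> \<sigma> \<inter> \<tau> \<in> \<Sigma>"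
proof -
  show "finite \<Sigma>" and poly: "\<sigma> \<in> \<Sigma> \<Longrightarrow> polycone W \<sigma>"
    and face: "\<sigma> \<in> \<Sigma> \<Longrightarrow> polycone_face \<tau> \<sigma> \<Longrightarrow> \<tau> \<in> \<Sigma>"
    and int: "\<sigma> \<in> \<Sigma> \<Longrightarrow> \<tau> \<in> \<Sigma> \<Longrightarrow> polycone_face (\<sigma> \<inter> \<tau>) \<sigma>" for \<sigma> \<tau>
    using assms by (simp_all add: semifan_def)
  show "\<sigma> \<in> \<Sigma> \<Longrightarrow> convex_cone \<sigma>" using poly polycone_convex_cone by simp
  show "\<sigma> \<in> \<Sigma> \<Longrightarrow> \<tau> \<in> \<Sigma> \<Longrightarrow> \<sigma> \<inter> \<tau> \<in> \<Sigma>" using face int by simp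
qed

text \<open>The lineality space of a cone is a face of it, hence a member of
  \<open>\<Sigma>\<close>. Its intersection with any other member is a face of a subspace, hence the
  whole subspace. So all members share one lineality space, which is therefore their
  intersection.\<close>

lemma semifan_lineality:
  assumes "semifan W \<Sigma>" "\<Sigma> \<noteq> {}"
  shows "subspace (\<Inter>\<Sigma>)" "\<Inter>\<Sigma> \<in> \<Sigma>"
    "\<sigma> \<in> \<Sigma> \<Longrightarrow> x \<in> \<sigma> \<Longrightarrow> - x \<in> \<sigma> \<Longrightarrow> x \<in> \<Inter>\<Sigma>"
proof -
  define lin where "lin = (\<lambda>\<sigma>. {x \<in> \<sigma>. - x \<in> (\<sigma> :: 'a set)})"
  have cc: "convex_cone (lin \<sigma>)" if "\<sigma> \<in> \<Sigma>" for \<sigma>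
    using semifanD(3)[OF assms(1) that] unfolding lin_def convex_cone_iff
    by (auto simp: minus_add_distrib simp del: add_uminus_conv_diff minus_add)
  have face: "polycone_face (lin \<sigma>) \<sigma>" if "\<sigma> \<in> \<Sigma>" for \<sigma>
  proof (rule extreme_face)
    show "polycone W \<sigma>" using semifanD(2)[OF assms(1) that] .
    show "lin \<sigma> \<subseteq> \<sigma>" by (auto simp: lin_def)
    show "convex_cone (lin \<sigma>)" using cc[OF that] .
    show "x \<in> lin \<sigma>" if xy: "x \<in> \<sigma>" "y \<in> \<sigma>" "x + y \<in> lin \<sigma>" for x y
    proof -
      have "y + - (x + y) \<in> \<sigma>"
        using xy convex_cone_add[OF semifanD(3)[OF assms(1) \<open>\<sigma> \<in> \<Sigma>\<close>]]
        unfolding lin_def by blast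
      then show ?thesis using xy by (simp add: lin_def)
    qed
  qed
  have lin_in: "lin \<sigma> \<in> \<Sigma>" if "\<sigma> \<in> \<Sigma>" for \<sigma>
    using semifanD(4)[OF assms(1) that face[OF that]] .
  have eq: "\<Inter>\<Sigma> = lin \<sigma>" if \<sigma>: "\<sigma> \<in> \<Sigma>" for \<sigma>
  proof
    show "\<Inter>\<Sigma> \<subseteq> lin \<sigma>" using lin_in[OF \<sigma>] by auto
    show "lin \<sigma> \<subseteq> \<Inter>\<Sigma>"
    proof
      fix x assume x: "x \<in> lin \<sigma>"
      have "x \<in> \<tau>" if \<tau>: "\<tau> \<in> \<Sigma>" for \<tau>
      proof -
        have f: "polycone_face (lin \<sigma> \<inter> \<tau>) (lin \<sigma>)"
          using semifanD(5)[OF assms(1) lin_in[OF \<sigma>] \<tau>] .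
        have "- x \<in> lin \<sigma>" using x by (auto simp: lin_def)
        moreover have "x + - x \<in> lin \<sigma> \<inter> \<tau>"
          using convex_cone_contains_0[OF face_extreme(2)[OF cc[OF \<sigma>] f]] by simp
        ultimately have "x \<in> lin \<sigma> \<inter> \<tau>"
          using face_extreme(3)[OF cc[OF \<sigma>] f x] by blast
        then show ?thesis by simp
      qed
      then show "x \<in> \<Inter>\<Sigma>" by blast
    qed
  qed
  obtain \<sigma>0 where \<sigma>0: "\<sigma>0 \<in> \<Sigma>" using assms(2) by blast
  show "\<Inter>\<Sigma> \<in> \<Sigma>" using lin_in[OF \<sigma>0] eq[OF \<sigma>0] by simp
  have "subspace (lin \<sigma>0)"
  proof -
    have "- x \<in> lin \<sigma>0" if "x \<in> lin \<sigma>0" for x using that by (auto simp: lin_def)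
    then show ?thesis using cc[OF \<sigma>0] subspace_convex_cone_symmetric by blast
  qed
  then show "subspace (\<Inter>\<Sigma>)" using eq[OF \<sigma>0] by simp
  show "x \<in> \<Inter>\<Sigma>" if "\<sigma> \<in> \<Sigma>" "x \<in> \<sigma>" "- x \<in> \<sigma>"
    using that eq[OF that(1)] by (auto simp: lin_def)
qed

text \<open>The pair \<open>(\<sigma>, B)\<close> stands for \<open>join \<sigma> B\<close>. The
  uniqueness condition does two jobs: applied to one pair it makes the join direct, so that
  \<open>B\<close> is independent modulo the span of \<sigma>; applied to two pairs it makes the
  joins meet exactly in the join of the common base and the common generators.\<close>

definition relative_fan :: "'a set set \<Rightarrow> ('a set \<times> 'a set) set \<Rightarrow> bool" where
  "relative_fan \<Sigma> P \<longleftrightarrow>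
     finite P \<and>
     (\<forall>\<sigma> B. (\<sigma>, B) \<in> P \<longrightarrow> \<sigma> \<in> \<Sigma> \<and> finite B \<and> B \<subseteq> W) \<and>
     (\<forall>\<sigma> B \<phi> A. (\<sigma>, B) \<in> P \<longrightarrow> polycone_face \<phi> \<sigma> \<longrightarrow> A \<subseteq> B \<longrightarrow> (\<phi>, A) \<in> P) \<and>
     (\<forall>\<sigma>\<in>\<Sigma>. (\<sigma>, {}) \<in> P) \<and>
     (\<forall>\<sigma> B \<sigma>' B' s s' c c'. (\<sigma>, B) \<in> P \<longrightarrow> (\<sigma>', B') \<in> P \<longrightarrow> s \<in> \<sigma> \<longrightarrow> s' \<in> \<sigma>' \<longrightarrow>
        c \<in> nonneg_on B \<longrightarrow> c' \<in> nonneg_on B' \<longrightarrow> s + lincomb c = s' + lincomb c' \<longrightarrow> s = s' \<and> c = c')"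

definition cones :: "('a set \<times> 'a set) set \<Rightarrow> 'a set set" where
  "cones P = (\<lambda>(\<sigma>, B). join \<sigma> B) ` P"

lemma relative_fanD:
  assumes "relative_fan \<Sigma> P"
  shows "finite P"
    "(\<sigma>, B) \<in> P \<Longrightarrow> \<sigma> \<in> \<Sigma>" "(\<sigma>, B) \<in> P \<Longrightarrow> finite B" "(\<sigma>, B) \<in> P \<Longrightarrow> B \<subseteq> W"
    "(\<sigma>, B) \<in> P \<Longrightarrow> polycone_face \<phi> \<sigma> \<Longrightarrow> A \<subseteq> B \<Longrightarrow> (\<phi>, A) \<in> P"
    "\<sigma> \<in> \<Sigma> \<Longrightarrow> (\<sigma>, {}) \<in> P"
proof -
  note 1 = assms[unfolded relative_fan_def, THEN conjunct1]
  note 2 = assms[unfolded relative_fan_def, THEN conjunct2, THEN conjunct1, rule_format]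
  note 3 = assms[unfolded relative_fan_def, THEN conjunct2, THEN conjunct2, THEN conjunct1,
      rule_format]
  note 4 = assms[unfolded relative_fan_def, THEN conjunct2, THEN conjunct2, THEN conjunct2,
      THEN conjunct1, rule_format]
  show "finite P" by (rule 1)
  show "\<sigma> \<in> \<Sigma>" "finite B" "B \<subseteq> W" if "(\<sigma>, B) \<in> P"
    using 2[OF that] by auto
  show "(\<phi>, A) \<in> P" if "(\<sigma>, B) \<in> P" "polycone_face \<phi> \<sigma>" "A \<subseteq> B"
    by (rule 3[OF that])
  show "(\<sigma>, {}) \<in> P" if "\<sigma> \<in> \<Sigma>"
    by (rule 4[OF that])
qed

lemma relative_fan_unique:
  assumes "relative_fan \<Sigma> P" "(\<sigma>, B) \<in> P" "(\<sigma>', B') \<in> P" "s \<in> \<sigma>" "s' \<in> \<sigma>'"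
    "c \<in> nonneg_on B" "c' \<in> nonneg_on B'" "s + lincomb c = s' + lincomb c'"
  shows "s = s'" "c = c'"
proof -
  have "s = s' \<and> c = c'"
    using assms(1)[unfolded relative_fan_def, THEN conjunct2, THEN conjunct2, THEN conjunct2,
        THEN conjunct2, rule_format, OF assms(2-8)] .
  then show "s = s'" "c = c'" by auto
qed

lemma relative_fan_base: "semifan W \<Sigma> \<Longrightarrow> relative_fan \<Sigma> ((\<lambda>\<sigma>. (\<sigma>, {})) ` \<Sigma>)"
  unfolding relative_fan_def using semifanD(1,4)[of \<Sigma>]
  by (intro conjI allI impI ballI) auto

lemma conesE:
  assumes "\<kappa> \<in> cones P"
  obtains \<sigma> B where "(\<sigma>, B) \<in> P" "\<kappa> = join \<sigma> B"
  using assms by (auto simp: cones_def)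

lemma conesI: "(\<sigma>, B) \<in> P \<Longrightarrow> join \<sigma> B \<in> cones P"
  by (force simp: cones_def)

lemma cones_superset: "relative_fan \<Sigma> P \<Longrightarrow> \<Sigma> \<subseteq> cones P"
  using conesI[of _ "{}" P] relative_fanD(6) by fastforce

context
  fixes \<Sigma> P
  assumes \<Sigma>: "semifan W \<Sigma>" and P: "relative_fan \<Sigma> P"
begin

lemma polycone_cones: "(\<sigma>, B) \<in> P \<Longrightarrow> polycone W (join \<sigma> B)"
  by (intro polycone_join relative_fanD(3,4)[OF P] semifanD(2)[OF \<Sigma>] relative_fanD(2)[OF P])

text \<open>By uniqueness, base parts and coefficients add up separately. Extremeness of \<phi>
  controls the base part, nonnegativity the coefficients.\<close>

lemma join_face:
  assumes "(\<sigma>, B) \<in> P" "polycone_face \<phi> \<sigma>" "A \<subseteq> B"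
  shows "polycone_face (join \<phi> A) (join \<sigma> B)"
proof (rule extreme_face[OF polycone_cones[OF assms(1)]])
  have cc: "convex_cone \<sigma>" using semifanD(3)[OF \<Sigma>] relative_fanD(2)[OF P assms(1)] by blast
  have fin: "finite B" using relative_fanD(3)[OF P assms(1)] .
  note fe = face_extreme[OF cc assms(2)]
  show "join \<phi> A \<subseteq> join \<sigma> B" using join_mono fe assms(3) by blast
  show "convex_cone (join \<phi> A)"
    using convex_cone_join fe finite_subset[OF assms(3) fin] by blast
  show "x \<in> join \<phi> A" if xy: "x \<in> join \<sigma> B" "y \<in> join \<sigma> B" "x + y \<in> join \<phi> A" for x y
  proof -
    obtain s c where s: "s \<in> \<sigma>" "c \<in> nonneg_on B" "x = s + lincomb c" using xy(1) by (rule joinE)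
    obtain s' c' where s': "s' \<in> \<sigma>" "c' \<in> nonneg_on B" "y = s' + lincomb c'" using xy(2) by (rule joinE)
    obtain t d where t: "t \<in> \<phi>" "d \<in> nonneg_on A" "x + y = t + lincomb d" using xy(3) by (rule joinE)
    have cc': "(\<lambda>b. c b + c' b) \<in> nonneg_on B" using nonneg_on_add[OF s(2) s'(2)] by simp
    have eq: "(s + s') + lincomb (\<lambda>b. c b + c' b) = t + lincomb d"
      using t(3) s(3) s'(3) lincomb_add[OF fin fin s(2) s'(2)] by (simp add: algebra_simps)
    have "d \<in> nonneg_on B" using nonneg_on_mono[OF assms(3)] t(2) by blast
    note u = relative_fan_unique[OF P assms(1,1) convex_cone_add[OF cc s(1) s'(1)] _ cc' this eq]
    have "t \<in> \<sigma>" using t fe(1) by blast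
    have "s \<in> \<phi>" using u(1)[OF \<open>t \<in> \<sigma>\<close>] fe(3)[OF s(1) s'(1)] t(1) by simp
    moreover have "c \<in> nonneg_on A"
    proof -
      have "c b = 0" if "b \<notin> A" for b
        using fun_cong[OF u(2)[OF \<open>t \<in> \<sigma>\<close>], of b] nonneg_onD[OF s(2), of b] nonneg_onD[OF s'(2), of b]
          nonneg_onD(2)[OF t(2) that] by linarith
      then show ?thesis using s(2) by (auto simp: nonneg_on_def)
    qed
    ultimately show ?thesis using s(3) joinI by blast
  qed
qed

lemma cones_Int:
  assumes "(\<sigma>, B) \<in> P" "(\<sigma>', B') \<in> P"
  shows "join \<sigma> B \<inter> join \<sigma>' B' = join (\<sigma> \<inter> \<sigma>') (B \<inter> B')"
proof
  show "join \<sigma> B \<inter> join \<sigma>' B' \<subseteq> join (\<sigma> \<inter> \<sigma>') (B \<inter> B')"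
  proof
    fix x assume x: "x \<in> join \<sigma> B \<inter> join \<sigma>' B'"
    obtain s c where s: "s \<in> \<sigma>" "c \<in> nonneg_on B" "x = s + lincomb c" using IntD1[OF x] by (rule joinE)
    obtain s' c' where s': "s' \<in> \<sigma>'" "c' \<in> nonneg_on B'" "x = s' + lincomb c'"
      using IntD2[OF x] by (rule joinE)
    have "s = s'" "c = c'"
      using relative_fan_unique[OF P assms s(1) s'(1) s(2) s'(2)] s(3) s'(3) by auto
    then show "x \<in> join (\<sigma> \<inter> \<sigma>') (B \<inter> B')"
      using s s' by (auto intro!: joinI nonneg_on_Int)
  qed
  show "join (\<sigma> \<inter> \<sigma>') (B \<inter> B') \<subseteq> join \<sigma> B \<inter> join \<sigma>' B'"
    by (simp add: join_mono)
qed

lemma semifan_cones: "semifan W (cones P)"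
  unfolding semifan_def
proof (intro conjI ballI allI impI)
  show "finite (cones P)" using relative_fanD(1)[OF P] by (simp add: cones_def)
  show "polycone W \<kappa>" if "\<kappa> \<in> cones P" for \<kappa> using conesE[OF that] polycone_cones by metis
  show "F \<in> cones P" if \<kappa>: "\<kappa> \<in> cones P" and F: "polycone_face F \<kappa>" for \<kappa> F
  proof -
    obtain \<sigma> B where B: "(\<sigma>, B) \<in> P" and \<kappa>B: "\<kappa> = join \<sigma> B" using \<kappa> by (rule conesE)
    have fin: "finite B" and cc: "convex_cone \<sigma>"
      using relative_fanD(2,3)[OF P B] semifanD(3)[OF \<Sigma>] by auto
    obtain u where u: "linear u" "\<And>x. x \<in> \<kappa> \<Longrightarrow> 0 \<le> (u x :: real)" "F = \<kappa> \<inter> {x. u x = 0}"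
      using F unfolding polycone_face_def by blast
    \<comment> \<open>The form is nonnegative on \<sigma> and on \<open>B\<close>, so it vanishes at
      \<open>s + lincomb c\<close> only if it vanishes at \<open>s\<close> and at each generator
      with positive coefficient.\<close>
    define \<phi> A where "\<phi> = \<sigma> \<inter> {x. u x = 0}" and "A = {b \<in> B. u b = 0}"
    have us: "0 \<le> u x" if "x \<in> \<sigma>" for x using u(2) join_base that unfolding \<kappa>B by blast
    have ub: "0 \<le> u b" if "b \<in> B" for b using u(2) join_incl[OF cc] that unfolding \<kappa>B by blast
    have "F = join \<phi> A"
    proof
      show "F \<subseteq> join \<phi> A"
      proof
        fix x assume x: "x \<in> F"
        then have "x \<in> join \<sigma> B" using u(3) \<kappa>B by simp
        then obtain s c where s: "s \<in> \<sigma>" "c \<in> nonneg_on B" "x = s + lincomb c" by (rule joinE)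
        have 0: "u s + (\<Sum>b\<in>B. c b * u b) = 0"
          using x u(3) s(3) linear_lincomb[OF u(1) fin s(2)] by (simp add: linear_add[OF u(1)])
        have "0 \<le> (\<Sum>b\<in>B. c b * u b)" using ub nonneg_onD(1)[OF s(2)] by (simp add: sum_nonneg)
        then have "u s = 0" and "(\<Sum>b\<in>B. c b * u b) = 0" using 0 us[OF s(1)] by auto
        then have "\<forall>b\<in>B. c b * u b = 0"
          using ub nonneg_onD(1)[OF s(2)] fin sum_nonneg_eq_0_iff[of B "\<lambda>b. c b * u b"] by simp
        then have "c \<in> nonneg_on A" using s(2) by (auto simp: nonneg_on_def A_def)
        then show "x \<in> join \<phi> A" using s \<open>u s = 0\<close> by (auto simp: \<phi>_def intro!: joinI)
      qed
      show "join \<phi> A \<subseteq> F"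
      proof
        fix x assume "x \<in> join \<phi> A"
        then obtain s c where s: "s \<in> \<phi>" "c \<in> nonneg_on A" "x = s + lincomb c" by (rule joinE)
        have "u (lincomb c) = 0"
          using linear_lincomb[OF u(1) _ s(2)] fin by (simp add: A_def)
        moreover have "x \<in> join \<sigma> B"
          using join_mono[of \<phi> \<sigma> A B] joinI[OF s(1,2)] s(3) by (auto simp: \<phi>_def A_def)
        ultimately show "x \<in> F"
          using s by (auto simp: u(3) \<kappa>B \<phi>_def linear_add[OF u(1)])
      qed
    qed
    moreover have "(\<phi>, A) \<in> P"
      using relative_fanD(5)[OF P B, of \<phi> A] u(1) us
      by (auto simp: \<phi>_def A_def polycone_face_def)
    ultimately show ?thesis using conesI by simp
  qed
  show "polycone_face (\<kappa> \<inter> \<kappa>') \<kappa>" if \<kappa>: "\<kappa> \<in> cones P" "\<kappa>' \<in> cones P" for \<kappa> \<kappa>'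
  proof -
    obtain \<sigma> B where B: "(\<sigma>, B) \<in> P" and \<kappa>B: "\<kappa> = join \<sigma> B" using \<kappa>(1) by (rule conesE)
    obtain \<sigma>' B' where B': "(\<sigma>', B') \<in> P" and \<kappa>B': "\<kappa>' = join \<sigma>' B'" using \<kappa>(2) by (rule conesE)
    have "polycone_face (\<sigma> \<inter> \<sigma>') \<sigma>"
      using semifanD(5)[OF \<Sigma>] relative_fanD(2)[OF P] B B' by blast
    then show ?thesis
      unfolding \<kappa>B \<kappa>B' cones_Int[OF B B'] using join_face[OF B] by simp
  qed
qed

text \<open>Uniqueness is obtained in two stages: over \<open>cones P\<close> for the generators
  from \<open>Q\<close>, then over \<open>\<Sigma>\<close> for those from \<open>P\<close>. This
  allows \<open>\<Sigma>\<close> to be extended repeatedly, for one \<open>r\<close> after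
  another.\<close>

lemma relative_fan_compose:
  assumes Q: "relative_fan (cones P) Q"
  obtains P' where "relative_fan \<Sigma> P'" "cones P' = cones Q"
proof -
  define P' where
    "P' = {(\<sigma>, B \<union> B') | \<sigma> B B'. (\<sigma>, B) \<in> P \<and> (join \<sigma> B, B') \<in> Q}"
  have P'_iff: "(\<sigma>, C) \<in> P' \<longleftrightarrow> (\<exists>B B'. C = B \<union> B' \<and> (\<sigma>, B) \<in> P \<and> (join \<sigma> B, B') \<in> Q)"
    for \<sigma> C
    unfolding P'_def by simp
  have P'E: "\<exists>B B'. C = B \<union> B' \<and> (\<sigma>, B) \<in> P \<and> (join \<sigma> B, B') \<in> Q \<and> B \<inter> B' = {} \<and>
      finite B \<and> finite B' \<and> B \<subseteq> W \<and> B' \<subseteq> W \<and> \<sigma> \<in> \<Sigma>" if C: "(\<sigma>, C) \<in> P'" for \<sigma> C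
  proof -
    obtain B B' where BB': "C = B \<union> B'" "(\<sigma>, B) \<in> P" "(join \<sigma> B, B') \<in> Q"
      using C unfolding P'_iff by blast
    have fin: "finite B" "finite B'" "B \<subseteq> W" "B' \<subseteq> W" "\<sigma> \<in> \<Sigma>"
      using relative_fanD(2-4)[OF P BB'(2)] relative_fanD(3,4)[OF Q BB'(3)] by simp_all
    have cc: "convex_cone \<sigma>" using semifanD(3)[OF \<Sigma>] fin by blast
    \<comment> \<open>A common \<open>b\<close> would be both a base point in
      \<open>join \<sigma> B\<close> and a generator of \<open>Q\<close>, hence have two expressions
      over \<open>Q\<close>. Disjointness lets a coefficient function on the union be split.\<close>
    have False if b: "b \<in> B" "b \<in> B'" for b
    proof -
      have "b \<in> join \<sigma> B" using join_incl[OF cc] b by blast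
      moreover have "0 \<in> join \<sigma> B"
        using convex_cone_contains_0[OF convex_cone_join[OF cc fin(1)]] .
      moreover have "b + lincomb (\<lambda>_. 0) = 0 + lincomb (\<lambda>x. if x = b then 1 else 0)" by simp
      ultimately have "(\<lambda>_. 0) = (\<lambda>x. if x = b then 1 else (0::real))"
        using relative_fan_unique(2)[OF Q BB'(3,3), of b 0] nonneg_on_single[OF b(2), of 1] by auto
      then show False by (metis zero_neq_one)
    qed
    then have "B \<inter> B' = {}" by blast
    then show ?thesis using BB' fin by (intro exI[of _ B] exI[of _ B'] conjI)
  qed
  have "relative_fan \<Sigma> P'"
    unfolding relative_fan_def
  proof (intro conjI allI impI ballI)
    have "P' \<subseteq> (\<lambda>((\<sigma>, B), (\<kappa>, B')). (\<sigma>, B \<union> B')) ` (P \<times> Q)"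
    proof
      fix p assume "p \<in> P'"
      then obtain \<sigma> B B' where "p = (\<sigma>, B \<union> B')" "(\<sigma>, B) \<in> P" "(join \<sigma> B, B') \<in> Q"
        by (cases p) (auto simp: P'_iff)
      then show "p \<in> (\<lambda>((\<sigma>, B), (\<kappa>, B')). (\<sigma>, B \<union> B')) ` (P \<times> Q)"
        by (intro image_eqI[of _ _ "((\<sigma>, B), (join \<sigma> B, B'))"]) auto
    qed
    then show "finite P'"
      using relative_fanD(1)[OF P] relative_fanD(1)[OF Q] by (blast intro: finite_subset)
    show "\<sigma> \<in> \<Sigma>" "finite C" "C \<subseteq> W" if "(\<sigma>, C) \<in> P'" for \<sigma> C
      using P'E[OF that] by auto
    show "(\<phi>, A) \<in> P'" if C: "(\<sigma>, C) \<in> P'" and F: "polycone_face \<phi> \<sigma>" "A \<subseteq> C" for \<sigma> C \<phi> A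
    proof -
      obtain B B' where BB': "C = B \<union> B'" "(\<sigma>, B) \<in> P" "(join \<sigma> B, B') \<in> Q"
        using P'E[OF C] by blast
      have "(\<phi>, A \<inter> B) \<in> P" using relative_fanD(5)[OF P BB'(2) F(1)] by simp
      moreover have "(join \<phi> (A \<inter> B), A \<inter> B') \<in> Q"
        using relative_fanD(5)[OF Q BB'(3) join_face[OF BB'(2) F(1)]] by simp
      moreover have "A = (A \<inter> B) \<union> (A \<inter> B')" using F(2) BB'(1) by blast
      ultimately show ?thesis unfolding P'_iff by blast
    qed
    show "(\<sigma>, {}) \<in> P'" if "\<sigma> \<in> \<Sigma>" for \<sigma>
    proof -
      have "(\<sigma>, {}) \<in> P" using relative_fanD(6)[OF P that] .
      moreover from this have "(join \<sigma> {}, {}) \<in> Q"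
        by (intro relative_fanD(6)[OF Q] conesI)
      ultimately show ?thesis unfolding P'_iff by (intro exI[of _ "{}"]) simp
    qed
    fix \<sigma> C \<sigma>' C' s s' c c'
    assume C: "(\<sigma>, C) \<in> P'" "(\<sigma>', C') \<in> P'" and s: "s \<in> \<sigma>" "s' \<in> \<sigma>'"
      and c: "c \<in> nonneg_on C" "c' \<in> nonneg_on C'" and eq: "s + lincomb c = s' + lincomb c'"
    obtain B1 B2 where B: "C = B1 \<union> B2" "(\<sigma>, B1) \<in> P" "(join \<sigma> B1, B2) \<in> Q" "B1 \<inter> B2 = {}"
      "finite B1" "finite B2" using P'E[OF C(1)] by blast
    obtain B1' B2' where B': "C' = B1' \<union> B2'" "(\<sigma>', B1') \<in> P" "(join \<sigma>' B1', B2') \<in> Q"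
      "B1' \<inter> B2' = {}" "finite B1'" "finite B2'" using P'E[OF C(2)] by blast
    have split: "\<exists>c1 c2. c1 \<in> nonneg_on D1 \<and> c2 \<in> nonneg_on D2 \<and> d = (\<lambda>b. c1 b + c2 b) \<and> lincomb d = lincomb c1 + lincomb c2"
      if "d \<in> nonneg_on (D1 \<union> D2)" "D1 \<inter> D2 = {}" "finite D1" "finite D2" for d and D1 D2 :: "'a set"
    proof -
      define d1 d2 where "d1 = (\<lambda>b. if b \<in> D1 then d b else 0)"
        and "d2 = (\<lambda>b. if b \<in> D1 then 0 else d b)"
      have *: "d1 \<in> nonneg_on D1" "d2 \<in> nonneg_on D2" "d = (\<lambda>b. d1 b + d2 b)"
        using that(1,2) by (auto simp: nonneg_on_def d1_def d2_def)
      moreover have "lincomb d = lincomb d1 + lincomb d2"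
        using lincomb_add[OF that(3,4) *(1,2)] *(3) by simp
      ultimately show ?thesis by blast
    qed
    obtain c1 c2 where c12: "c1 \<in> nonneg_on B1" "c2 \<in> nonneg_on B2" "c = (\<lambda>b. c1 b + c2 b)"
      "lincomb c = lincomb c1 + lincomb c2" using split[OF c(1)[unfolded B(1)] B(4-6)] by blast
    obtain c1' c2' where c12': "c1' \<in> nonneg_on B1'" "c2' \<in> nonneg_on B2'" "c' = (\<lambda>b. c1' b + c2' b)"
      "lincomb c' = lincomb c1' + lincomb c2'" using split[OF c(2)[unfolded B'(1)] B'(4-6)] by blast
    have "(s + lincomb c1) + lincomb c2 = (s' + lincomb c1') + lincomb c2'"
      using eq c12 c12' by (simp add: add.assoc)
    note u = relative_fan_unique[OF Q B(3) B'(3) joinI[OF s(1) c12(1)] joinI[OF s(2) c12'(1)]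
        c12(2) c12'(2) this]
    note u' = relative_fan_unique[OF P B(2) B'(2) s c12(1) c12'(1) u(1)]
    show "s = s'" "c = c'" using u u' c12 c12' by auto
  qed
  moreover have "cones P' = cones Q"
  proof
    show "cones P' \<subseteq> cones Q"
    proof
      fix \<kappa> assume "\<kappa> \<in> cones P'"
      then obtain \<sigma> C where C: "(\<sigma>, C) \<in> P'" "\<kappa> = join \<sigma> C" by (rule conesE)
      obtain B B' where "C = B \<union> B'" "(join \<sigma> B, B') \<in> Q" "finite B" "finite B'"
        using P'E[OF C(1)] by blast
      then show "\<kappa> \<in> cones Q" using C(2) conesI[of "join \<sigma> B" B' Q] by (simp add: join_Un)
    qed
    show "cones Q \<subseteq> cones P'"
    proof
      fix \<kappa> assume "\<kappa> \<in> cones Q"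
      then obtain \<delta> B' where \<delta>: "(\<delta>, B') \<in> Q" "\<kappa> = join \<delta> B'" by (rule conesE)
      obtain \<sigma> B where \<sigma>: "(\<sigma>, B) \<in> P" "\<delta> = join \<sigma> B"
        using relative_fanD(2)[OF Q \<delta>(1)] by (rule conesE)
      have "\<kappa> = join \<sigma> (B \<union> B')"
        using \<delta> \<sigma> join_Un[OF relative_fanD(3)[OF P \<sigma>(1)] relative_fanD(3)[OF Q \<delta>(1)]] by simp
      moreover have "(\<sigma>, B \<union> B') \<in> P'" using \<delta> \<sigma> unfolding P'_iff by blast
      ultimately show "\<kappa> \<in> cones P'" using conesI by simp
    qed
  qed
  ultimately show ?thesis using that by blast
qed

end

subsection \<open>Completing a star\<close>

text \<open>As \<open>r\<close> lies in \<open>\<delta>\<close>, adding the generator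
  \<open>- r\<close> gives \<open>\<delta>\<close> plus the line through \<open>r\<close>. The link
  of \<open>r\<close> is thus modelled inside the same space instead of a quotient, and the
  induction hypothesis applies to it directly.\<close>

definition star :: "'a \<Rightarrow> 'a set set \<Rightarrow> 'a set set" where
  "star r \<Delta> = (\<lambda>\<delta>. join \<delta> {- r}) ` {\<delta> \<in> \<Delta>. r \<in> \<delta>}"

text \<open>Divided by a large \<open>N\<close>, this says that the cones through \<open>r\<close>
  cover \<open>r + z / N\<close> for every direction \<open>z\<close>: a neighbourhood of
  \<open>r\<close>, expressed without topology. The condition is monotone in the set of
  cones.\<close>

definition star_complete :: "'a \<Rightarrow> 'a set set \<Rightarrow> bool" where
  "star_complete r \<C> \<longleftrightarrow> (\<forall>z. \<exists>N\<ge>0. \<exists>\<kappa>\<in>\<C>. r \<in> \<kappa> \<and> z + N *\<^sub>R r \<in> \<kappa>)"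

lemma star_complete_mono: "star_complete r \<C> \<Longrightarrow> \<C> \<subseteq> \<D> \<Longrightarrow> star_complete r \<D>"
  unfolding star_complete_def by (meson subsetD)

lemma mem_join_minus: "x \<in> join \<delta> {- r} \<longleftrightarrow> (\<exists>N\<ge>0. x + N *\<^sub>R r \<in> \<delta>)"
proof
  assume "x \<in> join \<delta> {- r}"
  then obtain s t where "x = s + t *\<^sub>R (- r)" "s \<in> \<delta>" "0 \<le> t"
    by (auto simp: join_singleton)
  then show "\<exists>N\<ge>0. x + N *\<^sub>R r \<in> \<delta>" by (intro exI[of _ t]) simp
next
  assume "\<exists>N\<ge>0. x + N *\<^sub>R r \<in> \<delta>"
  then obtain N where "N \<ge> 0" "x + N *\<^sub>R r \<in> \<delta>" by blast
  moreover have "x = (x + N *\<^sub>R r) + N *\<^sub>R (- r)" by simp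
  ultimately show "x \<in> join \<delta> {- r}" unfolding join_singleton by blast
qed

lemma add_ray_mono:
  assumes "convex_cone \<delta>" "r \<in> \<delta>" "x + N *\<^sub>R r \<in> \<delta>" "N \<le> M"
  shows "x + M *\<^sub>R r \<in> \<delta>"
proof -
  have "(x + N *\<^sub>R r) + (M - N) *\<^sub>R r \<in> \<delta>"
    using convex_cone_add[OF assms(1,3) convex_cone_scaleR[OF assms(1) _ assms(2)]] assms(4)
    by simp
  then show ?thesis by (simp add: algebra_simps)
qed

lemma join_minus_Int:
  assumes "convex_cone \<delta>" "convex_cone \<delta>'" "r \<in> \<delta>" "r \<in> \<delta>'"
  shows "join \<delta> {- r} \<inter> join \<delta>' {- r} = join (\<delta> \<inter> \<delta>') {- r}"
proof
  show "join \<delta> {- r} \<inter> join \<delta>' {- r} \<subseteq> join (\<delta> \<inter> \<delta>') {- r}"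
  proof
    fix x assume "x \<in> join \<delta> {- r} \<inter> join \<delta>' {- r}"
    then obtain N N' where N: "N \<ge> 0" "x + N *\<^sub>R r \<in> \<delta>" "N' \<ge> 0" "x + N' *\<^sub>R r \<in> \<delta>'"
      unfolding Int_iff mem_join_minus by blast
    have "x + max N N' *\<^sub>R r \<in> \<delta> \<inter> \<delta>'"
      using add_ray_mono[OF assms(1,3) N(2)] add_ray_mono[OF assms(2,4) N(4)] by simp
    moreover have "0 \<le> max N N'" using N by simp
    ultimately show "x \<in> join (\<delta> \<inter> \<delta>') {- r}" unfolding mem_join_minus by blast
  qed
  show "join (\<delta> \<inter> \<delta>') {- r} \<subseteq> join \<delta> {- r} \<inter> join \<delta>' {- r}" by (simp add: join_mono)
qed

lemma join_minus_Int_kernel: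
  fixes u :: "'a \<Rightarrow> real"
  assumes "linear u" "u r = 0"
  shows "join \<delta> {- r} \<inter> {x. u x = 0} = join (\<delta> \<inter> {x. u x = 0}) {- r}"
  using assms by (auto simp: mem_join_minus linear_add linear_scale)

lemma join_minus_face:
  fixes \<phi> \<delta> :: "'a set"
  assumes "polycone_face \<phi> \<delta>" "r \<in> \<phi>"
  shows "polycone_face (join \<phi> {- r}) (join \<delta> {- r})"
proof -
  obtain u where u: "linear u" "\<And>x. x \<in> \<delta> \<Longrightarrow> 0 \<le> (u x :: real)" "\<phi> = \<delta> \<inter> {x. u x = 0}"
    using assms(1) unfolding polycone_face_def by blast
  have "u r = 0" using assms(2) u by simp
  have "0 \<le> u x" if x: "x \<in> join \<delta> {- r}" for x
  proof -
    obtain N where "x + N *\<^sub>R r \<in> \<delta>" using x unfolding mem_join_minus by blast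
    from u(2)[OF this] show ?thesis
      using \<open>u r = 0\<close> by (simp add: linear_add[OF u(1)] linear_scale[OF u(1)])
  qed
  then show ?thesis
    unfolding u(3) join_minus_Int_kernel[OF u(1) \<open>u r = 0\<close>, symmetric] polycone_face_def
    using u(1) by blast
qed

lemma semifan_star:
  assumes \<Delta>: "semifan W \<Delta>" and r: "r \<in> W"
  shows "semifan W (star r \<Delta>)"
  unfolding semifan_def
proof (intro conjI ballI allI impI)
  show "finite (star r \<Delta>)" using semifanD(1)[OF \<Delta>] by (simp add: star_def)
  show "polycone W \<kappa>" if \<kappa>: "\<kappa> \<in> star r \<Delta>" for \<kappa>
  proof -
    obtain \<delta> where "\<delta> \<in> \<Delta>" "\<kappa> = join \<delta> {- r}" using \<kappa> unfolding star_def by blast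
    then show ?thesis using polycone_add_ray[OF semifanD(2)[OF \<Delta>] W_uminus[OF r]] by simp
  qed
  show "F \<in> star r \<Delta>" if \<kappa>: "\<kappa> \<in> star r \<Delta>" and F: "polycone_face F \<kappa>" for \<kappa> F
  proof -
    obtain \<delta> where \<delta>: "\<delta> \<in> \<Delta>" "r \<in> \<delta>" "\<kappa> = join \<delta> {- r}" using \<kappa> unfolding star_def by blast
    obtain u where u: "linear u" "\<And>x. x \<in> \<kappa> \<Longrightarrow> 0 \<le> (u x :: real)" "F = \<kappa> \<inter> {x. u x = 0}"
      using F unfolding polycone_face_def by blast
    have "r \<in> \<kappa>" using \<delta> join_base by blast
    moreover have "- r \<in> \<kappa>"
      unfolding \<delta>(3) using join_incl[OF semifanD(3)[OF \<Delta> \<delta>(1)], of "{- r}"] by simp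
    \<comment> \<open>A form nonnegative on a star cone vanishes at \<open>r\<close>, since the cone
      contains both \<open>r\<close> and \<open>- r\<close>. So its faces come from faces of
      \<open>\<delta>\<close> through \<open>r\<close>.\<close>
    ultimately have ur: "u r = 0"
      using u(2)[of r] u(2)[of "- r"] by (simp add: linear_neg[OF u(1)])
    have "polycone_face (\<delta> \<inter> {x. u x = 0}) \<delta>"
      unfolding polycone_face_def using u(1,2) join_base \<delta>(3) by blast
    then have "\<delta> \<inter> {x. u x = 0} \<in> \<Delta>" using semifanD(4)[OF \<Delta> \<delta>(1)] by blast
    moreover have "F = join (\<delta> \<inter> {x. u x = 0}) {- r}"
      unfolding u(3) \<delta>(3) by (rule join_minus_Int_kernel[OF u(1) ur])
    moreover have "r \<in> \<delta> \<inter> {x. u x = 0}" using \<delta> ur by simp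
    ultimately show ?thesis unfolding star_def by blast
  qed
  show "polycone_face (\<kappa> \<inter> \<kappa>') \<kappa>" if \<kappa>: "\<kappa> \<in> star r \<Delta>" "\<kappa>' \<in> star r \<Delta>" for \<kappa> \<kappa>'
  proof -
    obtain \<delta> where \<delta>: "\<delta> \<in> \<Delta>" "r \<in> \<delta>" "\<kappa> = join \<delta> {- r}"
      using \<kappa>(1) unfolding star_def by blast
    obtain \<delta>' where \<delta>': "\<delta>' \<in> \<Delta>" "r \<in> \<delta>'" "\<kappa>' = join \<delta>' {- r}"
      using \<kappa>(2) unfolding star_def by blast
    have "\<kappa> \<inter> \<kappa>' = join (\<delta> \<inter> \<delta>') {- r}"
      unfolding \<delta>(3) \<delta>'(3)
      using semifanD(3)[OF \<Delta>] \<delta> \<delta>' by (intro join_minus_Int) auto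
    moreover have "polycone_face (join (\<delta> \<inter> \<delta>') {- r}) (join \<delta> {- r})"
      using \<delta>(2) \<delta>'(2) by (intro join_minus_face semifanD(5)[OF \<Delta> \<delta>(1) \<delta>'(1)]) simp
    ultimately show ?thesis unfolding \<delta>(3) by simp
  qed
qed

text \<open>For nonnegative \<open>t\<close> the error term is a nonnegative multiple of
  \<open>r\<close>, which any cone through \<open>r\<close> absorbs. Points over pushed generators
  can thereby be compared with points over the original ones.\<close>

lemma lincomb_translate:
  fixes r :: 'a
  assumes "finite B" "c \<in> nonneg_on ((\<lambda>b. b + t *\<^sub>R r) ` B)"
  shows "(\<lambda>b. c (b + t *\<^sub>R r)) \<in> nonneg_on B"
    "lincomb c = lincomb (\<lambda>b. c (b + t *\<^sub>R r)) + (t * (\<Sum>b\<in>B. c (b + t *\<^sub>R r))) *\<^sub>R r"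
proof -
  let ?g = "\<lambda>b. b + t *\<^sub>R r"
  have inj: "inj ?g" by (simp add: inj_def)
  show 1: "(\<lambda>b. c (?g b)) \<in> nonneg_on B"
    using nonneg_onD[OF assms(2)] inj_image_mem_iff[OF inj, of _ B] by (simp add: nonneg_on_def)
  have "lincomb c = (\<Sum>y\<in>?g ` B. c y *\<^sub>R y)"
    using assms by (intro lincomb_nonneg_on) auto
  also have "\<dots> = (\<Sum>b\<in>B. c (?g b) *\<^sub>R ?g b)"
    using inj by (subst sum.reindex) (auto intro: inj_on_subset)
  also have "\<dots> = (\<Sum>b\<in>B. c (?g b) *\<^sub>R b) + (t * (\<Sum>b\<in>B. c (?g b))) *\<^sub>R r"
    by (simp add: scaleR_right_distrib sum.distrib sum_distrib_left scaleR_sum_left mult.commute)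
  finally show "lincomb c = lincomb (\<lambda>b. c (?g b)) + (t * (\<Sum>b\<in>B. c (?g b))) *\<^sub>R r"
    using lincomb_nonneg_on[OF assms(1) 1] by simp
qed

text \<open>
  If \<open>r\<close> lies in one of two cones of a semifan but not in the other, a form separating them is
  positive at \<open>r\<close>, hence at \<open>b + t *\<^sub>R r\<close> for large \<open>t\<close>.
\<close>

lemma separating_translation:
  assumes \<Delta>: "semifan W \<Delta>" and X: "finite X"
  obtains n :: nat where
    "\<And>\<delta> \<delta>'. \<delta> \<in> \<Delta> \<Longrightarrow> \<delta>' \<in> \<Delta> \<Longrightarrow> r \<in> \<delta> \<Longrightarrow> r \<notin> \<delta>' \<Longrightarrow>
      \<exists>v :: 'a \<Rightarrow> real. linear v \<and> (\<forall>x\<in>\<delta>. 0 \<le> v x) \<and> (\<forall>x\<in>\<delta>'. v x \<le> 0) \<and>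
        (\<forall>b\<in>X. 0 < v (b + real n *\<^sub>R r))"
proof -
  define T where "T = {(\<delta>, \<delta>'). \<delta> \<in> \<Delta> \<and> \<delta>' \<in> \<Delta> \<and> r \<in> \<delta> \<and> r \<notin> \<delta>'}"
  have "finite T"
    using semifanD(1)[OF \<Delta>] by (intro finite_subset[of T "\<Delta> \<times> \<Delta>"]) (auto simp: T_def)
  define good where "good = (\<lambda>n p. \<exists>v :: 'a \<Rightarrow> real. linear v \<and> (\<forall>x\<in>fst p. 0 \<le> v x) \<and>
    (\<forall>x\<in>snd p. v x \<le> 0) \<and> (\<forall>b\<in>X. 0 < v (b + real n *\<^sub>R r)))"
  have "eventually (\<lambda>n. good n p) sequentially" if p: "p \<in> T" for p
  proof -
    obtain \<delta> \<delta>' where \<delta>: "p = (\<delta>, \<delta>')" "\<delta> \<in> \<Delta>" "\<delta>' \<in> \<Delta>" "r \<in> \<delta>" "r \<notin> \<delta>'"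
      using p by (auto simp: T_def)
    have "polycone_face (\<delta> \<inter> \<delta>') \<delta>'"
      using semifanD(5)[OF \<Delta> \<delta>(3,2)] by (simp add: Int_commute)
    then obtain v :: "'a \<Rightarrow> real" where v: "linear v" "\<And>x. x \<in> \<delta> \<Longrightarrow> 0 \<le> v x"
      "\<And>x. x \<in> \<delta> \<Longrightarrow> v x = 0 \<Longrightarrow> x \<in> \<delta>'" "\<And>x. x \<in> \<delta>' \<Longrightarrow> v x \<le> 0"
      using separating_form[OF semifanD(2)[OF \<Delta> \<delta>(2)] semifanD(2)[OF \<Delta> \<delta>(3)]
          semifanD(5)[OF \<Delta> \<delta>(2,3)]] by metis
    have vr: "0 < v r" using v(2)[OF \<delta>(4)] v(3)[OF \<delta>(4)] \<delta>(5) by fastforce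
    have "eventually (\<lambda>n. 0 < v (b + real n *\<^sub>R r)) sequentially" for b
    proof -
      obtain m :: nat where m: "- v b < real m * v r"
        using ex_less_of_nat_mult[OF vr] by blast
      have "0 < v (b + real n *\<^sub>R r)" if "m \<le> n" for n
      proof -
        have "real m * v r \<le> real n * v r" using vr that by simp
        then show ?thesis using m by (simp add: linear_add[OF v(1)] linear_scale[OF v(1)])
      qed
      then show ?thesis unfolding eventually_sequentially by blast
    qed
    then have "eventually (\<lambda>n. \<forall>b\<in>X. 0 < v (b + real n *\<^sub>R r)) sequentially"
      using X by (intro eventually_ball_finite) auto
    then show ?thesis
      by (rule eventually_mono) (use v in \<open>auto simp: good_def \<delta>(1)\<close>)
  qed
  then have "eventually (\<lambda>n. \<forall>p\<in>T. good n p) sequentially"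
    using \<open>finite T\<close> by (intro eventually_ball_finite) auto
  then obtain n where n: "\<And>p. p \<in> T \<Longrightarrow> good n p"
    unfolding eventually_sequentially by blast
  show ?thesis
  proof (rule that[of n])
    fix \<delta> \<delta>' assume "\<delta> \<in> \<Delta>" "\<delta>' \<in> \<Delta>" "r \<in> \<delta>" "r \<notin> \<delta>'"
    then have "(\<delta>, \<delta>') \<in> T" by (simp add: T_def)
    from n[OF this] show "\<exists>v :: 'a \<Rightarrow> real. linear v \<and> (\<forall>x\<in>\<delta>. 0 \<le> v x) \<and> (\<forall>x\<in>\<delta>'. v x \<le> 0) \<and>
        (\<forall>b\<in>X. 0 < v (b + real n *\<^sub>R r))"
      by (simp add: good_def)
  qed
qed

text \<open>
  A complete fan in the star of \<open>r\<close> is lifted by pushing its new generators far in the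
  direction of \<open>r\<close>.
\<close>

lemma lift_star:
  assumes \<Delta>: "semifan W \<Delta>" and r: "r \<in> W"
    and Q: "relative_fan (star r \<Delta>) Q" and complete: "\<Union>(cones Q) = UNIV"
  obtains P where "relative_fan \<Delta> P" "star_complete r (cones P)"
proof -
  define X where "X = \<Union>(snd ` Q)"
  have X: "B \<subseteq> X" if "(\<kappa>, B) \<in> Q" for \<kappa> B
    unfolding X_def using that by force
  have finX: "finite X" unfolding X_def using relative_fanD(1,3)[OF Q] by auto
  obtain n :: nat where n: "\<And>\<delta> \<delta>'. \<delta> \<in> \<Delta> \<Longrightarrow> \<delta>' \<in> \<Delta> \<Longrightarrow> r \<in> \<delta> \<Longrightarrow> r \<notin> \<delta>' \<Longrightarrow>
      \<exists>v :: 'a \<Rightarrow> real. linear v \<and> (\<forall>x\<in>\<delta>. 0 \<le> v x) \<and> (\<forall>x\<in>\<delta>'. v x \<le> 0) \<and>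
        (\<forall>b\<in>X. 0 < v (b + real n *\<^sub>R r))"
    using separating_translation[OF \<Delta> finX, of r] by blast
  define g where "g = (\<lambda>b. b + real n *\<^sub>R r)"
  have g_inv: "g (y - real n *\<^sub>R r) = y" for y by (simp add: g_def)
  \<comment> \<open>The base \<phi> may be a face of \<open>\<delta>\<close> that misses
    \<open>r\<close>, as closure under faces of the base demands; the cone \<open>\<delta>\<close>
    through \<open>r\<close> is kept as the link to \<open>Q\<close>.\<close>
  define new where "new = (\<lambda>\<phi> A. \<exists>\<delta> B. A = g ` B \<and> \<delta> \<in> \<Delta> \<and> r \<in> \<delta> \<and> polycone_face \<phi> \<delta> \<and>
      (join \<delta> {- r}, B) \<in> Q)"
  define P where "P = {(\<phi>, A). new \<phi> A \<or> \<phi> \<in> \<Delta> \<and> A = {}}"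
  have P_iff: "(\<phi>, A) \<in> P \<longleftrightarrow> new \<phi> A \<or> \<phi> \<in> \<Delta> \<and> A = {}" for \<phi> A by (simp add: P_def)
  have newE: "\<exists>\<delta> B. A = g ` B \<and> \<delta> \<in> \<Delta> \<and> r \<in> \<delta> \<and> polycone_face \<phi> \<delta> \<and> (join \<delta> {- r}, B) \<in> Q \<and>
      finite B \<and> B \<subseteq> W \<and> \<phi> \<in> \<Delta> \<and> \<phi> \<subseteq> \<delta>" if A: "new \<phi> A" for \<phi> A
  proof -
    obtain \<delta> B where B: "A = g ` B" "\<delta> \<in> \<Delta>" "r \<in> \<delta>" "polycone_face \<phi> \<delta>" "(join \<delta> {- r}, B) \<in> Q"
      using A unfolding new_def by blast
    moreover have "finite B" "B \<subseteq> W" using relative_fanD(3,4)[OF Q B(5)] by auto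
    moreover have "\<phi> \<in> \<Delta>" "\<phi> \<subseteq> \<delta>"
      using semifanD(4)[OF \<Delta> B(2,4)] face_extreme(1)[OF semifanD(3)[OF \<Delta> B(2)] B(4)] by auto
    ultimately show ?thesis by (intro exI[of _ \<delta>] exI[of _ B] conjI)
  qed
  \<comment> \<open>A point over pushed generators is also a point over \<open>Q\<close>: the shift
    by \<open>C\<close> times \<open>r\<close> is absorbed by \<open>\<delta>\<close>. Uniqueness in
    \<open>Q\<close> then compares coefficients, and equal coefficients give equal base points by
    cancellation.\<close>
  have tr: "\<exists>C. s + C *\<^sub>R r \<in> join \<delta> {- r} \<and> (\<lambda>b. c (g b)) \<in> nonneg_on B \<and>
      s + lincomb c = (s + C *\<^sub>R r) + lincomb (\<lambda>b. c (g b))"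
    if *: "s \<in> \<delta>" "r \<in> \<delta>" "\<delta> \<in> \<Delta>" "finite B" "c \<in> nonneg_on (g ` B)" for s \<delta> B c
  proof -
    define C where "C = real n * (\<Sum>b\<in>B. c (g b))"
    note lt = lincomb_translate[OF *(4) *(5)[unfolded g_def]]
    have "0 \<le> C" using nonneg_onD(1)[OF *(5)] by (simp add: C_def sum_nonneg)
    then have "s + C *\<^sub>R r \<in> \<delta>"
      using *(1,2) convex_cone_add convex_cone_scaleR semifanD(3)[OF \<Delta> *(3)] by blast
    then have "s + C *\<^sub>R r \<in> join \<delta> {- r}" using join_base by blast
    moreover have "s + lincomb c = (s + C *\<^sub>R r) + lincomb (\<lambda>b. c (g b))"
      using lt(2) by (simp add: C_def g_def)
    moreover have "(\<lambda>b. c (g b)) \<in> nonneg_on B" using lt(1) by (simp add: g_def)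
    ultimately show ?thesis by blast
  qed
  have g_cancel: "c = c'" if eq: "(\<lambda>b. c (g b)) = (\<lambda>b. c' (g b))" for c c' :: "'a \<Rightarrow> real"
  proof
    fix y show "c y = c' y" using fun_cong[OF eq, of "y - real n *\<^sub>R r"] by (simp add: g_inv)
  qed
  \<comment> \<open>A point of an old cone \<open>\<delta>'\<close> uses no pushed generator. If
    \<open>r\<close> is in \<open>\<delta>'\<close>, then its star cone with no generators belongs
    to \<open>Q\<close>, and uniqueness there applies. Otherwise some form is at most 0 on
    \<open>\<delta>'\<close>, at least 0 on \<open>\<delta>\<close> and positive on the pushed
    generators, so their coefficients vanish.\<close>
  have new_old: "c = (\<lambda>_. 0)"
    if A: "new \<phi> A" and \<delta>': "\<delta>' \<in> \<Delta>" and s: "s \<in> \<phi>" "s' \<in> \<delta>'" "c \<in> nonneg_on A"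
    and eq: "s + lincomb c = s'" for \<phi> A \<delta>' s s' c
  proof -
    obtain \<delta> B where B: "A = g ` B" "\<delta> \<in> \<Delta>" "r \<in> \<delta>" "(join \<delta> {- r}, B) \<in> Q" "finite B" "\<phi> \<subseteq> \<delta>"
      using newE[OF A] by blast
    have s\<delta>: "s \<in> \<delta>" using s B by blast
    show ?thesis
    proof (cases "r \<in> \<delta>'")
      case True
      then have "join \<delta>' {- r} \<in> star r \<Delta>" using \<delta>' by (auto simp: star_def)
      then have Q': "(join \<delta>' {- r}, {}) \<in> Q" by (rule relative_fanD(6)[OF Q])
      obtain C where C: "s + C *\<^sub>R r \<in> join \<delta> {- r}" "(\<lambda>b. c (g b)) \<in> nonneg_on B"
        "s + lincomb c = (s + C *\<^sub>R r) + lincomb (\<lambda>b. c (g b))"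
        using tr[OF s\<delta> B(3,2,5)] s(3) B(1) by blast
      have "s' \<in> join \<delta>' {- r}" using s(2) join_base by blast
      then have "(\<lambda>b. c (g b)) = (\<lambda>_. 0)"
        using relative_fan_unique(2)[OF Q B(4) Q' C(1) _ C(2), of s' "\<lambda>_. 0"] C(3) eq by simp
      then show ?thesis using g_cancel[of c "\<lambda>_. 0"] by simp
    next
      case False
      have c0: "c y = 0" if y: "y \<notin> A" for y using nonneg_onD(2)[OF s(3) y] .
      have "c y = 0" if y: "y \<in> A" for y
      proof -
        obtain b where b: "b \<in> B" "y = g b" using y B(1) by blast
        have BX: "B \<subseteq> X" using X[OF B(4)] .
        obtain v :: "'a \<Rightarrow> real" where v: "linear v" "\<forall>x\<in>\<delta>. 0 \<le> v x" "\<forall>x\<in>\<delta>'. v x \<le> 0"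
          "\<forall>b\<in>X. 0 < v (b + real n *\<^sub>R r)"
          using n[OF B(2) \<delta>' B(3) False] by blast
        have pos: "0 < v a" if "a \<in> A" for a
          using that v(4) BX by (auto simp: B(1) g_def)
        have finA: "finite A" using B by simp
        have "v s + (\<Sum>a\<in>A. c a * v a) = v s'"
          using eq linear_lincomb[OF v(1) finA s(3)] linear_add[OF v(1), of s "lincomb c"] by simp
        moreover have nonneg: "0 \<le> c a * v a" if "a \<in> A" for a
          using pos[OF that] nonneg_onD(1)[OF s(3)] by simp
        moreover have "0 \<le> (\<Sum>a\<in>A. c a * v a)" using nonneg by (rule sum_nonneg)
        moreover have "0 \<le> v s" "v s' \<le> 0" using v s\<delta> s(2) by auto
        ultimately have "(\<Sum>a\<in>A. c a * v a) = 0" by linarith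
        then have "c y * v y = 0"
          using sum_nonneg_eq_0_iff[of A "\<lambda>a. c a * v a"] finA nonneg y by blast
        then show ?thesis using pos[OF y] by simp
      qed
      then show ?thesis using c0 by blast
    qed
  qed
  have "relative_fan \<Delta> P"
    unfolding relative_fan_def
  proof (intro conjI allI impI ballI)
    have "P \<subseteq> \<Delta> \<times> (insert {} ((\<lambda>(\<kappa>, B). g ` B) ` Q))"
    proof
      fix p assume "p \<in> P"
      then obtain \<phi> A where p: "p = (\<phi>, A)" "(\<phi>, A) \<in> P" by (cases p) auto
      then consider "new \<phi> A" | "\<phi> \<in> \<Delta>" "A = {}" unfolding P_iff by blast
      then show "p \<in> \<Delta> \<times> (insert {} ((\<lambda>(\<kappa>, B). g ` B) ` Q))"
      proof cases
        case 1
        then obtain \<delta> B where "A = g ` B" "(join \<delta> {- r}, B) \<in> Q" "\<phi> \<in> \<Delta>" using newE by blast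
        then show ?thesis unfolding p(1) by force
      qed (simp add: p)
    qed
    then show "finite P"
      using semifanD(1)[OF \<Delta>] relative_fanD(1)[OF Q] by (auto intro: finite_subset)
    \<comment> \<open>The factor is a natural number, hence in \<open>K\<close>, so translated
      generators stay in \<open>W\<close>.\<close>
    have gW: "g b \<in> W" if "b \<in> W" for b
      unfolding g_def using W_add[OF that W_scale[OF K_of_nat r]] .
    show "\<phi> \<in> \<Delta>" "finite A" "A \<subseteq> W" if A: "(\<phi>, A) \<in> P" for \<phi> A
      using A newE[of \<phi> A] gW unfolding P_iff by auto
    show "(\<psi>, A') \<in> P" if A: "(\<phi>, A) \<in> P" and F: "polycone_face \<psi> \<phi>" "A' \<subseteq> A" for \<phi> A \<psi> A'
    proof -
      consider "new \<phi> A" | "\<phi> \<in> \<Delta>" "A = {}" using A unfolding P_iff by blast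
      then show ?thesis
      proof cases
        case 1
        obtain \<delta> B where B: "A = g ` B" "\<delta> \<in> \<Delta>" "r \<in> \<delta>" "polycone_face \<phi> \<delta>" "(join \<delta> {- r}, B) \<in> Q"
          using newE[OF 1] by blast
        define B' where "B' = {b \<in> B. g b \<in> A'}"
        have "A' = g ` B'" using F(2) B(1) by (auto simp: B'_def)
        moreover have "polycone_face \<psi> \<delta>"
          using face_trans[OF semifanD(2)[OF \<Delta> B(2)] B(4) F(1)] .
        moreover have "(join \<delta> {- r}, B') \<in> Q"
          using relative_fanD(5)[OF Q B(5) face_refl] by (simp add: B'_def)
        ultimately show ?thesis using B unfolding P_iff new_def by blast
      next
        case 2
        then show ?thesis using F semifanD(4)[OF \<Delta>] unfolding P_iff by blast
      qed
    qed
    show "(\<delta>, {}) \<in> P" if "\<delta> \<in> \<Delta>" for \<delta> using that unfolding P_iff by blast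
    fix \<phi> A \<phi>' A' s s' c c'
    assume A: "(\<phi>, A) \<in> P" "(\<phi>', A') \<in> P" and s: "s \<in> \<phi>" "s' \<in> \<phi>'"
      and c: "c \<in> nonneg_on A" "c' \<in> nonneg_on A'"
      and eq: "s + lincomb c = s' + lincomb c'"
    have "c = c'"
    proof (cases "new \<phi> A")
      case True
      show ?thesis
      proof (cases "new \<phi>' A'")
        case True': True
        obtain \<delta> B where B: "A = g ` B" "\<delta> \<in> \<Delta>" "r \<in> \<delta>" "(join \<delta> {- r}, B) \<in> Q" "finite B" "\<phi> \<subseteq> \<delta>"
          using newE[OF True] by blast
        obtain \<delta>' B' where B': "A' = g ` B'" "\<delta>' \<in> \<Delta>" "r \<in> \<delta>'" "(join \<delta>' {- r}, B') \<in> Q"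
          "finite B'" "\<phi>' \<subseteq> \<delta>'" using newE[OF True'] by blast
        obtain C where C: "s + C *\<^sub>R r \<in> join \<delta> {- r}" "(\<lambda>b. c (g b)) \<in> nonneg_on B"
          "s + lincomb c = (s + C *\<^sub>R r) + lincomb (\<lambda>b. c (g b))"
          using tr[OF _ B(3,2,5)] s(1) c(1) B(1,6) by blast
        obtain C' where C': "s' + C' *\<^sub>R r \<in> join \<delta>' {- r}" "(\<lambda>b. c' (g b)) \<in> nonneg_on B'"
          "s' + lincomb c' = (s' + C' *\<^sub>R r) + lincomb (\<lambda>b. c' (g b))"
          using tr[OF _ B'(3,2,5)] s(2) c(2) B'(1,6) by blast
        have "(\<lambda>b. c (g b)) = (\<lambda>b. c' (g b))"
          using relative_fan_unique(2)[OF Q B(4) B'(4) C(1) C'(1) C(2) C'(2)] eq C(3) C'(3) by simp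
        then show ?thesis by (rule g_cancel)
      next
        case False
        then have "\<phi>' \<in> \<Delta>" "A' = {}" using A(2) unfolding P_iff by auto
        moreover from this have "c' = (\<lambda>_. 0)" using c(2) by simp
        ultimately show ?thesis using new_old[OF True _ s c(1)] eq by simp
      qed
    next
      case False
      then have A0: "\<phi> \<in> \<Delta>" "A = {}" using A(1) unfolding P_iff by auto
      then have c0: "c = (\<lambda>_. 0)" using c(1) by simp
      show ?thesis
      proof (cases "new \<phi>' A'")
        case True
        then show ?thesis using new_old[OF True A0(1) s(2,1) c(2)] eq c0 by simp
      next
        case False
        then have "A' = {}" using A(2) unfolding P_iff by auto
        then show ?thesis using c(2) c0 by simp
      qed
    qed
    then show "c = c'" "s = s'" using eq by auto
  qed
  moreover have "star_complete r (cones P)"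
    unfolding star_complete_def
  proof
    fix z
    obtain \<kappa> where "\<kappa> \<in> cones Q" "z \<in> \<kappa>" using complete by blast
    then obtain \<kappa>0 B where B: "(\<kappa>0, B) \<in> Q" "z \<in> join \<kappa>0 B" by (auto elim: conesE)
    obtain \<delta> where \<delta>: "\<delta> \<in> \<Delta>" "r \<in> \<delta>" "\<kappa>0 = join \<delta> {- r}"
      using relative_fanD(2)[OF Q B(1)] unfolding star_def by blast
    have cc: "convex_cone \<delta>" using semifanD(3)[OF \<Delta> \<delta>(1)] .
    have fin: "finite B" using relative_fanD(3)[OF Q B(1)] .
    obtain d c0 where d: "d \<in> \<kappa>0" "c0 \<in> nonneg_on B" "z = d + lincomb c0" using B(2) by (rule joinE)
    obtain N where N: "N \<ge> 0" "d + N *\<^sub>R r \<in> \<delta>" using d(1) unfolding \<delta>(3) mem_join_minus by blast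
    \<comment> \<open>The coefficients \<open>c0\<close> transported to the pushed generators. The
      resulting combination exceeds \<open>lincomb c0\<close> by \<open>C\<close> times
      \<open>r\<close>, which is why the final witness is \<open>N + C\<close>.\<close>
    define c where "c = (\<lambda>y. c0 (y - real n *\<^sub>R r))"
    have cg: "c (g b) = c0 b" for b by (simp add: c_def g_def)
    have c: "c \<in> nonneg_on (g ` B)"
    proof -
      have "c y = 0" if y: "y \<notin> g ` B" for y
      proof -
        have "y - real n *\<^sub>R r \<notin> B" using y g_inv[of y] by (metis image_eqI)
        then show ?thesis using nonneg_onD(2)[OF d(2)] by (simp add: c_def)
      qed
      then show ?thesis using nonneg_onD(1)[OF d(2)] by (simp add: nonneg_on_def c_def)
    qed
    define C where "C = real n * (\<Sum>b\<in>B. c (g b))"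
    have C0: "0 \<le> C" using nonneg_onD(1)[OF c] by (simp add: C_def sum_nonneg)
    have "lincomb c = lincomb c0 + C *\<^sub>R r"
      using lincomb_translate(2)[OF fin c[unfolded g_def]] cg by (simp add: C_def g_def)
    then have "z + (N + C) *\<^sub>R r = (d + N *\<^sub>R r) + lincomb c"
      using d(3) by (simp add: algebra_simps)
    then have "z + (N + C) *\<^sub>R r \<in> join \<delta> (g ` B)" using joinI[OF N(2) c] by simp
    moreover have "(\<delta>, g ` B) \<in> P"
      unfolding P_iff new_def using \<delta> B(1) face_refl by blast
    moreover have "r \<in> join \<delta> (g ` B)" using \<delta>(2) join_base by blast
    ultimately show "\<exists>N\<ge>0. \<exists>\<kappa>\<in>cones P. r \<in> \<kappa> \<and> z + N *\<^sub>R r \<in> \<kappa>"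
      using N(1) C0 conesI[of \<delta> "g ` B" P] by (intro exI[of _ "N + C"]) auto
  qed
  ultimately show ?thesis using that by blast
qed

subsection \<open>Simplicial covers\<close>

text \<open>A complete simplicial fan in the quotient by \<open>L\<close>, recorded as an abstract
  simplicial complex. Its vertices are vectors of \<open>W\<close> instead of classes modulo
  \<open>L\<close>, so that they can serve as new generators.\<close>

definition simplicial_cover :: "'a set \<Rightarrow> 'a set set \<Rightarrow> bool" where
  "simplicial_cover L T \<longleftrightarrow>
     finite T \<and> (\<forall>A. A \<in> T \<longrightarrow> finite A \<and> A \<subseteq> W) \<and> (\<forall>A A'. A \<in> T \<longrightarrow> A' \<subseteq> A \<longrightarrow> A' \<in> T) \<and>
     (\<forall>A A' l l' c c'. A \<in> T \<longrightarrow> A' \<in> T \<longrightarrow> l \<in> L \<longrightarrow> l' \<in> L \<longrightarrow> c \<in> nonneg_on A \<longrightarrow> c' \<in> nonneg_on A' \<longrightarrow>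
        l + lincomb c = l' + lincomb c' \<longrightarrow> l = l' \<and> c = c') \<and>
     (\<forall>x. \<exists>A l c. A \<in> T \<and> l \<in> L \<and> c \<in> nonneg_on A \<and> x = l + lincomb c)"

lemma simplicial_coverD:
  assumes "simplicial_cover L T"
  shows "finite T" "A \<in> T \<Longrightarrow> finite A" "A \<in> T \<Longrightarrow> A \<subseteq> W" "A \<in> T \<Longrightarrow> A' \<subseteq> A \<Longrightarrow> A' \<in> T"
    "\<exists>A l c. A \<in> T \<and> l \<in> L \<and> c \<in> nonneg_on A \<and> x = l + lincomb c"
proof -
  note 1 = assms[unfolded simplicial_cover_def, THEN conjunct1]
  note 2 = assms[unfolded simplicial_cover_def, THEN conjunct2, THEN conjunct1, rule_format]
  note 3 = assms[unfolded simplicial_cover_def, THEN conjunct2, THEN conjunct2, THEN conjunct1,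
      rule_format]
  note 4 = assms[unfolded simplicial_cover_def, THEN conjunct2, THEN conjunct2, THEN conjunct2,
      THEN conjunct2, rule_format]
  show "finite T" by (rule 1)
  show "finite A" "A \<subseteq> W" if "A \<in> T" using 2[OF that] by auto
  show "A' \<in> T" if "A \<in> T" "A' \<subseteq> A" by (rule 3[OF that])
  show "\<exists>A l c. A \<in> T \<and> l \<in> L \<and> c \<in> nonneg_on A \<and> x = l + lincomb c" by (rule 4)
qed

lemma simplicial_cover_unique:
  assumes "simplicial_cover L T" "A \<in> T" "A' \<in> T" "l \<in> L" "l' \<in> L" "c \<in> nonneg_on A" "c' \<in> nonneg_on A'"
    "l + lincomb c = l' + lincomb c'"
  shows "l = l'" "c = c'"
proof -
  have "l = l' \<and> c = c'"
    using assms(1)[unfolded simplicial_cover_def, THEN conjunct2, THEN conjunct2, THEN conjunct2,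
        THEN conjunct1, rule_format, OF assms(2-8)] .
  then show "l = l'" "c = c'" by auto
qed

text \<open>
  The fan spanned by a basis of a complement of \<open>L\<close> together with the negative of its sum.
\<close>

lemma simplicial_cover_exists:
  assumes L: "subspace L"
  shows "\<exists>T. simplicial_cover L T"
proof -
  obtain BL where BL: "BL \<subseteq> L" "independent BL" "L \<subseteq> span BL"
    using maximal_independent_subset by blast
  obtain B where B: "BL \<subseteq> B" "B \<subseteq> BL \<union> W" "independent B" "BL \<union> W \<subseteq> span B"
    using maximal_independent_subset_extend[of BL "BL \<union> W"] BL(2) by blast
  have spB: "span B = UNIV"
  proof -
    have "span W \<subseteq> span B" using B(4) by (intro span_minimal) auto
    then show ?thesis using span_W by auto
  qed
  have finB: "finite B" using finite_independent[OF B(3)] .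
  define E where "E = B - BL"
  have E: "E \<subseteq> W" "finite E" using B(2) finB by (auto simp: E_def)
  define g where "g = (\<lambda>e x. representation B x e)"
  have lin: "linear (g e)" for e
    unfolding g_def using B(3) spB by (simp add: linear_iff representation_add representation_scale)
  have gB: "g e b = (if b = e then 1 else 0)" if "b \<in> B" for e b
    using representation_basis[OF B(3) that] by (auto simp: g_def)
  have gL: "g e l = 0" if "e \<in> E" "l \<in> L" for e l
  proof (rule linear_eq_0_on_span[OF lin, of BL])
    show "l \<in> span BL" using that BL by blast
    show "g e b = 0" if "b \<in> BL" for b
      using gB[of b e] that B(1) \<open>e \<in> E\<close> by (auto simp: E_def)
  qed
  define w where "w = - (\<Sum>e\<in>E. e)"
  have gw: "g e w = - 1" if "e \<in> E" for e
  proof -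
    have "(\<Sum>b\<in>E. g e b) = (\<Sum>b\<in>E. if b = e then 1 else 0)"
      by (rule sum.cong) (auto simp: gB E_def)
    also have "\<dots> = 1" using that E by simp
    finally show ?thesis by (simp add: w_def linear_neg[OF lin] linear_sum[OF lin])
  qed
  have wE: "w \<notin> E"
  proof
    assume "w \<in> E"
    then have "g w w = 1" using gB[of w w] by (simp add: E_def)
    then show False using gw[OF \<open>w \<in> E\<close>] by simp
  qed
  have lcw: "lincomb c = (\<Sum>e\<in>E. c e *\<^sub>R e) + c w *\<^sub>R w" if "c \<in> nonneg_on (insert w E)" for c
    using lincomb_nonneg_on[OF _ that] E(2) wE by simp
  have glc: "g e (lincomb c) = c e - c w" if "e \<in> E" "c \<in> nonneg_on (insert w E)" for e c
  proof -
    have "(\<Sum>b\<in>E. c b * g e b) = (\<Sum>b\<in>E. if b = e then c b else 0)"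
      by (rule sum.cong) (auto simp: gB E_def)
    also have "\<dots> = c e" using that E by simp
    finally show ?thesis
      using gw[OF that(1)]
      by (simp add: lcw[OF that(2)] linear_add[OF lin] linear_sum[OF lin] linear_scale[OF lin])
  qed
  \<comment> \<open>Up to scaling, the only relation modulo \<open>L\<close> among the vectors of
    \<open>insert w E\<close> is that their sum is 0, so each proper subset is independent modulo
    \<open>L\<close>.\<close>
  define T where "T = {A. A \<subset> insert w E}"
  have "simplicial_cover L T"
    unfolding simplicial_cover_def
  proof (intro conjI allI impI)
    have "T \<subseteq> Pow (insert w E)" by (auto simp: T_def)
    then show "finite T" by (rule finite_subset) (simp add: E)
    have wW: "w \<in> W" unfolding w_def using E(1) by (intro W_uminus W_sum) blast
    show "finite A" "A \<subseteq> W" if "A \<in> T" for A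
    proof -
      have A: "A \<subseteq> insert w E" using that by (auto simp: T_def)
      show "finite A" by (rule finite_subset[OF A]) (simp add: E)
      show "A \<subseteq> W" using A wW E(1) by blast
    qed
    show "A' \<in> T" if "A \<in> T" "A' \<subseteq> A" for A A' using that unfolding T_def by auto
  next
    fix A A' l l' c c'
    assume A: "A \<in> T" "A' \<in> T" and l: "l \<in> L" "l' \<in> L" and c: "c \<in> nonneg_on A" "c' \<in> nonneg_on A'"
      and eq: "l + lincomb c = l' + lincomb c'"
    have cE: "c \<in> nonneg_on (insert w E)" "c' \<in> nonneg_on (insert w E)"
      using A c nonneg_on_mono[of A "insert w E"] nonneg_on_mono[of A' "insert w E"]
        by (auto simp: T_def)
    \<comment> \<open>Two expressions of a point differ by a multiple of the relation, a constant. A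
      vertex missing from \<open>A\<close> shows that the constant is at most 0, a vertex missing
      from \<open>A'\<close> that it is at least 0.\<close>
    have diff: "c x - c' x = c w - c' w" if "x \<in> insert w E" for x
    proof (cases "x = w")
      case False
      then have x: "x \<in> E" using that by simp
      have "g x (l + lincomb c) = g x (l' + lincomb c')" using eq by simp
      then show ?thesis
        using gL[OF x] l glc[OF x] cE by (simp add: linear_add[OF lin])
    qed simp
    obtain x where x: "x \<in> insert w E" "x \<notin> A" using A(1) unfolding T_def by blast
    obtain y where y: "y \<in> insert w E" "y \<notin> A'" using A(2) unfolding T_def by blast
    have "c w - c' w \<le> 0"
      using diff[OF x(1)] nonneg_onD(2)[OF c(1) x(2)] nonneg_onD(1)[OF c(2), of x] by simp
    moreover have "0 \<le> c w - c' w"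
      using diff[OF y(1)] nonneg_onD(2)[OF c(2) y(2)] nonneg_onD(1)[OF c(1), of y] by simp
    ultimately have 0: "c w - c' w = 0" by simp
    have "c x = c' x" for x
    proof (cases "x \<in> insert w E")
      case True
      then show ?thesis using diff[OF True] 0 by simp
    next
      case False
      then show ?thesis using nonneg_onD(2)[OF cE(1) False] nonneg_onD(2)[OF cE(2) False] by simp
    qed
    then show "c = c'" by (rule ext)
    then show "l = l'" using eq by simp
  next
    fix x
    define a where "a = representation B x"
    \<comment> \<open>Adding \<open>- m\<close> times the relation makes all coefficients
      nonnegative, and the minimum makes at least one of them 0, so the support is a proper
      subset.\<close>
    define m where "m = Min (insert 0 (a ` E))"
    have m: "m \<le> 0" "\<And>e. e \<in> E \<Longrightarrow> m \<le> a e" "m \<in> insert 0 (a ` E)"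
      unfolding m_def using E(2) Min_in[of "insert 0 (a ` E)"] by (auto intro!: Min_le)
    define c where "c = (\<lambda>b. if b = w then - m else if b \<in> E then a b - m else 0)"
    define A where "A = {b \<in> insert w E. c b \<noteq> 0}"
    define l where "l = (\<Sum>b\<in>BL. a b *\<^sub>R b)"
    have l: "l \<in> L"
      unfolding l_def using BL(1) by (intro subspace_sum[OF L] subspace_scale[OF L]) auto
    have c: "c \<in> nonneg_on A" "c \<in> nonneg_on (insert w E)"
      using m by (auto simp: nonneg_on_def c_def A_def)
    have "A \<noteq> insert w E"
    proof -
      consider "m = 0" | e where "e \<in> E" "m = a e" using m(3) by blast
      then show ?thesis
      proof cases
        case 1
        then have "w \<notin> A" by (simp add: A_def c_def)
        then show ?thesis by blast
      next
        case 2
        then have "e \<notin> A" using wE by (auto simp: A_def c_def)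
        then show ?thesis using 2 by blast
      qed
    qed
    then have AT: "A \<in> T" by (auto simp: T_def A_def)
    have "x = (\<Sum>b\<in>B. a b *\<^sub>R b)"
      using real_vector.sum_representation_eq[OF B(3), of x B] spB finB by (simp add: a_def)
    also have "\<dots> = (\<Sum>b\<in>E. a b *\<^sub>R b) + l"
      unfolding E_def l_def using finB B(1) by (rule sum.subset_diff[rotated])
    finally have x: "x = (\<Sum>b\<in>E. a b *\<^sub>R b) + l" .
    have "(\<Sum>e\<in>E. c e *\<^sub>R e) = (\<Sum>e\<in>E. (a e - m) *\<^sub>R e)"
      using wE by (intro sum.cong) (auto simp: c_def)
    then have "lincomb c = (\<Sum>b\<in>E. a b *\<^sub>R b)"
      by (simp add: lcw[OF c(2)] scaleR_left_diff_distrib sum_subtractf scaleR_sum_right[symmetric])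
        (simp add: c_def w_def)
    then have "x = l + lincomb c" using x by simp
    then show "\<exists>A l c. A \<in> T \<and> l \<in> L \<and> c \<in> nonneg_on A \<and> x = l + lincomb c" using AT l c(1) by blast
  qed
  then show ?thesis by blast
qed

section \<open>Subdivision of simplicial covers along hyperplanes\<close>

definition refines :: "'a set set \<Rightarrow> 'a set set \<Rightarrow> bool" where
  "refines T' T \<longleftrightarrow> (\<forall>A'\<in>T'. \<exists>A\<in>T. A' \<subseteq> cone_hull A)"

definition crossings :: "('a \<Rightarrow> real) \<Rightarrow> 'a set set \<Rightarrow> ('a \<times> 'a) set" where
  "crossings u T = {(x, y). {x, y} \<in> T \<and> 0 < u x \<and> u y < 0}"

definition one_sided :: "('a \<Rightarrow> real) \<Rightarrow> 'a set set \<Rightarrow> bool" where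
  "one_sided u T \<longleftrightarrow> (\<forall>A\<in>T. (\<forall>a\<in>A. 0 \<le> u a) \<or> (\<forall>a\<in>A. u a \<le> 0))"

lemma refines_trans:
  assumes "refines T'' T'" "refines T' T" "simplicial_cover L T"
  shows "refines T'' T"
  unfolding refines_def
proof
  fix A'' assume "A'' \<in> T''"
  then obtain A' where A': "A' \<in> T'" "A'' \<subseteq> cone_hull A'" using assms(1) unfolding refines_def by blast
  then obtain A where A: "A \<in> T" "A' \<subseteq> cone_hull A" using assms(2) unfolding refines_def by blast
  have cc: "convex_cone (cone_hull A)"
    using convex_cone_cone_hull simplicial_coverD(2)[OF assms(3) A(1)] by blast
  show "\<exists>A\<in>T. A'' \<subseteq> cone_hull A"
  proof (cases "finite A'")
    case True
    then show ?thesis using cone_hull_least[OF cc A(2)] A'(2) A(1) by blast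
  next
    case False
    \<comment> \<open>An infinite \<open>A'\<close> is treated through the support of
      \<open>c\<close>: if that is infinite too, the sum is 0, which lies in the cone.\<close>
    have "cone_hull A' \<subseteq> cone_hull A"
    proof
      fix x assume "x \<in> cone_hull A'"
      then obtain c where c: "c \<in> nonneg_on A'" "x = lincomb c" by (auto simp: cone_hull_def)
      have "lincomb c \<in> cone_hull A"
        unfolding lincomb_def
      proof (rule convex_cone_sum[OF cc])
        fix b assume "b \<in> {b. c b \<noteq> 0}"
        then have "b \<in> A'" using nonneg_onD(2)[OF c(1)] by blast
        then show "c b *\<^sub>R b \<in> cone_hull A"
          using A(2) nonneg_onD(1)[OF c(1)] by (intro convex_cone_scaleR[OF cc]) auto
      qed
      then show "x \<in> cone_hull A" using c by simp
    qed
    then show ?thesis using A A' by blast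
  qed
qed

text \<open>Nonnegative combinations of vectors on one side stay there. Hence forms can be handled
  one after another, since later subdivisions do not spoil earlier ones.\<close>

lemma one_sided_refines:
  assumes "linear u" "one_sided u T" "refines T' T" "simplicial_cover L T"
  shows "one_sided u T'"
  unfolding one_sided_def
proof
  fix A' assume "A' \<in> T'"
  then obtain A where A: "A \<in> T" "A' \<subseteq> cone_hull A" using assms(3) unfolding refines_def by blast
  have fin: "finite A" using simplicial_coverD(2)[OF assms(4) A(1)] .
  have ulc: "u x = (\<Sum>a\<in>A. c a * u a)" if "c \<in> nonneg_on A" "x = lincomb c" for x c
    using linear_lincomb[OF assms(1) fin that(1)] that(2) by simp
  have "(\<forall>a\<in>A. 0 \<le> u a) \<or> (\<forall>a\<in>A. u a \<le> 0)" using assms(2) A(1) unfolding one_sided_def by blast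
  then show "(\<forall>a\<in>A'. 0 \<le> u a) \<or> (\<forall>a\<in>A'. u a \<le> 0)"
  proof
    assume s: "\<forall>a\<in>A. 0 \<le> u a"
    have "0 \<le> u x" if x: "x \<in> A'" for x
    proof -
      obtain c where "c \<in> nonneg_on A" "x = lincomb c" using x A(2) by (auto simp: cone_hull_def)
      then show ?thesis using ulc s nonneg_onD(1)
        by (metis (no_types, lifting) mult_nonneg_nonneg sum_nonneg)
    qed
    then show ?thesis by blast
  next
    assume s: "\<forall>a\<in>A. u a \<le> 0"
    have "u x \<le> 0" if x: "x \<in> A'" for x
    proof -
      obtain c where c: "c \<in> nonneg_on A" "x = lincomb c" using x A(2) by (auto simp: cone_hull_def)
      have "(\<Sum>a\<in>A. c a * u a) \<le> 0"
        using s nonneg_onD(1)[OF c(1)] by (intro sum_nonpos mult_nonneg_nonpos) auto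
      then show ?thesis using ulc[OF c] by simp
    qed
    then show ?thesis by blast
  qed
qed

text \<open>Stellar subdivision of the edge \<open>{a, b}\<close> at its point on the hyperplane \<open>u = 0\<close>.\<close>

lemma stellar_subdivision:
  assumes L: "subspace L" and T: "simplicial_cover L T" and u: "u \<in> rational_forms"
    and ab: "(a, b) \<in> crossings u T"
  shows "\<exists>T'. simplicial_cover L T' \<and> refines T' T \<and> crossings u T' \<subset> crossings u T"
proof -
  have abT: "{a, b} \<in> T" "0 < u a" "u b < 0" using ab by (auto simp: crossings_def)
  have neq: "a \<noteq> b" using abT by auto
  have lin: "linear u" using rational_formD(1)[OF u] .
  have abW: "a \<in> W" "b \<in> W" using simplicial_coverD(3)[OF T abT(1)] by auto
  \<comment> \<open>Chosen so that \<open>u\<close> vanishes at \<open>p\<close>. They are positive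
    since \<open>u\<close> separates \<open>a\<close> from \<open>b\<close>, and lie in
    \<open>K\<close> since \<open>u\<close> is rational, so \<open>p\<close> is in
    \<open>W\<close>.\<close>
  define \<alpha> \<beta> where "\<alpha> = - u b" and "\<beta> = u a"
  have pos: "0 < \<alpha>" "0 < \<beta>" using abT by (auto simp: \<alpha>_def \<beta>_def)
  define p where "p = \<alpha> *\<^sub>R a + \<beta> *\<^sub>R b"
  have up: "u p = 0" by (simp add: p_def \<alpha>_def \<beta>_def linear_diff[OF lin] linear_scale[OF lin])
  have pW: "p \<in> W"
    unfolding p_def \<alpha>_def \<beta>_def
    using abW by (intro W_add W_scale K_uminus rational_formD(2)[OF u])
  have pab: "p \<noteq> a" "p \<noteq> b" using up abT by auto
  \<comment> \<open>Spreads the coefficient of \<open>p\<close> over \<open>a\<close> and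
    \<open>b\<close>. This turns coordinates over the subdivision into coordinates over
    \<open>T\<close> without changing the point.\<close>
  define push where "push = (\<lambda>d x. if x = p then 0 else
      d x + d p * (if x = a then \<alpha> else if x = b then \<beta> else (0::real)))"
  have pushv: "push d p = 0" "push d a = d a + d p * \<alpha>" "push d b = d b + d p * \<beta>"
    "\<And>x. x \<noteq> p \<Longrightarrow> x \<noteq> a \<Longrightarrow> x \<noteq> b \<Longrightarrow> push d x = d x" for d
    using pab neq by (auto simp: push_def)
  have push_nonneg_on: "push d \<in> nonneg_on (insert a (insert b A) - {p})"
    if "d \<in> nonneg_on (insert p A)" for d A
  proof -
    have "0 \<le> push d x" for x using nonneg_onD(1)[OF that] pos by (simp add: push_def)
    moreover have "push d x = 0" if x: "x \<notin> insert a (insert b A) - {p}" for x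
      using x nonneg_onD(2)[OF \<open>d \<in> nonneg_on (insert p A)\<close>, of x] by (auto simp: push_def)
    ultimately show ?thesis by (simp add: nonneg_on_def)
  qed
  have lincomb_push: "lincomb (push d) = lincomb d"
    if d: "d \<in> nonneg_on (insert p A)" and fin: "finite A" for d A
  proof -
    define d0 where "d0 = (\<lambda>x. if x = p then 0 else d x)"
    have d0: "d0 \<in> nonneg_on A" using nonneg_onD[OF d] by (auto simp: nonneg_on_def d0_def)
    define sg where "sg = (\<lambda>(q :: 'a) v x. if x = q then v else (0::real))"
    have sg: "sg q v \<in> nonneg_on {q}" if "0 \<le> v" for q :: 'a and v
      using that by (simp add: sg_def nonneg_on_def)
    have lcsg: "lincomb (sg q v) = v *\<^sub>R q" for q :: 'a and v by (simp add: sg_def)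
    have dp: "0 \<le> d p" "0 \<le> d p * \<alpha>" "0 \<le> d p * \<beta>" using nonneg_onD(1)[OF d] pos by auto
    have 1: "d = (\<lambda>x. d0 x + sg p (d p) x)" by (auto simp: d0_def sg_def)
    have "lincomb (\<lambda>x. d0 x + sg p (d p) x) = lincomb d0 + d p *\<^sub>R p"
      using lincomb_add[OF fin _ d0 sg[OF dp(1)]] by (simp add: lcsg)
    then have 2: "lincomb d = lincomb d0 + d p *\<^sub>R p" using 1 by simp
    have e: "push d = (\<lambda>x. (d0 x + sg a (d p * \<alpha>) x) + sg b (d p * \<beta>) x)"
      using pab neq by (auto simp: push_def d0_def sg_def)
    have i: "(\<lambda>x. d0 x + sg a (d p * \<alpha>) x) \<in> nonneg_on (A \<union> {a})"
      using nonneg_on_add[OF d0 sg[OF dp(2)]] .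
    have "lincomb (push d) = lincomb (\<lambda>x. d0 x + sg a (d p * \<alpha>) x) + (d p * \<beta>) *\<^sub>R b"
      unfolding e using lincomb_add[OF _ _ i sg[OF dp(3)]] fin by (simp add: lcsg)
    also have "\<dots> = lincomb d0 + (d p * \<alpha>) *\<^sub>R a + (d p * \<beta>) *\<^sub>R b"
      using lincomb_add[OF fin _ d0 sg[OF dp(2)]] by (simp add: lcsg)
    finally show ?thesis using 2 by (simp add: p_def scaleR_right_distrib add.assoc)
  qed
  have L0: "0 \<in> L" using subspace_0[OF L] .
  \<comment> \<open>Otherwise \<open>p\<close> would have two expressions over \<open>T\<close>: as
    a vertex, and as a combination of \<open>a\<close> and \<open>b\<close>.\<close>
  have pT: "p \<notin> A" if A: "A \<in> T" for A
  proof
    assume "p \<in> A"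
    then have pp: "{p} \<in> T" using simplicial_coverD(4)[OF T A] by blast
    define d where "d = (\<lambda>x. if x = p then 1 else (0::real))"
    have d: "d \<in> nonneg_on {p}" by (simp add: d_def nonneg_on_def)
    have "lincomb d = p" by (simp add: d_def)
    moreover have "lincomb (push d) = lincomb d" using lincomb_push[of d "{}"] d by simp
    ultimately have "0 + lincomb (push d) = 0 + lincomb d" by simp
    moreover have "push d \<in> nonneg_on {a, b}"
      using push_nonneg_on[of d "{}"] d pab by (simp add: insert_Diff_if)
    ultimately have "push d = d"
      using simplicial_cover_unique(2)[OF T abT(1) pp L0 L0 _ d] by blast
    then have "push d a = d a" by simp
    then show False using pushv(2)[of d] pab pos by (simp add: d_def)
  qed
  \<comment> \<open>The simplices that survive. Those containing the edge are replaced by cones from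
    \<open>p\<close> over simplices that do not contain the edge but together with it span a simplex
    of \<open>T\<close>.\<close>
  define S where "S = {A \<in> T. \<not> {a, b} \<subseteq> A}"
  define T' where "T' = S \<union> insert p ` {A \<in> S. insert a (insert b A) \<in> T}"
  have T'E: "\<exists>A. A \<in> S \<and> A' - {p} = A \<and> A' \<subseteq> insert p A \<and> finite A \<and>
      (\<forall>d\<in>nonneg_on A'. d \<in> nonneg_on (insert p A) \<and> (\<exists>A''\<in>T. push d \<in> nonneg_on A''))" if A': "A' \<in> T'" for A'
  proof -
    consider "A' \<in> S" | A where "A \<in> S" "insert a (insert b A) \<in> T" "A' = insert p A"
      using A' unfolding T'_def by blast
    then show ?thesis
    proof cases
      case 1
      then have A'T: "A' \<in> T" by (simp add: S_def)
      have "push d = d" if d: "d \<in> nonneg_on A'" for d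
        using nonneg_onD(2)[OF d pT[OF A'T]] by (auto simp: push_def)
      moreover have "A' - {p} = A'" using pT[OF A'T] by simp
      moreover have "d \<in> nonneg_on (insert p A')" if "d \<in> nonneg_on A'" for d
        using that nonneg_on_mono[of A' "insert p A'"] by blast
      ultimately show ?thesis
        using 1 A'T simplicial_coverD(2)[OF T A'T] by (intro exI[of _ A']) auto
    next
      case (2 A)
      then have AT: "A \<in> T" by (simp add: S_def)
      have "push d \<in> nonneg_on (insert a (insert b A))" if d: "d \<in> nonneg_on (insert p A)" for d
        using push_nonneg_on[OF d] nonneg_on_mono[of "insert a (insert b A) - {p}" "insert a (insert b A)"]
          by blast
      moreover have "A' - {p} = A" using pT[OF AT] 2 by simp
      ultimately show ?thesis
        using 2 simplicial_coverD(2)[OF T AT] by (intro exI[of _ A]) auto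
    qed
  qed
  have zero: "d a = 0 \<or> d b = 0" if A': "A' \<in> T'" and d: "d \<in> nonneg_on A'" for A' d
  proof -
    obtain A where A: "A \<in> S" "A' \<subseteq> insert p A" using T'E[OF A'] by blast
    then have "a \<notin> A' \<or> b \<notin> A'" using pab by (auto simp: S_def)
    then show ?thesis using nonneg_onD(2)[OF d] by blast
  qed
  \<comment> \<open>The coefficient at \<open>p\<close> can be read off from \<open>push d\<close>:
    as \<open>d\<close> vanishes at \<open>a\<close> or at \<open>b\<close>, it is the largest
    multiple of \<open>p\<close> that can be split off. So equal pushes force equal coefficients at
    \<open>p\<close>, and then everywhere.\<close>
  have le: "e p \<le> d p" if A': "A' \<in> T'" "A'' \<in> T'" and d: "d \<in> nonneg_on A'" "e \<in> nonneg_on A''"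
    and eq: "push d = push e" for A' A'' d e
  proof (rule ccontr)
    assume "\<not> e p \<le> d p"
    then have lt: "d p < e p" by simp
    have "d a + d p * \<alpha> = e a + e p * \<alpha>" "d b + d p * \<beta> = e b + e p * \<beta>"
      using fun_cong[OF eq, of a] fun_cong[OF eq, of b] by (simp_all add: pushv)
    moreover have "d p * \<alpha> < e p * \<alpha>" "d p * \<beta> < e p * \<beta>" using lt pos by auto
    ultimately have "e a < d a" "e b < d b" by linarith+
    then show False using zero[OF A'(1) d(1)] nonneg_onD(1)[OF d(2), of a] nonneg_onD(1)[OF d(2), of b]
      by auto
  qed
  have "simplicial_cover L T'"
    unfolding simplicial_cover_def
  proof (intro conjI allI impI)
    have "T' \<subseteq> T \<union> insert p ` T" by (auto simp: T'_def S_def)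
    then show "finite T'" using simplicial_coverD(1)[OF T] by (auto intro: finite_subset)
    show "finite A'" "A' \<subseteq> W" if A': "A' \<in> T'" for A'
      using A' simplicial_coverD(2,3)[OF T] pW unfolding T'_def S_def by auto
    show "A'' \<in> T'" if A': "A' \<in> T'" and sub: "A'' \<subseteq> A'" for A' A''
    proof -
      have SD: "X \<in> S" if "X \<subseteq> Y" "Y \<in> S" for X Y
        using that simplicial_coverD(4)[OF T, of Y X] unfolding S_def by blast
      consider "A' \<in> S" | A where "A \<in> S" "insert a (insert b A) \<in> T" "A' = insert p A"
        using A' unfolding T'_def by blast
      then show ?thesis
      proof cases
        case 1
        then show ?thesis using SD[OF sub] unfolding T'_def by blast
      next
        case (2 A)
        have X: "A'' - {p} \<in> S" using SD[of "A'' - {p}" A] sub 2 by blast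
        show ?thesis
        proof (cases "p \<in> A''")
          case True
          have "insert a (insert b (A'' - {p})) \<in> T"
            using simplicial_coverD(4)[OF T 2(2), of "insert a (insert b (A'' - {p}))"] sub 2(3)
            by blast
          moreover have "A'' = insert p (A'' - {p})" using True by blast
          ultimately show ?thesis using X unfolding T'_def by blast
        next
          case False
          then show ?thesis using X unfolding T'_def by simp
        qed
      qed
    qed
  next
    fix A' A'' l l' d e
    assume A': "A' \<in> T'" "A'' \<in> T'" and l: "l \<in> L" "l' \<in> L" and d: "d \<in> nonneg_on A'" "e \<in> nonneg_on A''"
      and eq: "l + lincomb d = l' + lincomb e"
    obtain A1 D1 where 1: "d \<in> nonneg_on (insert p A1)" "finite A1" "D1 \<in> T" "push d \<in> nonneg_on D1"
      using T'E[OF A'(1)] d(1) by blast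
    obtain A2 D2 where 2: "e \<in> nonneg_on (insert p A2)" "finite A2" "D2 \<in> T" "push e \<in> nonneg_on D2"
      using T'E[OF A'(2)] d(2) by blast
    have eq': "l + lincomb (push d) = l' + lincomb (push e)"
      using eq lincomb_push[OF 1(1,2)] lincomb_push[OF 2(1,2)] by simp
    note un = simplicial_cover_unique[OF T 1(3) 2(3) l 1(4) 2(4) eq']
    show "l = l'" by (rule un(1))
    have "d p = e p"
      using le[OF A' d un(2)] le[OF A'(2,1) d(2,1) un(2)[symmetric]] by simp
    then have "d x = e x" for x
      using fun_cong[OF un(2), of x] by (cases "x = p") (auto simp: push_def)
    then show "d = e" by (rule ext)
  next
    fix x
    obtain A l c where A: "A \<in> T" "l \<in> L" "c \<in> nonneg_on A" "x = l + lincomb c"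
      using simplicial_coverD(5)[OF T] by blast
    have fin: "finite A" using simplicial_coverD(2)[OF T A(1)] .
    show "\<exists>A l c. A \<in> T' \<and> l \<in> L \<and> c \<in> nonneg_on A \<and> x = l + lincomb c"
    proof (cases "{a, b} \<subseteq> A")
      case False
      then show ?thesis using A unfolding T'_def S_def by blast
    next
      case True
      \<comment> \<open>The largest multiple of \<open>p\<close> that can be split off
        \<open>c\<close>. It exhausts \<open>a\<close> or \<open>b\<close>, and the exhausted vertex
        \<open>q\<close> is removed from \<open>A\<close>.\<close>
      define m where "m = min (c a / \<alpha>) (c b / \<beta>)"
      have m: "0 \<le> m" "m * \<alpha> \<le> c a" "m * \<beta> \<le> c b"
      proof -
        show "0 \<le> m" using nonneg_onD(1)[OF A(3)] pos by (simp add: m_def)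
        have "m \<le> c a / \<alpha>" "m \<le> c b / \<beta>" by (auto simp: m_def)
        then show "m * \<alpha> \<le> c a" "m * \<beta> \<le> c b" using pos by (auto simp: field_simps)
      qed
      define d where "d = (\<lambda>x. if x = p then m else
          c x - m * (if x = a then \<alpha> else if x = b then \<beta> else 0))"
      obtain q where q: "q = a \<or> q = b" "d q = 0"
      proof (cases "c a / \<alpha> \<le> c b / \<beta>")
        case True
        then have "m = c a / \<alpha>" by (simp add: m_def)
        then have "d a = 0" using pos pab by (simp add: d_def)
        then show ?thesis using that by blast
      next
        case False
        then have "m = c b / \<beta>" by (simp add: m_def)
        then have "d b = 0" using pos pab neq by (simp add: d_def)
        then show ?thesis using that by blast
      qed
      have d: "d \<in> nonneg_on (insert p (A - {q}))"
      proof -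
        have "0 \<le> d x" for x using m nonneg_onD(1)[OF A(3)] by (auto simp: d_def)
        moreover have "d x = 0" if x: "x \<notin> insert p (A - {q})" for x
        proof (cases "x = q")
          case False
          then have "x \<notin> A" "x \<noteq> p" using x by auto
          then show ?thesis using nonneg_onD(2)[OF A(3)] True by (auto simp: d_def)
        qed (simp add: q)
        ultimately show ?thesis by (simp add: nonneg_on_def)
      qed
      have "push d = c"
      proof
        fix x show "push d x = c x"
          using nonneg_onD(2)[OF A(3) pT[OF A(1)]] by (auto simp: push_def d_def)
      qed
      then have "lincomb d = lincomb c" using lincomb_push[OF d] fin by simp
      moreover have "insert p (A - {q}) \<in> T'"
      proof -
        have "A - {q} \<in> S"
          using simplicial_coverD(4)[OF T A(1), of "A - {q}"] q(1) unfolding S_def by blast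
        moreover have "insert a (insert b (A - {q})) = A" using True q(1) by blast
        ultimately show ?thesis using A(1) unfolding T'_def by auto
      qed
      ultimately show ?thesis using A(2,4) d by metis
    qed
  qed
  moreover have "refines T' T"
    unfolding refines_def
  proof
    fix A' assume "A' \<in> T'"
    then consider "A' \<in> T" | A where "A \<in> T" "insert a (insert b A) \<in> T" "A' = insert p A"
      unfolding T'_def S_def by blast
    then show "\<exists>A\<in>T. A' \<subseteq> cone_hull A"
    proof cases
      case 1
      then show ?thesis using cone_hull_incl by blast
    next
      case (2 A)
      let ?B = "insert a (insert b A)"
      have cc: "convex_cone (cone_hull ?B)"
        using convex_cone_cone_hull simplicial_coverD(2)[OF T 2(2)] by blast
      have incl: "?B \<subseteq> cone_hull ?B" by (rule cone_hull_incl)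
      have "p \<in> cone_hull ?B"
        unfolding p_def using incl pos
        by (intro convex_cone_add[OF cc] convex_cone_scaleR[OF cc]) auto
      then show ?thesis using incl 2 by blast
    qed
  qed
  moreover have "crossings u T' \<subset> crossings u T"
  proof -
    \<comment> \<open>As \<open>u\<close> vanishes at \<open>p\<close>, no edge at \<open>p\<close>
      is a crossing, so every remaining crossing is an old one, and the edge from \<open>a\<close>
      to \<open>b\<close> is gone.\<close>
    have *: "{x, y} \<in> S" if xy: "{x, y} \<in> T'" "0 < u x" "u y < 0" for x y
    proof -
      have "p \<notin> {x, y}" using up xy by auto
      then show ?thesis using xy(1) unfolding T'_def by blast
    qed
    then have "crossings u T' \<subseteq> crossings u T"
      unfolding crossings_def S_def by blast
    moreover have "(a, b) \<notin> crossings u T'"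
      using *[of a b] unfolding crossings_def S_def by blast
    ultimately show ?thesis using ab by blast
  qed
  ultimately show ?thesis by blast
qed

text \<open>Induction on the number of crossing edges. Edges suffice, since a simplex with vertices
  strictly on both sides contains a crossing edge.\<close>

lemma one_sided_subdivision:
  assumes L: "subspace L" and T: "simplicial_cover L T" and u: "u \<in> rational_forms"
  shows "\<exists>T'. simplicial_cover L T' \<and> refines T' T \<and> one_sided u T'"
  using T
proof (induction "card (crossings u T)" arbitrary: T rule: less_induct)
  case less
  show ?case
  proof (cases "crossings u T = {}")
    case True
    have "one_sided u T"
      unfolding one_sided_def
    proof (rule ballI, rule ccontr)
      fix A assume A: "A \<in> T" and "\<not> ((\<forall>a\<in>A. 0 \<le> u a) \<or> (\<forall>a\<in>A. u a \<le> 0))"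
      then obtain x y where xy: "x \<in> A" "y \<in> A" "0 < u x" "u y < 0" by (auto simp: not_le)
      then have "{x, y} \<in> T" using simplicial_coverD(4)[OF less.prems A, of "{x, y}"] by blast
      then show False using xy True by (auto simp: crossings_def)
    qed
    moreover have "refines T T" unfolding refines_def using cone_hull_incl by blast
    ultimately show ?thesis using less.prems by blast
  next
    case False
    then obtain a b where ab: "(a, b) \<in> crossings u T" by auto
    obtain T1 where T1: "simplicial_cover L T1" "refines T1 T" "crossings u T1 \<subset> crossings u T"
      using stellar_subdivision[OF L less.prems u ab] by blast
    have "crossings u T \<subseteq> \<Union>T \<times> \<Union>T" by (auto simp: crossings_def)
    moreover have "finite (\<Union>T)"
      using simplicial_coverD(1,2)[OF less.prems] by blast
    ultimately have "finite (crossings u T)" by (meson finite_SigmaI finite_subset)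
    then have "card (crossings u T1) < card (crossings u T)"
      using T1(3) by (rule psubset_card_mono)
    then obtain T' where "simplicial_cover L T'" "refines T' T1" "one_sided u T'"
      using less.hyps T1(1) by blast
    then show ?thesis using refines_trans[OF _ T1(2) less.prems] by blast
  qed
qed

lemma simplicial_cover_one_sided:
  assumes L: "subspace L" and U: "finite U" "U \<subseteq> rational_forms"
  shows "\<exists>T. simplicial_cover L T \<and> (\<forall>u\<in>U. one_sided u T)"
  using U
proof (induction U rule: finite_induct)
  case empty
  then show ?case using simplicial_cover_exists[OF L] by blast
next
  case (insert u U)
  then obtain T where T: "simplicial_cover L T" "\<forall>u\<in>U. one_sided u T" by auto
  obtain T' where T': "simplicial_cover L T'" "refines T' T" "one_sided u T'"
    using one_sided_subdivision[OF L T(1)] insert.prems by blast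
  have "one_sided v T'" if "v \<in> U" for v
    using one_sided_refines[OF _ _ T'(2) T(1)] T(2) that insert.prems rational_formD(1) by blast
  then show ?case using T' by blast
qed

text \<open>Each \<open>G\<close> becomes a union of simplices modulo \<open>L\<close>. A form
  defining \<open>G\<close> vanishes on the subspace \<open>L\<close> and has one sign on
  \<open>A\<close>; if it is at most 0 on \<open>A\<close> but nonnegative at a point with all
  coefficients positive, it vanishes on \<open>A\<close>.\<close>

lemma simplicial_cover_compatible:
  assumes L: "subspace L" and G: "finite \<G>" "\<And>G. G \<in> \<G> \<Longrightarrow> polycone W G" "\<And>G. G \<in> \<G> \<Longrightarrow> L \<subseteq> G"
  obtains T where "simplicial_cover L T"
    "\<And>G A c l. G \<in> \<G> \<Longrightarrow> A \<in> T \<Longrightarrow> c \<in> nonneg_on A \<Longrightarrow> (\<And>b. b \<in> A \<Longrightarrow> 0 < c b) \<Longrightarrow> l \<in> L \<Longrightarrow>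
      l + lincomb c \<in> G \<Longrightarrow> A \<subseteq> G"
proof -
  have ex: "\<forall>G\<in>\<G>. \<exists>U. finite U \<and> U \<subseteq> rational_forms \<and> G = {x. \<forall>u\<in>U. 0 \<le> u x}"
    using G(2) unfolding polycone_iff by blast
  obtain F where "\<forall>G\<in>\<G>. finite (F G) \<and> F G \<subseteq> rational_forms \<and> G = {x. \<forall>u\<in>F G. 0 \<le> u x}"
    using bchoice[OF ex] by (rule exE)
  note F = this[rule_format]
  obtain T where T: "simplicial_cover L T" "\<forall>u\<in>\<Union>(F ` \<G>). one_sided u T"
    using simplicial_cover_one_sided[OF L, of "\<Union>(F ` \<G>)"] F G(1) by blast
  show ?thesis
  proof (rule that[OF T(1)])
    fix G A c l
    assume A: "G \<in> \<G>" "A \<in> T" "c \<in> nonneg_on A" "\<And>b. b \<in> A \<Longrightarrow> 0 < c b" "l \<in> L" "l + lincomb c \<in> G"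
    have memG: "x \<in> G \<longleftrightarrow> (\<forall>u\<in>F G. 0 \<le> u x)" for x using F[OF A(1)] by blast
    have fin: "finite A" using simplicial_coverD(2)[OF T(1) A(2)] .
    have "0 \<le> u b" if u: "u \<in> F G" and b: "b \<in> A" for u b
    proof -
      have lin: "linear u" using F[OF A(1)] u rational_formD(1) by blast
      have "l \<in> G" "- l \<in> G" using A(5) G(3)[OF A(1)] subspace_neg[OF L] by blast+
      then have "0 \<le> u l" "0 \<le> u (- l)" using u unfolding memG by blast+
      then have "u l = 0" by (simp add: linear_neg[OF lin])
      moreover have "0 \<le> u (l + lincomb c)" using A(6) u unfolding memG by blast
      ultimately have ge: "0 \<le> (\<Sum>b\<in>A. c b * u b)"
        using linear_lincomb[OF lin fin A(3)] by (simp add: linear_add[OF lin])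
      have "one_sided u T" using T(2) A(1) u by blast
      then have "(\<forall>a\<in>A. 0 \<le> u a) \<or> (\<forall>a\<in>A. u a \<le> 0)" using A(2) unfolding one_sided_def by blast
      then show ?thesis
      proof
        assume neg: "\<forall>a\<in>A. u a \<le> 0"
        have nn': "0 \<le> - (c a * u a)" if "a \<in> A" for a
          using neg that A(4)[OF that] by (simp add: mult_nonneg_nonpos)
        have "(\<Sum>a\<in>A. - (c a * u a)) \<le> 0" using ge by (simp add: sum_negf)
        then have "(\<Sum>a\<in>A. - (c a * u a)) = 0"
          using sum_nonneg[of A "\<lambda>a. - (c a * u a)"] nn' by simp
        then have "- (c b * u b) = 0"
          using sum_nonneg_eq_0_iff[of A "\<lambda>a. - (c a * u a)"] fin nn' b by blast
        then show ?thesis using A(4)[OF b] by simp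
      qed (use b in blast)
    qed
    then show "A \<subseteq> G" unfolding subset_iff memG by blast
  qed
qed

subsection \<open>Filling the complement\<close>

text \<open>
  Once the relative fan is complete around the generators \<open>R\<close>, only simplices \<open>(L, B)\<close> over
  the lineality space \<open>L\<close> can meet the closure of the uncovered part. So these may be
  subdivided, and the uncovered part filled, without touching \<open>\<Sigma>\<close>.
\<close>

lemma fill_complement:
  assumes \<Sigma>: "semifan W \<Sigma>" and ne: "\<Sigma> \<noteq> {}" and P: "relative_fan \<Sigma> P"
    and R: "finite R" "R \<subseteq> W"
    and generators: "\<And>\<sigma> s. \<sigma> \<in> \<Sigma> \<Longrightarrow> s \<in> \<sigma> \<Longrightarrow> s \<notin> \<Inter>\<Sigma> \<Longrightarrow>
      \<exists>r\<in>R. r \<in> \<sigma> \<and> (\<exists>\<eta>>0. s - \<eta> *\<^sub>R r \<in> \<sigma>)"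
    and star: "\<And>r. r \<in> R \<Longrightarrow> star_complete r (cones P)"
  shows "\<exists>P'. relative_fan \<Sigma> P' \<and> \<Union>(cones P') = UNIV"
proof -
  define L where "L = \<Inter>\<Sigma>"
  define \<Delta> where "\<Delta> = cones P"
  have L: "subspace L" "L \<in> \<Sigma>" using semifan_lineality(1,2)[OF \<Sigma> ne] by (auto simp: L_def)
  have L\<sigma>: "L \<subseteq> \<sigma>" if "\<sigma> \<in> \<Sigma>" for \<sigma> using that by (auto simp: L_def)
  have L0: "0 \<in> L" using subspace_0[OF L(1)] .
  have \<Delta>: "semifan W \<Delta>" unfolding \<Delta>_def using semifan_cones[OF \<Sigma> P] .
  have L\<Delta>: "L \<subseteq> \<delta>" if \<delta>: "\<delta> \<in> \<Delta>" for \<delta>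
  proof -
    obtain \<sigma> B where "(\<sigma>, B) \<in> P" "\<delta> = join \<sigma> B" using \<delta> unfolding \<Delta>_def by (rule conesE)
    then show ?thesis using L\<sigma>[OF relative_fanD(2)[OF P]] join_base by blast
  qed
  have LB: "(L, B) \<in> P" if \<sigma>: "(\<sigma>, B) \<in> P" for \<sigma> B
  proof -
    have \<sigma>\<Sigma>: "\<sigma> \<in> \<Sigma>" using relative_fanD(2)[OF P \<sigma>] .
    have "\<sigma> \<inter> L = L" using L\<sigma>[OF \<sigma>\<Sigma>] by blast
    then have "polycone_face L \<sigma>" using semifanD(5)[OF \<Sigma> \<sigma>\<Sigma> L(2)] by simp
    then show ?thesis using relative_fanD(5)[OF P \<sigma>] by simp
  qed
  \<comment> \<open>Star cones are included because completeness at \<open>r\<close> controls a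
    point only after a multiple of \<open>r\<close> is added to it, which is membership in
    \<open>join \<delta> {- r}\<close>.\<close>
  define \<G> where "\<G> = \<Delta> \<union> (\<lambda>(\<delta>, r). join \<delta> {- r}) ` (\<Delta> \<times> R)"
  have G: "finite \<G>" using semifanD(1)[OF \<Delta>] R(1) by (simp add: \<G>_def)
  have G1: "polycone W G" "L \<subseteq> G" if G': "G \<in> \<G>" for G
  proof -
    consider "G \<in> \<Delta>" | \<delta> r where "\<delta> \<in> \<Delta>" "r \<in> R" "G = join \<delta> {- r}"
      using G' unfolding \<G>_def by blast
    then have "polycone W G \<and> L \<subseteq> G"
    proof cases
      case 1
      then show ?thesis using semifanD(2)[OF \<Delta>] L\<Delta> by blast
    next
      case 2
      have "- r \<in> W" using R(2) 2(2) W_uminus by blast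
      then show ?thesis
        using polycone_add_ray[OF semifanD(2)[OF \<Delta> 2(1)]] L\<Delta>[OF 2(1)] join_base[of \<delta> "{- r}"] 2(3)
        by blast
    qed
    then show "polycone W G" "L \<subseteq> G" by auto
  qed
  obtain T where T: "simplicial_cover L T"
    and compat: "\<And>G A c l. G \<in> \<G> \<Longrightarrow> A \<in> T \<Longrightarrow> c \<in> nonneg_on A \<Longrightarrow> (\<And>b. b \<in> A \<Longrightarrow> 0 < c b) \<Longrightarrow>
      l \<in> L \<Longrightarrow> l + lincomb c \<in> G \<Longrightarrow> A \<subseteq> G"
    using simplicial_cover_compatible[OF L(1) G G1] by blast
  have finT: "finite A" if "A \<in> T" for A using simplicial_coverD(2)[OF T that] .
  define ind where "ind = (\<lambda>(A :: 'a set) b. if b \<in> A then 1 else (0::real))"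
  have ind: "ind A \<in> nonneg_on A" for A by (simp add: ind_def nonneg_on_def)
  have lincomb_ind: "lincomb (ind A) = (\<Sum>b\<in>A. b)" if "finite A" for A
    using lincomb_nonneg_on[OF that ind] by (simp add: ind_def)
  have support: "\<exists>A l c. A \<in> T \<and> l \<in> L \<and> c \<in> nonneg_on A \<and> (\<forall>b\<in>A. 0 < c b) \<and> x = l + lincomb c" for x
  proof -
    obtain A l c where A: "A \<in> T" "l \<in> L" "c \<in> nonneg_on A" "x = l + lincomb c"
      using simplicial_coverD(5)[OF T] by blast
    define A' where "A' = {b \<in> A. c b \<noteq> 0}"
    have "A' \<in> T" using simplicial_coverD(4)[OF T A(1), of A'] by (auto simp: A'_def)
    moreover have "c \<in> nonneg_on A'" using nonneg_onD[OF A(3)] by (auto simp: nonneg_on_def A'_def)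
    moreover have "\<forall>b\<in>A'. 0 < c b" using nonneg_onD(1)[OF A(3)] by (auto simp: A'_def order_less_le)
    ultimately show ?thesis using A(2,4) by blast
  qed
  \<comment> \<open>The vertex sum represents the open simplex: by compatibility, a cone of
    \<open>\<Delta>\<close> that meets the open simplex contains all its vertices, hence their sum.
    Faces of such simplices are included for closure under subsets.\<close>
  define outer where "outer = (\<lambda>A. \<exists>A'\<in>T. A \<subseteq> A' \<and> (\<Sum>b\<in>A'. b) \<notin> \<Union>\<Delta>)"
  \<comment> \<open>Only the part of \<open>join \<sigma> B\<close> over \<open>L\<close> is
    subdivided; the base \<sigma> is kept whole.\<close>
  define inner where "inner = (\<lambda>\<sigma> A. \<exists>B. (\<sigma>, B) \<in> P \<and> A \<subseteq> join L B)"
  define P' where "P' = {(\<sigma>, A). A \<in> T \<and> (inner \<sigma> A \<or> \<sigma> = L \<and> outer A)}"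
  have P'_iff: "(\<sigma>, A) \<in> P' \<longleftrightarrow> A \<in> T \<and> (inner \<sigma> A \<or> \<sigma> = L \<and> outer A)" for \<sigma> A
    by (simp add: P'_def)
  have ccL: "convex_cone L" using semifanD(3)[OF \<Sigma> L(2)] .
  have innerE: "\<exists>B m d. (\<sigma>, B) \<in> P \<and> lincomb c \<in> join L B \<and> m \<in> L \<and> d \<in> nonneg_on B \<and> lincomb c = m + lincomb d"
    if A: "inner \<sigma> A" "A \<in> T" "c \<in> nonneg_on A" for \<sigma> A c
  proof -
    obtain B where B: "(\<sigma>, B) \<in> P" "A \<subseteq> join L B" using A(1) unfolding inner_def by blast
    have "cone_hull A \<subseteq> join L B"
      using cone_hull_least[OF convex_cone_join[OF ccL relative_fanD(3)[OF P B(1)]] B(2) finT[OF A(2)]] .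
    then have lcB: "lincomb c \<in> join L B" using cone_hullI[OF A(3)] by blast
    then obtain m d where "m \<in> L" "d \<in> nonneg_on B" "lincomb c = m + lincomb d" by (rule joinE)
    then show ?thesis using B(1) lcB by blast
  qed
  \<comment> \<open>The crux: a point \<open>x\<close> shared with an outer simplex has its base
    part in \<open>L\<close>. Otherwise \<open>x - \<eta> *\<^sub>R r\<close> still lies in the cone
    \<kappa> of \<open>x\<close> for some \<open>r\<close> in \<open>R\<close>, and completeness at
    \<open>r\<close> covers \<open>x + a *\<^sub>R y\<close> for some positive \<open>a\<close>,
    where \<open>y\<close> is the vertex sum of an uncovered simplex. That point is in the open
    simplex, so \<open>y\<close> would be covered as well.\<close>
  have inner_outer: "s \<in> L"
    if A: "inner \<sigma> A" "A \<in> T" "s \<in> \<sigma>" "c \<in> nonneg_on A"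
      and A': "outer A'" "A' \<in> T" "l \<in> L" "c' \<in> nonneg_on A'" and eq: "s + lincomb c = l + lincomb c'"
    for \<sigma> A s c A' l c'
  proof (rule ccontr)
    assume sL: "s \<notin> L"
    obtain B where B: "(\<sigma>, B) \<in> P" "lincomb c \<in> join L B" using innerE[OF A(1,2,4)] by blast
    have \<sigma>: "\<sigma> \<in> \<Sigma>" "convex_cone \<sigma>" using relative_fanD(2)[OF P B(1)] semifanD(3)[OF \<Sigma>] by auto
    obtain r \<eta> where r: "r \<in> R" "r \<in> \<sigma>" and \<eta>: "0 < \<eta>" "s - \<eta> *\<^sub>R r \<in> \<sigma>"
      using generators[OF \<sigma>(1) A(3)] sL unfolding L_def by blast
    obtain A'' where A'': "A'' \<in> T" "A' \<subseteq> A''" "(\<Sum>b\<in>A''. b) \<notin> \<Union>\<Delta>"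
      using A'(1) unfolding outer_def by blast
    define x y where "x = s + lincomb c" and "y = (\<Sum>b\<in>A''. b)"
    define \<kappa> where "\<kappa> = join \<sigma> B"
    have \<kappa>: "\<kappa> \<in> \<Delta>" unfolding \<kappa>_def \<Delta>_def using conesI[OF B(1)] .
    have cc\<kappa>: "convex_cone \<kappa>" using semifanD(3)[OF \<Delta> \<kappa>] .
    have "lincomb c \<in> \<kappa>" using B(2) join_mono[OF L\<sigma>[OF \<sigma>(1)], of B B] by (auto simp: \<kappa>_def)
    moreover have "s \<in> \<kappa>" "r \<in> \<kappa>" "s - \<eta> *\<^sub>R r \<in> \<kappa>"
      using A(3) r(2) \<eta>(2) join_base by (auto simp: \<kappa>_def)
    ultimately have x\<kappa>: "x \<in> \<kappa>" and r\<kappa>: "r \<in> \<kappa>" and "(s - \<eta> *\<^sub>R r) + lincomb c \<in> \<kappa>"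
      using convex_cone_add[OF cc\<kappa>] by (auto simp: x_def)
    then have x\<eta>\<kappa>: "x - \<eta> *\<^sub>R r \<in> \<kappa>" by (simp add: x_def algebra_simps)
    have c'': "c' \<in> nonneg_on A''" using A'(4) nonneg_on_mono[OF A''(2)] by blast
    have open_simplex: "A'' \<subseteq> G" if G: "G \<in> \<G>" and a: "0 < a" and mem: "x + a *\<^sub>R y \<in> G" for G a
    proof -
      define e where "e = (\<lambda>b. c' b + a * ind A'' b)"
      have ai: "(\<lambda>b. a * ind A'' b) \<in> nonneg_on A''" using nonneg_on_scale[OF ind] a by simp
      have e: "e \<in> nonneg_on A''" unfolding e_def using nonneg_on_add[OF c'' ai] by simp
      have "lincomb e = lincomb c' + a *\<^sub>R y"
        unfolding e_def y_def
        using lincomb_add[OF finT[OF A''(1)] finT[OF A''(1)] c'' ai] lincomb_scale[OF finT[OF A''(1)] ind]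
          lincomb_ind[OF finT[OF A''(1)]] by simp
      then have "l + lincomb e \<in> G" using mem eq by (simp add: x_def add.assoc)
      moreover have "0 < e b" if "b \<in> A''" for b
        using that a nonneg_onD(1)[OF c''] by (simp add: e_def ind_def add_nonneg_pos)
      ultimately show ?thesis using compat[OF G A''(1) e _ A'(3)] by blast
    qed
    have y_mem: "y \<in> G" if "G \<in> \<G>" "A'' \<subseteq> G" for G
      unfolding y_def using that polycone_convex_cone[OF G1(1)] by (intro convex_cone_sum) auto
    \<comment> \<open>This cone \<open>\<delta>\<close> will cover \<open>x + a *\<^sub>R y\<close>.
      Since \<open>x + y\<close> lies in its star cone, compatibility puts all of \<open>A''\<close>
      there, hence \<open>x\<close> and \<open>y\<close> separately.\<close>
    obtain N \<delta> where N: "0 \<le> N" "\<delta> \<in> \<Delta>" "r \<in> \<delta>" "(x + y) + N *\<^sub>R r \<in> \<delta>"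
      using star[OF r(1)] unfolding star_complete_def \<Delta>_def by blast
    have cc\<delta>: "convex_cone \<delta>" using semifanD(3)[OF \<Delta> N(2)] .
    have J: "join \<delta> {- r} \<in> \<G>" using N(2) r(1) by (auto simp: \<G>_def)
    have ccJ: "convex_cone (join \<delta> {- r})" using polycone_convex_cone[OF G1(1)[OF J]] .
    have "x + y \<in> join \<delta> {- r}" unfolding mem_join_minus using N(1,4) by blast
    then have sub: "A'' \<subseteq> join \<delta> {- r}" using open_simplex[OF J, of 1] by simp
    have "y \<in> join \<delta> {- r}" using y_mem[OF J sub] .
    then obtain M where M: "0 \<le> M" "y + M *\<^sub>R r \<in> \<delta>" unfolding mem_join_minus by blast
    have M1: "y + (M + 1) *\<^sub>R r \<in> \<delta>" using add_ray_mono[OF cc\<delta> N(3) M(2)] by simp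
    have "lincomb c' \<in> join \<delta> {- r}"
      using cone_hull_least[OF ccJ sub finT[OF A''(1)]] cone_hullI[OF c''] by blast
    moreover have "l \<in> join \<delta> {- r}" using G1(2)[OF J] A'(3) by blast
    ultimately have "x \<in> join \<delta> {- r}" using convex_cone_add[OF ccJ] eq by (simp add: x_def)
    then obtain M' where M': "0 \<le> M'" "x + M' *\<^sub>R r \<in> \<delta>" unfolding mem_join_minus by blast
    have Mr: "(M' + \<eta>) *\<^sub>R r \<in> \<kappa>" using convex_cone_scaleR[OF cc\<kappa> _ r\<kappa>] M'(1) \<eta>(1) by simp
    have xM': "(x - \<eta> *\<^sub>R r) + (M' + \<eta>) *\<^sub>R r = x + M' *\<^sub>R r" by (simp add: algebra_simps)
    have "x + M' *\<^sub>R r \<in> \<kappa>"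
      using convex_cone_add[OF cc\<kappa> x\<kappa> convex_cone_scaleR[OF cc\<kappa> M'(1) r\<kappa>]] .
    then have "(x - \<eta> *\<^sub>R r) + (M' + \<eta>) *\<^sub>R r \<in> \<kappa> \<inter> \<delta>" unfolding xM' using M'(2) by blast
    \<comment> \<open>The intersection of \<kappa> and \<open>\<delta>\<close> is extreme in
      \<kappa>, so the added multiple of \<open>r\<close> can be taken off again, even down to
      \<open>x - \<eta> *\<^sub>R r\<close>.\<close>
    then have "x - \<eta> *\<^sub>R r \<in> \<kappa> \<inter> \<delta>"
      using face_extreme(3)[OF cc\<kappa> semifanD(5)[OF \<Delta> \<kappa> N(2)] x\<eta>\<kappa> Mr] by blast
    then have x\<eta>: "x - \<eta> *\<^sub>R r \<in> \<delta>" by simp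
    \<comment> \<open>Makes the multiples of \<open>r\<close> cancel: what \<open>x\<close> gives up
      equals what \<open>y\<close> receives. Using \<open>M + 1\<close> keeps the denominator
      positive.\<close>
    define a where "a = \<eta> / (M + 1)"
    have a: "0 < a" "a * (M + 1) = \<eta>" using \<eta>(1) M(1) by (auto simp: a_def)
    have "(x - \<eta> *\<^sub>R r) + a *\<^sub>R (y + (M + 1) *\<^sub>R r) \<in> \<delta>"
      using convex_cone_add[OF cc\<delta> x\<eta> convex_cone_scaleR[OF cc\<delta> less_imp_le[OF a(1)] M1]] .
    moreover have "(x - \<eta> *\<^sub>R r) + a *\<^sub>R (y + (M + 1) *\<^sub>R r) = x + a *\<^sub>R y"
      using a(2) by (simp only: scaleR_right_distrib scaleR_scaleR) simp
    ultimately have "x + a *\<^sub>R y \<in> \<delta>" by simp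
    moreover have \<delta>G: "\<delta> \<in> \<G>" using N(2) by (simp add: \<G>_def)
    ultimately have "A'' \<subseteq> \<delta>" using open_simplex[OF _ a(1)] by blast
    then have "y \<in> \<delta>" using y_mem[OF \<delta>G] by blast
    then show False using A''(3) N(2) unfolding y_def by blast
  qed
  have "relative_fan \<Sigma> P'"
    unfolding relative_fan_def
  proof (intro conjI allI impI ballI)
    have \<Sigma>P': "\<sigma> \<in> \<Sigma>" if "(\<sigma>, A) \<in> P'" for \<sigma> A
      using that relative_fanD(2)[OF P] L(2) unfolding P'_iff inner_def by blast
    have "P' \<subseteq> \<Sigma> \<times> T" using \<Sigma>P' unfolding P'_def by auto
    then show "finite P'"
      using finite_subset finite_cartesian_product semifanD(1)[OF \<Sigma>] simplicial_coverD(1)[OF T]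
      by blast
    show "\<sigma> \<in> \<Sigma>" "finite A" "A \<subseteq> W" if A: "(\<sigma>, A) \<in> P'" for \<sigma> A
    proof -
      have "A \<in> T" using A unfolding P'_iff by blast
      then show "finite A" "A \<subseteq> W" using simplicial_coverD(2,3)[OF T] by auto
      show "\<sigma> \<in> \<Sigma>" using \<Sigma>P'[OF A] .
    qed
    show "(\<phi>, A') \<in> P'" if A: "(\<sigma>, A) \<in> P'" and F: "polycone_face \<phi> \<sigma>" "A' \<subseteq> A" for \<sigma> A \<phi> A'
    proof -
      have A'T: "A' \<in> T" using A simplicial_coverD(4)[OF T _ F(2)] unfolding P'_iff by blast
      consider "inner \<sigma> A" | "\<sigma> = L" "outer A" using A unfolding P'_iff by blast
      then show ?thesis
      proof cases
        case 1
        then obtain B where B: "(\<sigma>, B) \<in> P" "A \<subseteq> join L B" unfolding inner_def by blast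
        have "(\<phi>, B) \<in> P" using relative_fanD(5)[OF P B(1) F(1)] by simp
        moreover have "A' \<subseteq> join L B" using B(2) F(2) by blast
        ultimately show ?thesis using A'T unfolding P'_iff inner_def by blast
      next
        case 2
        note fe = face_extreme[OF ccL F(1)[unfolded 2(1)]]
        have "x \<in> \<phi>" if x: "x \<in> L" for x
          using fe(3)[OF x subspace_neg[OF L(1) x]] convex_cone_contains_0[OF fe(2)] by simp
        then have "\<phi> = L" using fe(1) by blast
        moreover have "outer A'" using 2(2) F(2) unfolding outer_def by blast
        ultimately show ?thesis using A'T unfolding P'_iff by blast
      qed
    qed
    show "(\<sigma>, {}) \<in> P'" if "\<sigma> \<in> \<Sigma>" for \<sigma>
    proof -
      have "{} \<in> T" using simplicial_coverD(5)[OF T] simplicial_coverD(4)[OF T _ empty_subsetI] by blast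
      then show ?thesis using relative_fanD(6)[OF P that] unfolding P'_iff inner_def by blast
    qed
    fix \<sigma> A \<sigma>' A' s s' c c'
    assume A: "(\<sigma>, A) \<in> P'" "(\<sigma>', A') \<in> P'" and s: "s \<in> \<sigma>" "s' \<in> \<sigma>'"
      and c: "c \<in> nonneg_on A" "c' \<in> nonneg_on A'"
      and eq: "s + lincomb c = s' + lincomb c'"
    have AT: "A \<in> T" "A' \<in> T" using A unfolding P'_iff by auto
    \<comment> \<open>Settles all cases with base points in \<open>L\<close>. Outer pairs have base
      \<open>L\<close>, and \<open>inner_outer\<close> reduces the mixed case to this one.\<close>
    have TU: "c = c'" if "s \<in> L" "s' \<in> L"
      using simplicial_cover_unique(2)[OF T AT that c eq] .
    have "c = c'"
    proof (cases "inner \<sigma> A")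
      case in1: True
      show ?thesis
      proof (cases "inner \<sigma>' A'")
        case in2: True
        obtain B m d where B: "(\<sigma>, B) \<in> P" "m \<in> L" "d \<in> nonneg_on B" "lincomb c = m + lincomb d"
          using innerE[OF in1 AT(1) c(1)] by blast
        obtain B' m' d' where B': "(\<sigma>', B') \<in> P" "m' \<in> L" "d' \<in> nonneg_on B'"
          "lincomb c' = m' + lincomb d'"
          using innerE[OF in2 AT(2) c(2)] by blast
        have \<sigma>: "\<sigma> \<in> \<Sigma>" "\<sigma>' \<in> \<Sigma>" using relative_fanD(2)[OF P] B(1) B'(1) by auto
        have sm: "s + m \<in> \<sigma>" "s' + m' \<in> \<sigma>'"
          using s B(2) B'(2) L\<sigma> \<sigma> convex_cone_add[OF semifanD(3)[OF \<Sigma>]] by blast+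
        have "(s + m) + lincomb d = (s' + m') + lincomb d'" using eq B(4) B'(4) by (simp add: add.assoc)
        \<comment> \<open>Uniqueness in \<open>P\<close> gives equal \<open>d\<close>, but
          \<open>m\<close> and \<open>m'\<close> may differ; uniqueness in \<open>T\<close> modulo
          \<open>L\<close> then compares \<open>c\<close> with \<open>c'\<close>.\<close>
        then have "lincomb d = lincomb d'"
          using relative_fan_unique(2)[OF P B(1) B'(1) sm B(3) B'(3)] by simp
        then have "- m + lincomb c = - m' + lincomb c'" using B(4) B'(4) by simp
        then show ?thesis
          using simplicial_cover_unique(2)[OF T AT _ _ c] B(2) B'(2) subspace_neg[OF L(1)] by blast
      next
        case False
        then have o: "\<sigma>' = L" "outer A'" using A(2) unfolding P'_iff by auto
        then have "s \<in> L" using inner_outer[OF in1 AT(1) s(1) c(1) o(2) AT(2) _ c(2) eq] s(2) by simp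
        then show ?thesis using TU s(2) o by simp
      qed
    next
      case False
      then have o: "\<sigma> = L" "outer A" using A(1) unfolding P'_iff by auto
      have "s' \<in> L"
      proof (cases "inner \<sigma>' A'")
        case in2: True
        then show ?thesis
          using inner_outer[OF in2 AT(2) s(2) c(2) o(2) AT(1) _ c(1) eq[symmetric]] s(1) o by simp
      next
        case False
        then show ?thesis using A(2) s(2) unfolding P'_iff by auto
      qed
      then show ?thesis using TU s(1) o by simp
    qed
    then show "c = c'" "s = s'" using eq by auto
  qed
  moreover have "x \<in> \<Union>(cones P')" for x
  proof (cases "x \<in> \<Union>\<Delta>")
    case True
    then obtain \<delta> where "\<delta> \<in> cones P" "x \<in> \<delta>" unfolding \<Delta>_def by blast
    then obtain \<sigma> B where B: "(\<sigma>, B) \<in> P" "x \<in> join \<sigma> B" by (auto elim: conesE)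
    obtain s d where s: "s \<in> \<sigma>" "d \<in> nonneg_on B" "x = s + lincomb d" using B(2) by (rule joinE)
    \<comment> \<open>Only \<open>lincomb d\<close> is rewritten over \<open>T\<close>; its
      component in \<open>L\<close> is moved to the base point, which remains in \<sigma>.\<close>
    obtain A l c where A: "A \<in> T" "l \<in> L" "c \<in> nonneg_on A" "\<forall>b\<in>A. 0 < c b" "lincomb d = l + lincomb c"
      using support[of "lincomb d"] by blast
    have "join L B \<in> \<G>" using conesI[OF LB[OF B(1)]] by (simp add: \<G>_def \<Delta>_def)
    moreover have "l + lincomb c \<in> join L B" using joinI[OF L0 s(2)] A(5) by simp
    ultimately have "A \<subseteq> join L B" using compat[OF _ A(1,3) _ A(2)] A(4) by blast
    then have "(\<sigma>, A) \<in> P'" using A(1) B(1) unfolding P'_iff inner_def by blast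
    moreover have "s + l \<in> \<sigma>"
      using s(1) A(2) L\<sigma>[OF relative_fanD(2)[OF P B(1)]]
        convex_cone_add[OF semifanD(3)[OF \<Sigma> relative_fanD(2)[OF P B(1)]]] by blast
    then have "(s + l) + lincomb c \<in> join \<sigma> A" using joinI A(3) by blast
    moreover have "x = (s + l) + lincomb c" using s(3) A(5) by (simp add: add.assoc)
    ultimately show ?thesis using conesI by (metis UnionI)
  next
    case False
    obtain A l c where A: "A \<in> T" "l \<in> L" "c \<in> nonneg_on A" "\<forall>b\<in>A. 0 < c b" "x = l + lincomb c"
      using support[of x] by blast
    have "(\<Sum>b\<in>A. b) \<notin> \<Union>\<Delta>"
    proof
      assume "(\<Sum>b\<in>A. b) \<in> \<Union>\<Delta>"
      then obtain \<delta> where \<delta>: "\<delta> \<in> \<Delta>" "(\<Sum>b\<in>A. b) \<in> \<delta>" by blast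
      have "0 + lincomb (ind A) \<in> \<delta>" using \<delta>(2) lincomb_ind[OF finT[OF A(1)]] by simp
      moreover have "\<delta> \<in> \<G>" using \<delta>(1) by (simp add: \<G>_def)
      ultimately have "A \<subseteq> \<delta>" using compat[OF _ A(1) ind _ L0] by (auto simp: ind_def)
      then have "cone_hull A \<subseteq> \<delta>"
        using cone_hull_least[OF semifanD(3)[OF \<Delta> \<delta>(1)] _ finT[OF A(1)]] by blast
      then have "x \<in> \<delta>"
        unfolding A(5) using convex_cone_add[OF semifanD(3)[OF \<Delta> \<delta>(1)]] cone_hullI[OF A(3)] A(2)
          L\<Delta>[OF \<delta>(1)] by blast
      then show False using False \<delta>(1) by blast
    qed
    then have "(L, A) \<in> P'" using A(1) unfolding P'_iff outer_def by blast
    moreover have "x \<in> join L A" unfolding A(5) using joinI[OF A(2,3)] .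
    ultimately show ?thesis using conesI by (metis UnionI)
  qed
  ultimately show ?thesis by blast
qed

section \<open>Induction on the codimension of the lineality space\<close>

lemma dim_less:
  assumes "subspace L" "subspace L'" "L \<subset> L'"
  shows "dim L < dim (L' :: 'a set)"
proof -
  obtain B where B: "B \<subseteq> L" "independent B" "L \<subseteq> span B"
    using maximal_independent_subset by blast
  obtain B' where B': "B \<subseteq> B'" "B' \<subseteq> L'" "independent B'" "L' \<subseteq> span B'"
    using maximal_independent_subset_extend[of B L'] B assms(3) by blast
  have "dim L = card B" using dim_unique[OF B(1,3,2) refl] .
  moreover have "dim L' = card B'" using dim_unique[OF B'(2,4,3) refl] .
  moreover have "B \<noteq> B'" using B(1) B'(4) assms span_minimal[of B L] by blast
  then have "card B < card B'"
    using B'(1) finite_independent[OF B'(3)] by (intro psubset_card_mono) auto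
  ultimately show ?thesis by simp
qed

text \<open>In an expansion of \<open>s\<close> by generators of \<sigma>, some summand is outside
  the subspace \<open>L\<close>. Its generator is \<open>r\<close> and its positive coefficient is
  \<open>\<eta>\<close>; subtracting it leaves a nonnegative combination.\<close>

lemma generators_off_lineality:
  assumes \<Sigma>: "semifan W \<Sigma>" and L: "subspace L"
  obtains R where "finite R" "R \<subseteq> W" "R \<subseteq> \<Union>\<Sigma> - L"
    "\<forall>\<sigma>\<in>\<Sigma>. \<forall>s\<in>\<sigma> - L. \<exists>r\<in>R. r \<in> \<sigma> \<and> (\<exists>\<eta>>0. s - \<eta> *\<^sub>R r \<in> \<sigma>)"
proof -
  have ex: "\<forall>\<sigma>\<in>\<Sigma>. \<exists>G. finite G \<and> G \<subseteq> W \<and> \<sigma> = cone_hull G"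
    using polycone_generators[OF semifanD(2)[OF \<Sigma>]] by blast
  obtain f where "\<forall>\<sigma>\<in>\<Sigma>. finite (f \<sigma>) \<and> f \<sigma> \<subseteq> W \<and> \<sigma> = cone_hull (f \<sigma>)"
    using bchoice[OF ex] by (rule exE)
  note f = this[rule_format]
  define R where "R = \<Union>(f ` \<Sigma>) - L"
  show ?thesis
  proof (rule that[of R])
    show "finite R" "R \<subseteq> W" using f semifanD(1)[OF \<Sigma>] by (auto simp: R_def)
    have "f \<sigma> \<subseteq> \<sigma>" if "\<sigma> \<in> \<Sigma>" for \<sigma> using f[OF that] cone_hull_incl[of "f \<sigma>"] by simp
    then show "R \<subseteq> \<Union>\<Sigma> - L" unfolding R_def by blast
  next
    show "\<forall>\<sigma>\<in>\<Sigma>. \<forall>s\<in>\<sigma> - L. \<exists>r\<in>R. r \<in> \<sigma> \<and> (\<exists>\<eta>>0. s - \<eta> *\<^sub>R r \<in> \<sigma>)"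
    proof (intro ballI)
      fix \<sigma> s assume \<sigma>: "\<sigma> \<in> \<Sigma>" and "s \<in> \<sigma> - L"
      then have s: "s \<in> \<sigma>" "s \<notin> L" by auto
      have G: "finite (f \<sigma>)" "\<sigma> = cone_hull (f \<sigma>)" using f[OF \<sigma>] by auto
      obtain c where c: "c \<in> nonneg_on (f \<sigma>)" "s = lincomb c"
        using s(1) G(2) by (auto simp: cone_hull_def)
      have sum: "s = (\<Sum>g\<in>f \<sigma>. c g *\<^sub>R g)" using lincomb_nonneg_on[OF G(1) c(1)] c(2) by simp
      obtain g where g: "g \<in> f \<sigma>" "c g *\<^sub>R g \<notin> L"
        using s(2) subspace_sum[OF L, of "f \<sigma>" "\<lambda>g. c g *\<^sub>R g"] sum by blast
      have gL: "g \<notin> L" "c g \<noteq> 0" using g(2) subspace_scale[OF L] subspace_0[OF L] by auto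
      then have pos: "0 < c g" using nonneg_onD(1)[OF c(1), of g] by simp
      have cc: "convex_cone \<sigma>" using semifanD(3)[OF \<Sigma> \<sigma>] .
      have incl: "f \<sigma> \<subseteq> \<sigma>" using cone_hull_incl[of "f \<sigma>"] G(2) by simp
      have "s - c g *\<^sub>R g = (\<Sum>b\<in>f \<sigma> - {g}. c b *\<^sub>R b)"
        using sum G(1) g(1) by (simp add: sum_diff1)
      also have "\<dots> \<in> \<sigma>"
        using incl nonneg_onD(1)[OF c(1)]
        by (intro convex_cone_sum[OF cc] convex_cone_scaleR[OF cc]) auto
      finally have "s - c g *\<^sub>R g \<in> \<sigma>" .
      moreover have "g \<in> R" "g \<in> \<sigma>" using g(1) gL(1) \<sigma> incl by (auto simp: R_def)
      ultimately show "\<exists>r\<in>R. r \<in> \<sigma> \<and> (\<exists>\<eta>>0. s - \<eta> *\<^sub>R r \<in> \<sigma>)" using pos by blast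
    qed
  qed
qed

text \<open>No base case is singled out: if the lineality space is everything, then \<open>R\<close>
  is empty and \<open>fill_complement\<close> applies at once. Otherwise the points of
  \<open>R\<close> are treated one by one; each star contains both \<open>L\<close> and
  \<open>r\<close> in its lineality space, so the induction hypothesis completes it.\<close>

lemma relative_completion:
  assumes "semifan W \<Sigma>" "\<Sigma> \<noteq> {}"
  shows "\<exists>P. relative_fan \<Sigma> P \<and> \<Union>(cones P) = UNIV"
proof -
  obtain B0 :: "'a set" where B0: "finite B0" "span B0 = UNIV" using finite_dimensional by blast
  \<comment> \<open>Ensures that the truncated difference used as induction measure really drops
    when the dimension grows.\<close>
  have dim_le: "dim L \<le> card B0" for L :: "'a set" using dim_le_card[of L B0] B0 by simp
  show ?thesis
    using assms
  proof (induction "card B0 - dim (\<Inter>\<Sigma>)" arbitrary: \<Sigma> rule: less_induct)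
    case less
    note \<Sigma> = less.prems(1)
    define L where "L = \<Inter>\<Sigma>"
    have L: "subspace L" using semifan_lineality(1)[OF less.prems] by (simp add: L_def)
    obtain R where R: "finite R" "R \<subseteq> W" "R \<subseteq> \<Union>\<Sigma> - L"
      and generators: "\<forall>\<sigma>\<in>\<Sigma>. \<forall>s\<in>\<sigma> - L. \<exists>r\<in>R. r \<in> \<sigma> \<and> (\<exists>\<eta>>0. s - \<eta> *\<^sub>R r \<in> \<sigma>)"
      using generators_off_lineality[OF \<Sigma> L] .
    have "\<exists>P. relative_fan \<Sigma> P \<and> (\<forall>r\<in>R'. star_complete r (cones P))" if "R' \<subseteq> R" for R'
      using finite_subset[OF that R(1)] that
    proof (induction R' rule: finite_induct)
      case empty
      then show ?case using relative_fan_base[OF \<Sigma>] by blast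
    next
      case (insert r R')
      then obtain P where P: "relative_fan \<Sigma> P" "\<forall>r\<in>R'. star_complete r (cones P)" by blast
      have r: "r \<in> W" "r \<in> \<Union>\<Sigma>" "r \<notin> L" using insert.prems R by auto
      have \<Delta>: "semifan W (cones P)" using semifan_cones[OF \<Sigma> P(1)] .
      have star: "semifan W (star r (cones P))" using semifan_star[OF \<Delta> r(1)] .
      obtain \<sigma>0 where "\<sigma>0 \<in> cones P" "r \<in> \<sigma>0" using r(2) cones_superset[OF P(1)] by blast
      then have ne: "star r (cones P) \<noteq> {}" unfolding star_def by blast
      have "L \<union> {r} \<subseteq> \<kappa>" if \<kappa>: "\<kappa> \<in> star r (cones P)" for \<kappa>
      proof -
        obtain \<delta> where \<delta>: "\<delta> \<in> cones P" "r \<in> \<delta>" "\<kappa> = join \<delta> {- r}"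
          using \<kappa> unfolding star_def by blast
        obtain \<sigma> B where B: "(\<sigma>, B) \<in> P" "\<delta> = join \<sigma> B" using \<delta>(1) by (rule conesE)
        have "L \<subseteq> \<sigma>" using relative_fanD(2)[OF P(1) B(1)] by (auto simp: L_def)
        then have "L \<subseteq> \<delta>" unfolding B(2) using join_base by blast
        then show ?thesis using \<delta>(2,3) join_base by blast
      qed
      then have sub: "L \<union> {r} \<subseteq> \<Inter>(star r (cones P))" by blast
      then have "L \<subset> \<Inter>(star r (cones P))" using r(3) by blast
      then have "dim L < dim (\<Inter>(star r (cones P)))"
        using dim_less[OF L semifan_lineality(1)[OF star ne]] by blast
      then have "card B0 - dim (\<Inter>(star r (cones P))) < card B0 - dim (\<Inter>\<Sigma>)"
        using dim_le[of "\<Inter>(star r (cones P))"] unfolding L_def by linarith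
      then obtain Q where Q: "relative_fan (star r (cones P)) Q" "\<Union>(cones Q) = UNIV"
        using less.hyps[OF _ star ne] by blast
      obtain P1 where P1: "relative_fan (cones P) P1" "star_complete r (cones P1)"
        using lift_star[OF \<Delta> r(1) Q] .
      obtain P' where P': "relative_fan \<Sigma> P'" "cones P' = cones P1"
        using relative_fan_compose[OF \<Sigma> P(1) P1(1)] .
      \<comment> \<open>All earlier cones are kept, so completeness at the points already treated
        persists.\<close>
      have "cones P \<subseteq> cones P'" using cones_superset[OF P1(1)] P'(2) by simp
      then have "\<forall>r\<in>insert r R'. star_complete r (cones P')"
        using P(2) P1(2) P'(2) star_complete_mono by auto
      then show ?case using P'(1) by blast
    qed
    then obtain P where P: "relative_fan \<Sigma> P" "\<forall>r\<in>R. star_complete r (cones P)" by blast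
    show ?case
    proof (rule fill_complement[OF less.prems P(1) R(1,2)])
      show "\<exists>r\<in>R. r \<in> \<sigma> \<and> (\<exists>\<eta>>0. s - \<eta> *\<^sub>R r \<in> \<sigma>)"
        if "\<sigma> \<in> \<Sigma>" "s \<in> \<sigma>" "s \<notin> \<Inter>\<Sigma>" for \<sigma> s
        using generators[rule_format, of \<sigma> s] that unfolding L_def by simp
      show "star_complete r (cones P)" if "r \<in> R" for r using P(2) that by simp
    qed
  qed
qed

section \<open>Simpliciality and conclusion\<close>

lemma semifan_0: "semifan W {{0}}"
proof -
  have "\<tau> = {0}" if "polycone_face \<tau> {0 :: 'a}" for \<tau>
    using that linear_0 unfolding polycone_face_def by blast
  then show ?thesis by (simp add: semifan_def polycone_0 face_refl)
qed

text \<open>If \<open>C\<close> is an independent set generating \<sigma>, then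
  \<open>C \<union> B\<close> generates the join. Splitting a linear relation into positive and
  negative parts yields two expressions of one point; uniqueness kills the coefficients on
  \<open>B\<close>, and independence of \<open>C\<close> the others.\<close>

lemma simplicial_cones:
  assumes \<Sigma>: "simplicial_semifan W \<Sigma>" and P: "relative_fan \<Sigma> P"
  shows "simplicial_semifan W (cones P)"
  unfolding simplicial_semifan_def
proof
  have sf: "semifan W \<Sigma>" using \<Sigma> by (simp add: simplicial_semifan_def)
  show "semifan W (cones P)" by (rule semifan_cones[OF sf P])
  show "\<forall>\<kappa>\<in>cones P. simplicial_cone \<kappa>"
  proof
    fix \<kappa> assume "\<kappa> \<in> cones P"
    then obtain \<sigma> B where B: "(\<sigma>, B) \<in> P" "\<kappa> = join \<sigma> B" by (rule conesE)
    have \<sigma>: "\<sigma> \<in> \<Sigma>" "convex_cone \<sigma>" using relative_fanD(2)[OF P B(1)] semifanD(3)[OF sf] by auto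
    obtain C where C: "independent C" "\<sigma> = convex_cone hull C"
      using \<Sigma> \<sigma>(1) unfolding simplicial_semifan_def simplicial_cone_def by blast
    have fin: "finite C" "finite B" using finite_independent[OF C(1)] relative_fanD(3)[OF P B(1)] .
    have jn0: "join {0} D = cone_hull D" for D :: "'a set" by (simp add: join_def)
    have "\<kappa> = join (join {0} C) B" using B(2) C(2) by (simp add: jn0 cone_hull_eq_hull[OF fin(1)])
    also have "\<dots> = join {0} (C \<union> B)" using join_Un[OF fin] .
    also have "\<dots> = convex_cone hull (C \<union> B)" using fin by (simp add: jn0 cone_hull_eq_hull)
    finally have hull: "\<kappa> = convex_cone hull (C \<union> B)" .
    have C\<sigma>: "C \<subseteq> \<sigma>" unfolding C(2) by (rule hull_subset)
    have 0: "0 \<in> \<sigma>" using convex_cone_contains_0[OF \<sigma>(2)] .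
    have disj: "C \<inter> B = {}"
    proof (rule ccontr)
      assume "C \<inter> B \<noteq> {}"
      then obtain b where b: "b \<in> \<sigma>" "b \<in> B" using C\<sigma> by blast
      have "b + lincomb (\<lambda>_. 0) = 0 + lincomb (\<lambda>x. if x = b then 1 else 0)" by simp
      then have "(\<lambda>_. 0) = (\<lambda>x. if x = b then 1 else (0::real))"
        using relative_fan_unique(2)[OF P B(1,1) b(1) 0] nonneg_on_single[OF b(2), of 1] by simp
      then show False by (metis zero_neq_one)
    qed
    have "independent (C \<union> B)"
    proof (rule independent_if_scalars_zero)
      show "finite (C \<union> B)" using fin by simp
      fix f x assume f: "(\<Sum>x\<in>C \<union> B. f x *\<^sub>R x) = 0" and x: "x \<in> C \<union> B"
      define s s' where "s = (\<Sum>v\<in>C. max (f v) 0 *\<^sub>R v)" and "s' = (\<Sum>v\<in>C. max (- f v) 0 *\<^sub>R v)"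
      define c c' where "c = (\<lambda>v. if v \<in> B then max (f v) 0 else 0)"
        and "c' = (\<lambda>v. if v \<in> B then max (- f v) 0 else 0)"
      have s: "s \<in> \<sigma>" "s' \<in> \<sigma>"
        unfolding s_def s'_def using C\<sigma>
        by (auto intro!: convex_cone_sum[OF \<sigma>(2)] convex_cone_scaleR[OF \<sigma>(2)])
      have c: "c \<in> nonneg_on B" "c' \<in> nonneg_on B" by (auto simp: c_def c'_def nonneg_on_def)
      have max_diff: "max (f v) 0 *\<^sub>R v - max (- f v) 0 *\<^sub>R v = f v *\<^sub>R v" for v
        by (simp add: scaleR_left_diff_distrib[symmetric] max_def)
      have ss: "s - s' = (\<Sum>v\<in>C. f v *\<^sub>R v)"
        by (simp add: s_def s'_def sum_subtractf[symmetric] max_diff)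
      have "lincomb c - lincomb c' = (\<Sum>v\<in>B. f v *\<^sub>R v)"
        by (simp add: lincomb_nonneg_on[OF fin(2)] c) (simp add: c_def c'_def sum_subtractf[symmetric] max_diff)
      then have "(s - s') + (lincomb c - lincomb c') = 0"
        using f sum.union_disjoint[OF fin disj, of "\<lambda>v. f v *\<^sub>R v"] ss by simp
      then have "s + lincomb c = s' + lincomb c'" by (simp add: algebra_simps)
      note u = relative_fan_unique[OF P B(1,1) s c this]
      show "f x = 0"
      proof (cases "x \<in> B")
        case True
        then show ?thesis using fun_cong[OF u(2), of x]
          by (simp add: c_def c'_def max_def split: if_splits)
      next
        case False
        have "(\<Sum>v\<in>C. f v *\<^sub>R v) = 0" using u(1) ss by simp
        then show ?thesis using independentD[OF C(1) fin(1) subset_refl] False x by blast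
      qed
    qed
    then show "simplicial_cone \<kappa>" using hull unfolding simplicial_cone_def by blast
  qed
qed

end

lemma rational_structure_K_structure:
  fixes K :: "real set" and W :: "'a::real_vector set"
  assumes "\<exists>B :: 'a set. finite B \<and> span B = UNIV"
    and "subfield_of_reals K" and "K_structure K W"
  shows "rational_structure K W"
proof
  show "sub_vector_space K W" using assms(3) by (simp add: K_structure_def)
  show "representation B w b \<in> K"
    if "B \<subseteq> W" "independent B" "span B = UNIV" "w \<in> W" for B w b
    using K_structure_representation[OF assms(2,3) that(1-3) _ that(4)]
      independent_span_bound[of _ B] assms(1) that(2) by blast
qed (use assms K_structure_span in auto)

theorem mainTheorem1:
  fixes K :: "real set" and W :: "'a::real_vector set"
  assumes "\<exists>B :: 'a set. finite B \<and> span B = UNIV"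
    and "subfield_of_reals K"
    and "K_structure K W"
  shows "(\<forall>\<Sigma>. semifan W \<Sigma> \<longrightarrow> (\<exists>\<Sigma>'. semifan_completion W \<Sigma> \<Sigma>')) \<and>
         (\<forall>\<Sigma>. simplicial_semifan W \<Sigma> \<longrightarrow>
              (\<exists>\<Sigma>'. semifan_completion W \<Sigma> \<Sigma>' \<and> simplicial_semifan W \<Sigma>'))"
proof -
  interpret rational_structure K W
    using assms by (rule rational_structure_K_structure)
  have completion: "\<exists>\<Sigma>'. semifan_completion W \<Sigma> \<Sigma>' \<and>
      (simplicial_semifan W \<Sigma> \<longrightarrow> simplicial_semifan W \<Sigma>')" if \<Sigma>: "semifan W \<Sigma>" for \<Sigma>
  proof -
    \<comment> \<open>A relative fan over the empty semifan has no cones and covers nothing, so the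
      zero cone, which is simplicial, is put in first.\<close>
    define \<Sigma>0 where "\<Sigma>0 = (if \<Sigma> = {} then {{0}} else \<Sigma>)"
    have \<Sigma>0: "semifan W \<Sigma>0" "\<Sigma>0 \<noteq> {}" "\<Sigma> \<subseteq> \<Sigma>0"
      using \<Sigma> semifan_0 by (auto simp: \<Sigma>0_def)
    obtain P where P: "relative_fan \<Sigma>0 P" "\<Union>(cones P) = UNIV"
      using relative_completion[OF \<Sigma>0(1,2)] by blast
    have "semifan_completion W \<Sigma> (cones P)"
      using semifan_cones[OF \<Sigma>0(1) P(1)] P(2) cones_superset[OF P(1)] \<Sigma>0(3)
      unfolding semifan_completion_def complete_semifan_def by blast
    moreover have "simplicial_semifan W (cones P)" if "simplicial_semifan W \<Sigma>"
    proof (rule simplicial_cones[OF _ P(1)])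
      have "simplicial_cone {0 :: 'a}"
        unfolding simplicial_cone_def by (intro exI[of _ "{}"]) (simp add: independent_empty)
      then show "simplicial_semifan W \<Sigma>0"
        using that \<Sigma>0(1) by (simp add: simplicial_semifan_def \<Sigma>0_def split: if_splits)
    qed
    ultimately show ?thesis by blast
  qed
  show ?thesis
    using completion unfolding simplicial_semifan_def by metis
qed

end
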